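(* Let $\Omega \subset \mathbb{R}^n$ be a bounded domain, $d(x)=\operatorname{dist}(x,\partial\Omega)$, and $\tau\in(0,1)$. If $1<p<\infty$ and $f\in L^p(\Omega)$, then $$ \lim_{s\nearrow 1} (1-s) \int_\Omega \int_{\{y:\,|x-y|<\tau d(x)\}} \frac{|f(y)-f(x)|^p}{|x-y|^{n+sp}} \, dy \, dx = K_{n,p} \int_\Omega |\nabla f (x)|^p \, dx, $$ where $K_{n,p}= \frac{1}{p} \int_{\mathbb{S}^{n-1}} |\sigma_n|^p \, d\sigma$ (with $\sigma_n$ the $n$-th coordinate of $\sigma\in\mathbb{S}^{n-1}$), and with the convention that $\int_\Omega|\nabla f|^p=\infty$ if $f\notin W^{1,p}(\Omega)$.
   Context: Note that if $|x-y|<\tau d(x)$ with $x\in\Omega$, then $y\in\Omega$, so the inner integral is over a ball contained in $\Omega$. The statement includes that the limit exists (possibly $+\infty$), and in particular that if $f\notin W^{1,p}(\Omega)$ then the limit is $+\infty$. *)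

theory Defs
  imports "HOL-Analysis.Analysis"
begin

definition partial_deriv :: "'n::finite \<Rightarrow> (real^'n \<Rightarrow> real) \<Rightarrow> real^'n \<Rightarrow> real" where
  "partial_deriv i \<phi> x = frechet_derivative \<phi> (at x) (axis i 1)"

definition smooth_fun :: "(real^'n::finite \<Rightarrow> real) \<Rightarrow> bool" where
  "smooth_fun \<phi> \<longleftrightarrow> (\<forall>is :: 'n list. \<forall>x. foldr partial_deriv is \<phi> differentiable (at x))"

definition test_fun :: "(real^'n::finite) set \<Rightarrow> (real^'n \<Rightarrow> real) \<Rightarrow> bool" where
  "test_fun \<Omega> \<phi> \<longleftrightarrow> smooth_fun \<phi> \<and> compact (closure {x. \<phi> x \<noteq> 0})
      \<and> closure {x. \<phi> x \<noteq> 0} \<subseteq> \<Omega>"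

definition weak_gradient :: "(real^'n::finite) set \<Rightarrow> (real^'n \<Rightarrow> real) \<Rightarrow> (real^'n \<Rightarrow> real^'n) \<Rightarrow> bool" where
  "weak_gradient \<Omega> f g \<longleftrightarrow>
     (\<forall>i. \<forall>K. compact K \<and> K \<subseteq> \<Omega> \<longrightarrow> set_integrable lebesgue K (\<lambda>x. g x $ i)) \<and>
     (\<forall>\<phi> i. test_fun \<Omega> \<phi> \<longrightarrow>
        (LINT x:\<Omega>|lebesgue. f x * partial_deriv i \<phi> x) = - (LINT x:\<Omega>|lebesgue. g x $ i * \<phi> x))"

text \<open>The integral of |grad f|^p over Omega, with the convention that it is infinite
  if f has no weak gradient (if the weak gradient exists but is not in L^p the
  integral is infinite anyway).\<close>
definition grad_energy :: "(real^'n::finite) set \<Rightarrow> (real^'n \<Rightarrow> real) \<Rightarrow> real \<Rightarrow> ennreal" where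
  "grad_energy \<Omega> f p =
     (if \<exists>g. weak_gradient \<Omega> f g
      then (\<integral>\<^sup>+ x\<in>\<Omega>. ennreal (norm ((SOME g. weak_gradient \<Omega> f g) x) powr p) \<partial>lebesgue)
      else \<infinity>)"

text \<open>Surface measure on the unit sphere, defined as the cone measure:
  sigma(A) = n * Lebesgue measure of {r x : 0 < r <= 1, x in A}.\<close>
definition sphere_measure :: "('a::euclidean_space) measure" where
  "sphere_measure = measure_of (sphere 0 1) (sets (restrict_space lborel (sphere 0 1)))
     (\<lambda>A. of_nat DIM('a) * emeasure lborel {r *\<^sub>R x | r x. r \<in> {0<..1} \<and> x \<in> A})"

definition K_const :: "'n::finite \<Rightarrow> real \<Rightarrow> ennreal" where
  "K_const i p = ennreal (1 / p) *
     (\<integral>\<^sup>+ \<sigma>. ennreal (\<bar>\<sigma> $ i\<bar> powr p) \<partial>(sphere_measure :: (real^'n) measure))"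

end

(* The argument works with Borel representatives and b = p (1 - s), so that the kernel is
   |h|^(b - n - p) and its mass concentrates at h = 0 as b tends to 0. In polar coordinates the
   integral of |v.h|^p |h|^(b - n - p) over a ball of radius r is (p / b) r^b K |v|^p.

   If f has a weak gradient g, then for every h the difference f(x + h) - f(x) is almost everywhere
   the integral of g(x + t h).h over t in [0, 1]. Jensen's inequality and Tonelli give the upper
   bound, whatever b is. For the lower bound, the convexity of |.|^p and the continuity
   of translations in L^1 compare difference quotients with g on a compact set on which g is bounded.

   If the energies stay bounded along a sequence s -> 1, then averages of the difference quotients
   over slowly shrinking balls are bounded in L^p and converge to the distributional partial
   derivatives of f when tested; a weak L^1 limit of these averages is then a weak gradient. Hence
   the energies tend to infinity if there is none. *)

theory Submission
  imports Defs
begin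

section \<open>Invariance of Lebesgue measure\<close>

text \<open>The factor 1/p in the constant comes from b = p (1 - s): the factors 1 - s and p / b
  cancel. The radii of the balls enter the bounds only as R^b and r^b, which tend to 1, so
  \<open>\<tau>\<close> leaves no trace in the limit. The domain has no boundary regularity, so
  \<open>f\<close> is never approximated by smooth functions; every derivative is put on a test
  function instead. One argument covers all weak gradients \<open>g\<close>: if |g|^p has infinite
  integral the upper bound is void, and the lower bound still grows without limit as the sets on
  which \<open>g\<close> is bounded exhaust \<open>\<Omega>\<close>. Without a weak gradient, one
  has to be constructed. The integrals of the averages against test functions are known to converge,
  so all that is missing is a function representing these limits. It is found by minimising a
  strictly convex integral of linear growth, which takes the place of weak compactness.\<close>

lemma nn_integral_lborel_translate:
  fixes f :: "'a::euclidean_space \<Rightarrow> ennreal"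
  assumes [measurable]: "f \<in> borel_measurable borel"
  shows "(\<integral>\<^sup>+x. f (x + c) \<partial>lborel) = (\<integral>\<^sup>+x. f x \<partial>lborel)"
proof -
  have "(\<integral>\<^sup>+x. f x \<partial>lborel) = (\<integral>\<^sup>+x. f x \<partial>(distr lborel borel ((+) c)))"
    by (simp add: lborel_distr_plus)
  also have "\<dots> = (\<integral>\<^sup>+x. f (c + x) \<partial>lborel)"
    by (subst nn_integral_distr) auto
  finally show ?thesis by (simp add: add.commute)
qed

lemma nn_integral_lborel_scaleR:
  fixes f :: "'a::euclidean_space \<Rightarrow> ennreal"
  assumes [measurable]: "f \<in> borel_measurable borel" and "c \<noteq> 0"
  shows "(\<integral>\<^sup>+x. f x \<partial>lborel) = ennreal (\<bar>c\<bar> ^ DIM('a)) * (\<integral>\<^sup>+x. f (c *\<^sub>R x) \<partial>lborel)"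
proof -
  have "(\<integral>\<^sup>+x. f x \<partial>lborel) = (\<integral>\<^sup>+x. f x \<partial>(density (distr lborel borel (\<lambda>x. 0 + c *\<^sub>R x)) (\<lambda>_. \<bar>c\<bar>^DIM('a))))"
    using lborel_affine[OF assms(2), of "0::'a"] by simp
  also have "\<dots> = (\<integral>\<^sup>+x. ennreal (\<bar>c\<bar>^DIM('a)) * f (c *\<^sub>R x) \<partial>lborel)"
    by (simp add: nn_integral_density nn_integral_distr)
  also have "\<dots> = ennreal (\<bar>c\<bar> ^ DIM('a)) * (\<integral>\<^sup>+x. f (c *\<^sub>R x) \<partial>lborel)"
    by (simp add: nn_integral_cmult)
  finally show ?thesis .
qed

text \<open>Uniqueness of translation-invariant measures, carried out on integrals: the image
  \<open>M\<close> of Lebesgue measure under \<open>T\<close> is translation invariant, hence a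
  multiple of it, and the factor is 1 because \<open>T\<close> preserves the unit ball. Rotations
  later reduce the direction of a gradient to one coordinate.\<close>

lemma nn_integral_lborel_orthogonal:
  fixes f :: "'a::euclidean_space \<Rightarrow> ennreal" and T :: "'a \<Rightarrow> 'a"
  assumes [measurable]: "f \<in> borel_measurable borel" and T: "orthogonal_transformation T"
  shows "(\<integral>\<^sup>+x. f (T x) \<partial>lborel) = (\<integral>\<^sup>+x. f x \<partial>lborel)"
proof -
  have lin: "linear T" using T by (rule orthogonal_transformation_linear)
  have [measurable]: "T \<in> borel_measurable borel"
    by (intro borel_measurable_continuous_onI linear_continuous_on linear_conv_bounded_linear[THEN iffD1] lin)
  define M where "M = distr lborel borel T"
  have [measurable_cong]: "sets M = sets borel" by (simp add: M_def)
  have nM: "(\<integral>\<^sup>+x. u x \<partial>M) = (\<integral>\<^sup>+x. u (T x) \<partial>lborel)" if "u \<in> borel_measurable borel" for u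
    using that by (simp add: M_def nn_integral_distr)
  have surjT: "\<exists>z. T z = y" for y
    using orthogonal_transformation_surj[OF T] by (metis surjE)
  have M_translate: "(\<integral>\<^sup>+x. u (x + y) \<partial>M) = (\<integral>\<^sup>+x. u x \<partial>M)" if [measurable]: "u \<in> borel_measurable borel" for u y
  proof -
    obtain z where z: "y = T z" using surjT by metis
    have "(\<integral>\<^sup>+x. u (x + y) \<partial>M) = (\<integral>\<^sup>+x. u (T (x + z)) \<partial>lborel)"
      by (subst nM) (auto simp: z linear_add[OF lin])
    also have "\<dots> = (\<integral>\<^sup>+x. u (T x) \<partial>lborel)"
      by (rule nn_integral_lborel_translate[of "\<lambda>x. u (T x)"]) simp
    finally show ?thesis by (simp add: nM)
  qed
  \<comment> \<open>A weight of positive finite mass. The double integral of B(y) f(x + y) is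
    evaluated with translation invariance of \<open>M\<close> in one variable and of Lebesgue
    measure in the other; the mass of \<open>B\<close> then cancels.\<close>
  define B where "B = (indicator (cball 0 1) :: 'a \<Rightarrow> ennreal)"
  have [measurable]: "B \<in> borel_measurable borel" unfolding B_def by (intro borel_measurable_indicator) simp
  have B_sym: "B (- x) = B x" for x by (simp add: B_def indicator_def)
  have B_T: "B (T x) = B x" for x
    by (simp add: B_def indicator_def orthogonal_transformation_norm[OF T])
  have MB: "(\<integral>\<^sup>+x. B x \<partial>M) = (\<integral>\<^sup>+x. B x \<partial>lborel)" by (simp add: nM B_T)
  have Bval: "(\<integral>\<^sup>+x. B x \<partial>lborel) = emeasure lborel (cball 0 (1::real) :: 'a set)"
    by (simp add: B_def)
  have Bpos: "(\<integral>\<^sup>+x. B x \<partial>lborel) \<noteq> 0" "(\<integral>\<^sup>+x. B x \<partial>lborel) \<noteq> \<infinity>"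
  proof -
    have "emeasure lborel (ball 0 (1::real) :: 'a set) > 0"
      by (simp add: emeasure_ball)
    also have "emeasure lborel (ball 0 (1::real) :: 'a set) \<le> emeasure lborel (cball 0 (1::real) :: 'a set)"
      by (intro emeasure_mono) auto
    finally show "(\<integral>\<^sup>+x. B x \<partial>lborel) \<noteq> 0" by (simp add: Bval)
    show "(\<integral>\<^sup>+x. B x \<partial>lborel) \<noteq> \<infinity>"
      using emeasure_lborel_cball_finite[of "0::'a" 1] by (simp add: Bval)
  qed
  interpret S1: sigma_finite_measure M
  proof
    define A where "A = range (\<lambda>n::nat. cball (0::'a) (real n))"
    have "emeasure M (cball 0 (real n)) \<noteq> \<infinity>" for n
    proof -
      have "T -` cball 0 (real n) = cball 0 (real n)"
        by (auto simp: orthogonal_transformation_norm[OF T])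
      then have "emeasure M (cball 0 (real n)) = emeasure lborel (cball (0::'a) (real n))"
        by (simp add: M_def emeasure_distr)
      then show ?thesis
        using emeasure_lborel_cball_finite[of "0::'a" "real n"] by simp
    qed
    moreover have "\<Union>A = space M"
      by (auto simp: A_def M_def) (meson real_arch_simple)
    ultimately show "\<exists>A. countable A \<and> A \<subseteq> sets M \<and> \<Union>A = space M \<and> (\<forall>a\<in>A. emeasure M a \<noteq> \<infinity>)"
      by (intro exI[of _ A]) (auto simp: A_def M_def)
  qed
  interpret P: pair_sigma_finite M lborel by standard
  have "(\<integral>\<^sup>+x. f x \<partial>M) * (\<integral>\<^sup>+x. B x \<partial>lborel) = (\<integral>\<^sup>+y. \<integral>\<^sup>+x. B y * f x \<partial>M \<partial>lborel)"
    by (simp add: nn_integral_cmult nn_integral_multc mult.commute)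
  also have "\<dots> = (\<integral>\<^sup>+y. \<integral>\<^sup>+x. B y * f (x + y) \<partial>M \<partial>lborel)"
    by (simp add: nn_integral_cmult M_translate)
  also have "\<dots> = (\<integral>\<^sup>+x. \<integral>\<^sup>+y. B y * f (x + y) \<partial>lborel \<partial>M)"
    by (rule P.Fubini'[where f="\<lambda>x y. B y * f (x + y)"]) measurable
  also have "\<dots> = (\<integral>\<^sup>+x. \<integral>\<^sup>+y. B (y - x) * f y \<partial>lborel \<partial>M)"
  proof (rule nn_integral_cong)
    fix x
    show "(\<integral>\<^sup>+y. B y * f (x + y) \<partial>lborel) = (\<integral>\<^sup>+y. B (y - x) * f y \<partial>lborel)"
      using nn_integral_lborel_translate[of "\<lambda>y. B (y - x) * f y" x] by (simp add: add.commute)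
  qed
  also have "\<dots> = (\<integral>\<^sup>+y. \<integral>\<^sup>+x. B (y - x) * f y \<partial>M \<partial>lborel)"
    by (rule P.Fubini'[where f="\<lambda>x y. B (y - x) * f y", symmetric]) measurable
  also have "\<dots> = (\<integral>\<^sup>+y. (\<integral>\<^sup>+x. B x \<partial>lborel) * f y \<partial>lborel)"
  proof (rule nn_integral_cong)
    fix y
    have "(\<integral>\<^sup>+x. B (y - x) * f y \<partial>M) = (\<integral>\<^sup>+x. B (x + (- y)) \<partial>M) * f y"
      using B_sym[of "y - x" for x] by (simp add: nn_integral_multc)
    then show "(\<integral>\<^sup>+x. B (y - x) * f y \<partial>M) = (\<integral>\<^sup>+x. B x \<partial>lborel) * f y"
      using M_translate[of B "- y"] by (simp add: MB)
  qed
  also have "\<dots> = (\<integral>\<^sup>+x. f x \<partial>lborel) * (\<integral>\<^sup>+x. B x \<partial>lborel)"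
    by (simp add: nn_integral_cmult) (rule mult.commute)
  finally have "(\<integral>\<^sup>+x. f x \<partial>M) = (\<integral>\<^sup>+x. f x \<partial>lborel)"
    using Bpos by (metis ennreal_mult_divide_eq infinity_ennreal_def)
  then show ?thesis by (simp add: nM)
qed

section \<open>Continuity of translations in the mean\<close>

lemma integrable_lborel_translate:
  fixes g :: "'a::euclidean_space \<Rightarrow> 'b::{banach, second_countable_topology}"
  assumes "integrable lborel g"
  shows "integrable lborel (\<lambda>x. g (x + c))"
proof -
  have [measurable]: "g \<in> borel_measurable borel" using assms by auto
  show ?thesis
    using assms nn_integral_lborel_translate[of "\<lambda>x. ennreal (norm (g x))" c]
    by (simp add: integrable_iff_bounded)
qed

lemma integral_lborel_translate:
  fixes g :: "'a::euclidean_space \<Rightarrow> 'b::{banach, second_countable_topology}"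
  assumes [measurable]: "g \<in> borel_measurable borel"
  shows "(LINT x|lborel. g (x + c)) = (LINT x|lborel. g x)"
proof -
  have "(LINT x|lborel. g x) = (LINT x|distr lborel borel ((+) c). g x)"
    by (simp add: lborel_distr_plus)
  also have "\<dots> = (LINT x|lborel. g (c + x))"
    by (subst integral_distr) auto
  finally show ?thesis by (simp add: add.commute)
qed

text \<open>An open \<open>T\<close> slightly larger than \<open>A\<close> absorbs the translates:
  for x in \<open>A\<close> the points \<open>x + h k\<close> eventually lie in \<open>T\<close>, so
  dominated convergence works for \<open>T\<close> where pointwise convergence may fail for
  \<open>A\<close> itself.\<close>

lemma translate_indicator_tendsto:
  fixes A :: "'a::euclidean_space set" and h :: "nat \<Rightarrow> 'a"
  assumes [measurable]: "A \<in> sets borel" and fin: "emeasure lborel A < \<infinity>" and h: "h \<longlonglongrightarrow> 0"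
  shows "(\<lambda>k. LINT x|lborel. \<bar>indicator A (x + h k) - indicator A x\<bar> :: real) \<longlonglongrightarrow> 0"
proof (rule LIMSEQ_I)
  fix r :: real assume "r > 0"
  define e where "e = r / 4"
  have "e > 0" using \<open>r > 0\<close> by (simp add: e_def)
  obtain T where T: "open T" "A \<subseteq> T" "(T - A) \<in> lmeasurable" "emeasure lebesgue (T - A) < ennreal e"
    using sets_lebesgue_outer_open[of A e] \<open>e > 0\<close> by auto
  have [measurable]: "T \<in> sets borel" using T(1) by simp
  have TA: "emeasure lborel (T - A) < ennreal e" using T(4) by simp
  have iA: "integrable lborel (indicator A :: 'a \<Rightarrow> real)"
    using fin by (simp add: integrable_indicator_iff)
  have iTA: "integrable lborel (indicator (T - A) :: 'a \<Rightarrow> real)"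
    using TA by (simp add: integrable_indicator_iff) (metis ennreal_less_top order.strict_trans)
  have "(\<lambda>k. LINT x|lborel. indicator A x * indicator T (x + h k) :: real) \<longlonglongrightarrow> (LINT x|lborel. indicator A x)"
  proof (rule integral_dominated_convergence[where w="indicator A"])
    show "AE x in lborel. (\<lambda>k. indicator A x * indicator T (x + h k) :: real) \<longlonglongrightarrow> indicator A x"
    proof (rule AE_I2)
      fix x
      show "(\<lambda>k. indicator A x * indicator T (x + h k) :: real) \<longlonglongrightarrow> indicator A x"
      proof (cases "x \<in> A")
        case True
        have "(\<lambda>k. x + h k) \<longlonglongrightarrow> x + 0" by (intro tendsto_intros h)
        then have "eventually (\<lambda>k. x + h k \<in> T) sequentially"
          using T True by (auto simp: tendsto_def)
        then have "eventually (\<lambda>k. indicator A x * indicator T (x + h k) = (indicator A x :: real)) sequentially"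
          by eventually_elim (simp add: True)
        then show ?thesis by (rule tendsto_eventually)
      qed simp
    qed
  qed (auto simp: iA indicator_def)
  then obtain N where N: "\<And>k. k \<ge> N \<Longrightarrow> \<bar>(LINT x|lborel. indicator A x * indicator T (x + h k)) - (LINT x|lborel. indicator A x)\<bar> < e"
    using \<open>e > 0\<close> by (auto simp: LIMSEQ_iff)
  show "\<exists>N. \<forall>k\<ge>N. norm ((LINT x|lborel. \<bar>indicator A (x + h k) - indicator A x\<bar>) - 0 :: real) < r"
  proof (intro exI allI impI)
    fix k assume "k \<ge> N"
    have iAh: "integrable lborel (\<lambda>x. indicator A (x + h k) :: real)"
      by (rule integrable_lborel_translate[OF iA])
    have iTAh: "integrable lborel (\<lambda>x. indicator (T - A) (x + h k) :: real)"
      by (rule integrable_lborel_translate[OF iTA])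
    have i1: "integrable lborel (\<lambda>x. indicator A x * indicator T (x + h k) :: real)"
      by (rule Bochner_Integration.integrable_bound[OF iA]) (auto simp: indicator_def)
    \<comment> \<open>Let a, b, c be the indicators of \<open>A\<close> at x, and of
      \<open>A\<close> and \<open>T - A\<close> at x + h k. Then |a - b| = a + b - 2 a b, and
      replacing b by b + c in the product costs at most 2 c. Both error terms carry a factor 2,
      hence e = r / 4.\<close>
    have "(LINT x|lborel. \<bar>indicator A (x + h k) - indicator A x\<bar> :: real)
        \<le> (LINT x|lborel. indicator A x + indicator A (x + h k) - 2 * (indicator A x * indicator T (x + h k)) + 2 * indicator (T - A) (x + h k))"
      using T(2)
      by (intro integral_mono Bochner_Integration.integrable_abs Bochner_Integration.integrable_diff Bochner_Integration.integrable_add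
           integrable_mult_right iA iAh i1 iTAh) (auto simp: indicator_def)
    also have "\<dots> = (LINT x|lborel. indicator A x) + (LINT x|lborel. indicator A (x + h k))
        - 2 * (LINT x|lborel. indicator A x * indicator T (x + h k)) + 2 * (LINT x|lborel. indicator (T - A) (x + h k))"
      using iA iAh i1 iTAh by simp
    also have "(LINT x|lborel. indicator A (x + h k)) = (LINT x|lborel. indicator A x :: real)"
      by (rule integral_lborel_translate) simp
    also have "(LINT x|lborel. indicator (T - A) (x + h k)) = (LINT x|lborel. indicator (T - A) x :: real)"
      by (rule integral_lborel_translate) simp
    also have "(LINT x|lborel. indicator (T - A) x :: real) = measure lborel (T - A)"
      by simp
    finally have *: "(LINT x|lborel. \<bar>indicator A (x + h k) - indicator A x\<bar> :: real) \<le>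
       2 * ((LINT x|lborel. indicator A x) - (LINT x|lborel. indicator A x * indicator T (x + h k))) + 2 * measure lborel (T - A)"
      by (simp add: algebra_simps)
    have "measure lborel (T - A) < e"
      using TA \<open>e > 0\<close> unfolding measure_def
      by (metis ennreal_enn2real_if ennreal_less_iff ennreal_less_top enn2real_nonneg order.strict_trans less_imp_le ennreal_enn2real top.not_eq_extremum)
    then have "(LINT x|lborel. \<bar>indicator A (x + h k) - indicator A x\<bar> :: real) < r"
      using * N[OF \<open>k \<ge> N\<close>] unfolding e_def by argo
    moreover have "(LINT x|lborel. \<bar>indicator A (x + h k) - indicator A x\<bar> :: real) \<ge> 0" by simp
    ultimately show "norm ((LINT x|lborel. \<bar>indicator A (x + h k) - indicator A x\<bar>) - 0 :: real) < r"
      by simp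
  qed
qed

text \<open>The property holds for multiples of indicators and passes to sums and to dominated
  limits, because a translation does not change the L^1 distance between a function and its
  approximant.\<close>

lemma translate_L1_tendsto_sequentially:
  fixes g :: "'a::euclidean_space \<Rightarrow> 'b::{banach, second_countable_topology}" and h :: "nat \<Rightarrow> 'a"
  assumes "integrable lborel g" and h: "h \<longlonglongrightarrow> 0"
  shows "(\<lambda>k. LINT x|lborel. norm (g (x + h k) - g x)) \<longlonglongrightarrow> 0"
  using assms(1)
proof (induction rule: integrable_induct)
  case (base A c)
  have "(\<lambda>k. (LINT x|lborel. \<bar>indicator A (x + h k) - indicator A x\<bar> :: real) * norm c) \<longlonglongrightarrow> 0 * norm c"
    using base h by (intro tendsto_mult tendsto_const translate_indicator_tendsto) auto
  moreover have "norm (indicator A (x + h k) *\<^sub>R c - indicator A x *\<^sub>R c) = \<bar>indicator A (x + h k) - indicator A x\<bar> * norm c" for x k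
    by (simp flip: scaleR_left_diff_distrib)
  ultimately show ?case by simp
next
  case (add f g)
  note if1 = integrable_lborel_translate[OF add.hyps(1)]
  note ig1 = integrable_lborel_translate[OF add.hyps(2)]
  have upper: "(\<lambda>k. (LINT x|lborel. norm (f (x + h k) - f x)) + (LINT x|lborel. norm (g (x + h k) - g x))) \<longlonglongrightarrow> 0 + 0"
    by (intro tendsto_add add.IH)
  show ?case
  proof (rule tendsto_sandwich[OF _ _ tendsto_const upper[simplified]])
    show "\<forall>\<^sub>F k in sequentially. (LINT x|lborel. norm (f (x + h k) + g (x + h k) - (f x + g x)))
       \<le> (LINT x|lborel. norm (f (x + h k) - f x)) + (LINT x|lborel. norm (g (x + h k) - g x))"
    proof (rule always_eventually, rule allI)
      fix k
      have "(LINT x|lborel. norm (f (x + h k) + g (x + h k) - (f x + g x)))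
        \<le> (LINT x|lborel. norm (f (x + h k) - f x) + norm (g (x + h k) - g x))"
        using add.hyps if1[of "h k"] ig1[of "h k"]
        by (intro integral_mono Bochner_Integration.integrable_add integrable_norm Bochner_Integration.integrable_diff)
           (auto intro: order_trans[OF _ norm_triangle_ineq] simp: algebra_simps)
      also have "\<dots> = (LINT x|lborel. norm (f (x + h k) - f x)) + (LINT x|lborel. norm (g (x + h k) - g x))"
        using add.hyps if1[of "h k"] ig1[of "h k"]
        by (intro Bochner_Integration.integral_add integrable_norm Bochner_Integration.integrable_diff)
      finally show "(LINT x|lborel. norm (f (x + h k) + g (x + h k) - (f x + g x))) \<le> \<dots>" .
    qed
  qed simp
next
  case (lim f s)
  \<comment> \<open>The approximants supplied by \<open>integrable_induct\<close> are at most twice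
    as large in norm as \<open>f\<close>, hence the dominating factor 3.\<close>
  have lims: "(\<lambda>i. LINT x|lborel. norm (f x - s i x)) \<longlonglongrightarrow> (LINT x|lborel. norm (f x - f x))"
  proof (rule integral_dominated_convergence[where w="\<lambda>x. 3 * norm (f x)"])
    show "AE x in lborel. (\<lambda>i. norm (f x - s i x)) \<longlonglongrightarrow> norm (f x - f x)"
      using lim.hyps by (intro AE_I2 tendsto_intros) auto
    show "AE x in lborel. norm (norm (f x - s i x)) \<le> 3 * norm (f x)" for i
      using lim.hyps(3)[of _ i] by (intro AE_I2) (smt (verit) norm_triangle_ineq4 space_lborel UNIV_I real_norm_def norm_ge_zero)
  qed (use lim.hyps in \<open>auto dest: borel_measurable_integrable\<close>)
  show ?case
  proof (rule LIMSEQ_I)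
    fix r :: real assume "r > 0"
    then obtain i where i: "\<bar>LINT x|lborel. norm (f x - s i x)\<bar> < r / 4"
      using lims[THEN LIMSEQ_D, of "r / 4"] by auto
    obtain N where N: "\<And>k. k \<ge> N \<Longrightarrow> \<bar>LINT x|lborel. norm (s i (x + h k) - s i x)\<bar> < r / 4"
      using lim.IH[of i, THEN LIMSEQ_D, of "r / 4"] \<open>r > 0\<close> by auto
    have is1: "integrable lborel (\<lambda>x. norm (f x - s i x))" using lim.hyps by auto
    have is2: "integrable lborel (\<lambda>x. norm (f (x + h k) - s i (x + h k)))" for k
      using integrable_lborel_translate[OF is1] .
    have is3: "integrable lborel (\<lambda>x. norm (s i (x + h k) - s i x))" for k
      using lim.hyps(1)[of i] integrable_lborel_translate[OF lim.hyps(1)[of i], of "h k"] by auto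
    have is4: "integrable lborel (\<lambda>x. norm (f (x + h k) - f x))" for k
      using lim.hyps(4) integrable_lborel_translate[OF lim.hyps(4), of "h k"] by auto
    show "\<exists>N. \<forall>k\<ge>N. norm ((LINT x|lborel. norm (f (x + h k) - f x)) - 0) < r"
    proof (intro exI allI impI)
      fix k assume k: "k \<ge> N"
      have "(LINT x|lborel. norm (f (x + h k) - f x)) \<le> (LINT x|lborel. norm (f (x + h k) - s i (x + h k)) + norm (s i (x + h k) - s i x) + norm (f x - s i x))"
        using is1 is2[of k] is3[of k] is4[of k]
        by (intro integral_mono Bochner_Integration.integrable_add)
           (auto, smt (verit, best) norm_triangle_ineq norm_minus_commute diff_add_cancel add_diff_eq add.commute norm_diff_triangle_le)
      also have "\<dots> = (LINT x|lborel. norm (f (x + h k) - s i (x + h k))) + (LINT x|lborel. norm (s i (x + h k) - s i x)) + (LINT x|lborel. norm (f x - s i x))"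
        using is1 is2[of k] is3[of k] by simp
      also have "(LINT x|lborel. norm (f (x + h k) - s i (x + h k))) = (LINT x|lborel. norm (f x - s i x))"
        using is1 by (intro integral_lborel_translate[of "\<lambda>x. norm (f x - s i x)"]) auto
      finally have "(LINT x|lborel. norm (f (x + h k) - f x)) < r"
        using i N[OF k] \<open>r > 0\<close> by linarith
      moreover have "(LINT x|lborel. norm (f (x + h k) - f x)) \<ge> 0" by simp
      ultimately show "norm ((LINT x|lborel. norm (f (x + h k) - f x)) - 0) < r"
        by simp
    qed
  qed
qed

lemma translate_L1_small:
  fixes g :: "'a::euclidean_space \<Rightarrow> 'b::{banach, second_countable_topology}"
  assumes g: "integrable lborel g" and "e > 0"
  obtains d where "d > 0" "\<And>h. norm h < d \<Longrightarrow> (LINT x|lborel. norm (g (x + h) - g x)) < e"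
proof -
  have "((\<lambda>h. LINT x|lborel. norm (g (x + h) - g x)) \<longlongrightarrow> 0) (at 0)"
    unfolding tendsto_at_iff_sequentially
    using translate_L1_tendsto_sequentially[OF g] by (simp add: o_def)
  then obtain d where d: "d > 0" "\<And>h. h \<noteq> 0 \<Longrightarrow> norm h < d \<Longrightarrow> \<bar>LINT x|lborel. norm (g (x + h) - g x)\<bar> < e"
    using \<open>e > 0\<close> unfolding LIM_def by (auto simp: dist_norm)
  show ?thesis
  proof (rule that[OF d(1)])
    fix h :: 'a assume "norm h < d"
    then show "(LINT x|lborel. norm (g (x + h) - g x)) < e"
      using d(2)[of h] \<open>e > 0\<close> by (cases "h = 0") auto
  qed
qed

section \<open>Convexity of the power function\<close>

text \<open>The supporting line of |.|^p at \<open>m\<close>, from Young's inequality for |a| and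
  |m|^(p - 1) with conjugate exponent q = p / (p - 1). Writing the slope with \<open>sgn\<close>
  treats all signs and m = 0 together.\<close>

lemma powr_tangent_le:
  fixes a m p :: real
  assumes "1 < p"
  shows "\<bar>m\<bar> powr p + p * sgn m * \<bar>m\<bar> powr (p - 1) * (a - m) \<le> \<bar>a\<bar> powr p"
proof -
  define q where "q = p / (p - 1)"
  have q: "1 < q" "1 / p + 1 / q = 1" "(p - 1) * q = p" "1 / q = (p - 1) / p"
    using assms by (auto simp: q_def field_simps)
  have "\<bar>a\<bar> * \<bar>m\<bar> powr (p - 1) \<le> \<bar>a\<bar> powr p / p + (\<bar>m\<bar> powr (p - 1)) powr q / q"
    using Youngs_inequality[of p q "\<bar>a\<bar>" "\<bar>m\<bar> powr (p - 1)"] assms q by simp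
  then have "\<bar>a\<bar> * \<bar>m\<bar> powr (p - 1) \<le> \<bar>a\<bar> powr p / p + \<bar>m\<bar> powr p / q"
    by (simp add: powr_powr q)
  then have "p * (\<bar>a\<bar> * \<bar>m\<bar> powr (p - 1)) \<le> p * (\<bar>a\<bar> powr p / p + \<bar>m\<bar> powr p * ((p - 1) / p))"
    using assms by (intro mult_left_mono) (auto simp: q(4)[symmetric])
  also have "\<dots> = \<bar>a\<bar> powr p + (p - 1) * \<bar>m\<bar> powr p"
    using assms by (simp add: field_simps)
  finally have 1: "p * (\<bar>a\<bar> * \<bar>m\<bar> powr (p - 1)) \<le> \<bar>a\<bar> powr p + (p - 1) * \<bar>m\<bar> powr p" .
  have m: "sgn m * m * \<bar>m\<bar> powr (p - 1) = \<bar>m\<bar> powr p"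
  proof (cases "m = 0")
    case False
    then have "\<bar>m\<bar> powr p = \<bar>m\<bar> * \<bar>m\<bar> powr (p - 1)"
      using powr_mult_base[of "\<bar>m\<bar>" "p - 1"] by simp
    then show ?thesis by (simp add: abs_sgn mult.commute)
  qed simp
  have "sgn m * a \<le> \<bar>a\<bar>" by (auto simp: sgn_if)
  then have "p * ((sgn m * a) * \<bar>m\<bar> powr (p - 1)) \<le> p * (\<bar>a\<bar> * \<bar>m\<bar> powr (p - 1))"
    using assms by (intro mult_left_mono mult_right_mono) auto
  moreover have "p * sgn m * \<bar>m\<bar> powr (p - 1) * (a - m) = p * ((sgn m * a) * \<bar>m\<bar> powr (p - 1)) - p * (sgn m * m * \<bar>m\<bar> powr (p - 1))"
    by (simp add: algebra_simps)
  moreover have "p * (sgn m * m * \<bar>m\<bar> powr (p - 1)) = (p - 1) * \<bar>m\<bar> powr p + \<bar>m\<bar> powr p"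
    unfolding m by (simp add: algebra_simps)
  ultimately show ?thesis using 1 by linarith
qed

text \<open>The supporting line at \<open>a\<close>, whose slope is at most p N^(p - 1) in absolute
  value. The error is only of first order in |q - a|; this is why continuity of translations in L^1
  suffices on a set where the gradient is bounded.\<close>

lemma powr_le_powr_plus_diff:
  fixes a q p N :: real
  assumes "1 < p" "\<bar>a\<bar> \<le> N"
  shows "\<bar>a\<bar> powr p \<le> \<bar>q\<bar> powr p + p * N powr (p - 1) * \<bar>q - a\<bar>"
proof -
  have "- (p * sgn a * \<bar>a\<bar> powr (p - 1) * (q - a)) \<le> \<bar>p * sgn a * \<bar>a\<bar> powr (p - 1) * (q - a)\<bar>"
    by (rule abs_le_D2) simp
  also have "\<dots> \<le> p * N powr (p - 1) * \<bar>q - a\<bar>"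
    using assms powr_mono2[of "p - 1" "\<bar>a\<bar>" N]
    by (auto simp: abs_mult abs_sgn_eq intro!: mult_right_mono mult_left_mono)
  finally show ?thesis using powr_tangent_le[OF assms(1), of a q] by linarith
qed

text \<open>Integrate the supporting line at the mean value: its linear term drops out. The power of
  the total mass appears because the measure is not normalised.\<close>

lemma (in finite_measure) jensen_powr_of_pos_measure:
  fixes u :: "'a \<Rightarrow> real"
  assumes p: "1 < p" and u: "integrable M u" and pos: "0 < measure M (space M)"
  shows "ennreal (\<bar>LINT x|M. u x\<bar> powr p) \<le> ennreal (measure M (space M) powr (p - 1)) * (\<integral>\<^sup>+x. ennreal (\<bar>u x\<bar> powr p) \<partial>M)"
proof (cases "(\<integral>\<^sup>+x. ennreal (\<bar>u x\<bar> powr p) \<partial>M) = \<infinity>")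
  case True
  then show ?thesis using pos by (simp add: ennreal_mult_top)
next
  case False
  have [measurable]: "u \<in> borel_measurable M" using u by auto
  have ip: "integrable M (\<lambda>x. \<bar>u x\<bar> powr p)"
    using False by (intro integrableI_nonneg) (auto simp: top.not_eq_extremum)
  define T where "T = measure M (space M)"
  define m where "m = (LINT x|M. u x) / T"
  have um: "(LINT x|M. u x) = T * m" using pos by (simp add: m_def T_def)
  have "(LINT x|M. \<bar>m\<bar> powr p + p * sgn m * \<bar>m\<bar> powr (p - 1) * (u x - m)) \<le> (LINT x|M. \<bar>u x\<bar> powr p)"
    using u ip by (intro integral_mono) (auto intro: powr_tangent_le[OF p])
  moreover have "(LINT x|M. \<bar>m\<bar> powr p + p * sgn m * \<bar>m\<bar> powr (p - 1) * (u x - m)) = T * \<bar>m\<bar> powr p"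
    using u by (simp add: T_def[symmetric] um)
  ultimately have 1: "T * \<bar>m\<bar> powr p \<le> (LINT x|M. \<bar>u x\<bar> powr p)" by simp
  have "\<bar>LINT x|M. u x\<bar> powr p = T powr (p - 1) * (T * \<bar>m\<bar> powr p)"
  proof -
    have "T powr p = T powr (p - 1) * T"
      using powr_mult_base[of T "p - 1"] pos by (simp add: T_def mult.commute)
    then show ?thesis using pos by (simp add: um abs_mult powr_mult T_def)
  qed
  also have "\<dots> \<le> T powr (p - 1) * (LINT x|M. \<bar>u x\<bar> powr p)"
    using 1 by (intro mult_left_mono) auto
  finally have "ennreal (\<bar>LINT x|M. u x\<bar> powr p) \<le> ennreal (T powr (p - 1) * (LINT x|M. \<bar>u x\<bar> powr p))"
    by (rule ennreal_leI)
  also have "\<dots> = ennreal (T powr (p - 1)) * (\<integral>\<^sup>+x. ennreal (\<bar>u x\<bar> powr p) \<partial>M)"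
    using ip by (simp add: ennreal_mult nn_integral_eq_integral)
  finally show ?thesis by (simp add: T_def)
qed

lemma (in finite_measure) jensen_powr:
  fixes u :: "'a \<Rightarrow> real"
  assumes p: "1 < p" and u: "integrable M u"
  shows "ennreal (\<bar>LINT x|M. u x\<bar> powr p) \<le> ennreal (measure M (space M) powr (p - 1)) * (\<integral>\<^sup>+x. ennreal (\<bar>u x\<bar> powr p) \<partial>M)"
proof (cases "0 < measure M (space M)")
  case True
  then show ?thesis by (rule jensen_powr_of_pos_measure[OF p u])
next
  case False
  then have "measure M (space M) = 0" using measure_nonneg[of M "space M"] by linarith
  then have "emeasure M (space M) = 0" by (simp add: emeasure_eq_measure)
  then have "M = null_measure M" by (intro measure_eqI) (auto intro: emeasure_eq_0 dest: sets.sets_into_space)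
  then have "(LINT x|M. u x) = (LINT x|null_measure M. u x)" by simp
  then show ?thesis by simp
qed

section \<open>Integrals in polar form\<close>

lemma measurable_mem_ball [measurable (raw)]:
  fixes f c :: "'a \<Rightarrow> 'b::{metric_space, second_countable_topology}"
  assumes [measurable]: "f \<in> borel_measurable M" "c \<in> borel_measurable M" "r \<in> borel_measurable M"
  shows "Measurable.pred M (\<lambda>x. f x \<in> ball (c x) (r x))" "Measurable.pred M (\<lambda>x. f x \<in> cball (c x) (r x))"
  by simp_all

lemma AE_lborel_ball_cball:
  "AE z in lborel. indicator (ball (c::'a::euclidean_space) r) z = (indicator (cball c r) z :: 'b::zero_neq_one)"
proof -
  have "sphere c r \<in> null_sets lebesgue"
    using negligible_sphere negligible_iff_null_sets by blast
  then have "sphere c r \<in> null_sets lborel"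
    using null_sets_completion_iff[of "sphere c r" lborel] by auto
  then have "AE z in lborel. z \<notin> sphere c r" by (rule AE_not_in)
  then show ?thesis by eventually_elim (auto simp: indicator_def)
qed

lemma nn_integral_cball_homogeneous:
  fixes F :: "'a::euclidean_space \<Rightarrow> ennreal"
  assumes [measurable]: "F \<in> borel_measurable borel"
    and hom: "\<And>c z. c > 0 \<Longrightarrow> F (c *\<^sub>R z) = F z" and "r > 0"
  shows "(\<integral>\<^sup>+z. F z * indicator (cball 0 r) z \<partial>lborel) =
    ennreal (r ^ DIM('a)) * (\<integral>\<^sup>+z. F z * indicator (cball 0 1) z \<partial>lborel)"
proof -
  have "(\<integral>\<^sup>+z. F z * indicator (cball 0 r) z \<partial>lborel) =
      ennreal (\<bar>r\<bar> ^ DIM('a)) * (\<integral>\<^sup>+z. F (r *\<^sub>R z) * indicator (cball 0 r) (r *\<^sub>R z) \<partial>lborel)"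
    by (rule nn_integral_lborel_scaleR) (use \<open>r > 0\<close> in auto)
  moreover have "indicator (cball 0 r) (r *\<^sub>R z) = (indicator (cball 0 1) z :: ennreal)" for z :: 'a
    using \<open>r > 0\<close> by (simp add: indicator_def)
  ultimately show ?thesis using \<open>r > 0\<close> by (simp add: hom)
qed

lemma ennreal_powr_eq_integral:
  fixes a x :: real
  assumes "0 < a" "0 < x"
  shows "ennreal (x powr (- a)) = (\<integral>\<^sup>+t. ennreal (a * t powr (- a - 1)) * indicator {x..} t \<partial>lborel)"
proof -
  have "(\<integral>\<^sup>+t. ennreal (a * t powr (- a - 1)) * indicator {x..} t \<partial>lborel) = ennreal (0 - (- (x powr (- a))))"
  proof (rule nn_integral_FTC_atLeast)
    fix t assume "x \<le> t"
    then have "t > 0" using assms by simp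
    then show "((\<lambda>t. - (t powr (- a))) has_real_derivative a * t powr (- a - 1)) (at t)"
      by (auto intro!: derivative_eq_intros)
    show "0 \<le> a * t powr (- a - 1)" using assms by simp
  next
    have "((\<lambda>t::real. t powr (- a)) \<longlongrightarrow> 0) at_top"
      using assms by (intro tendsto_neg_powr filterlim_ident) auto
    then show "((\<lambda>t::real. - (t powr (- a))) \<longlongrightarrow> 0) at_top"
      using tendsto_minus[of "\<lambda>t::real. t powr (- a)" 0] by simp
  qed simp
  then show ?thesis by simp
qed

lemma nn_integral_powr_unit_interval:
  fixes b :: real
  assumes "0 < b"
  shows "(\<integral>\<^sup>+t. ennreal (t powr (b - 1)) * indicator {0..1} t \<partial>lborel) = ennreal (1 / b)"
proof -
  have "((\<lambda>t::real. t powr (b - 1)) has_integral (1 powr (b - 1 + 1) / (b - 1 + 1))) {0..1}"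
    using assms by (intro has_integral_powr_from_0) auto
  then have "((\<lambda>t::real. t powr (b - 1)) has_integral (1 / b)) {0..1}" by simp
  then have "((\<lambda>t::real. t powr (b - 1) * indicator {0..1} t) has_integral (1 / b)) UNIV"
    by (subst (asm) has_integral_restrict_UNIV[symmetric])
       (rule has_integral_eq[rotated], assumption, simp add: indicator_def)
  then have "(\<integral>\<^sup>+t. ennreal (t powr (b - 1) * indicator {0..1} t) \<partial>lborel) = ennreal (1 / b)"
    by (intro nn_integral_has_integral_lborel) auto
  then show ?thesis by (simp add: ennreal_mult' ennreal_indicator)
qed

text \<open>Layer-cake in the radial variable: write \<open>|z|\<^sup>b\<^sup>-\<^sup>n\<close> as an integral of \<open>t\<^sup>b\<^sup>-\<^sup>n\<^sup>-\<^sup>1\<close>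
  over \<open>t \<ge> |z|\<close> and exchange the integrals.\<close>

lemma nn_integral_homogeneous_powr_unit_cball:
  fixes F :: "'a::euclidean_space \<Rightarrow> ennreal" and b :: real
  assumes [measurable]: "F \<in> borel_measurable borel"
    and hom: "\<And>c z. c > 0 \<Longrightarrow> F (c *\<^sub>R z) = F z" and b: "0 < b" "b < DIM('a)"
  shows "(\<integral>\<^sup>+z. F z * ennreal (norm z powr (b - DIM('a))) * indicator (cball 0 1) z \<partial>lborel) =
    ennreal (DIM('a) / b) * (\<integral>\<^sup>+z. F z * indicator (cball 0 1) z \<partial>lborel)"
proof -
  define n where "n = real DIM('a)"
  define a where "a = n - b"
  have a: "a > 0" using b by (simp add: a_def n_def)
  define k where "k = (\<integral>\<^sup>+z. F z * indicator (cball 0 1) z \<partial>lborel)"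
  have "(\<integral>\<^sup>+z. F z * ennreal (norm z powr (b - DIM('a))) * indicator (cball 0 1) z \<partial>lborel) =
     (\<integral>\<^sup>+z. \<integral>\<^sup>+t. F z * indicator (cball 0 1) z * (ennreal (a * t powr (- a - 1)) * (indicator {norm z..} t * indicator {0<..} t)) \<partial>lborel \<partial>lborel)"
  proof (rule nn_integral_cong_AE)
    show "AE z in lborel. F z * ennreal (norm z powr (b - DIM('a))) * indicator (cball 0 1) z =
      (\<integral>\<^sup>+t. F z * indicator (cball 0 1) z * (ennreal (a * t powr (- a - 1)) * (indicator {norm z..} t * indicator {0<..} t)) \<partial>lborel)"
      using AE_lborel_singleton[of "0::'a"]
    proof eventually_elim
      case (elim z)
      have "(\<integral>\<^sup>+t. F z * indicator (cball 0 1) z * (ennreal (a * t powr (- a - 1)) * (indicator {norm z..} t * indicator {0<..} t)) \<partial>lborel)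
        = F z * indicator (cball 0 1) z * (\<integral>\<^sup>+t. ennreal (a * t powr (- a - 1)) * indicator {norm z..} t \<partial>lborel)"
        using elim by (subst nn_integral_cmult[symmetric])
          (auto intro!: nn_integral_cong simp: indicator_def, smt (verit) norm_ge_zero norm_eq_zero)
      also have "\<dots> = F z * indicator (cball 0 1) z * ennreal (norm z powr (- a))"
        using ennreal_powr_eq_integral[OF a, of "norm z"] elim by simp
      finally show ?case by (simp add: a_def n_def mult_ac)
    qed
  qed
  also have "\<dots> = (\<integral>\<^sup>+t. \<integral>\<^sup>+z. F z * indicator (cball 0 1) z * (ennreal (a * t powr (- a - 1)) * (indicator {norm z..} t * indicator {0<..} t)) \<partial>lborel \<partial>lborel)"
    by (rule lborel_pair.Fubini'[symmetric]) (simp add: indicator_def, measurable)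
  \<comment> \<open>By homogeneity the z-integral over |z| <= min t 1 is t^n k for t < 1 and k for t
    > 1. With a = n - b the two ranges contribute a / b and 1, which add up to n / b.\<close>
  also have "\<dots> = (\<integral>\<^sup>+t. k * (ennreal a * (ennreal (t powr (b - 1)) * indicator {0..1} t) + ennreal (a * t powr (- a - 1)) * indicator {1..} t) \<partial>lborel)"
  proof (rule nn_integral_cong_AE)
    show "AE t in lborel. (\<integral>\<^sup>+z. F z * indicator (cball 0 1) z * (ennreal (a * t powr (- a - 1)) * (indicator {norm z..} t * indicator {0<..} t)) \<partial>lborel)
      = k * (ennreal a * (ennreal (t powr (b - 1)) * indicator {0..1} t) + ennreal (a * t powr (- a - 1)) * indicator {1..} t)"
      using AE_lborel_singleton[of "0::real"] AE_lborel_singleton[of "1::real"]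
    proof eventually_elim
      case (elim t)
      consider "t < 0" | "0 < t" "t < 1" | "1 < t" using elim by linarith
      then show ?case
      proof cases
        case 1
        then show ?thesis by simp
      next
        case 2
        have "(\<integral>\<^sup>+z. F z * indicator (cball 0 1) z * (ennreal (a * t powr (- a - 1)) * (indicator {norm z..} t * indicator {0<..} t)) \<partial>lborel)
          = (\<integral>\<^sup>+z. (F z * indicator (cball 0 t) z) * ennreal (a * t powr (- a - 1)) \<partial>lborel)"
          using 2 by (intro nn_integral_cong) (auto simp: indicator_def)
        also have "\<dots> = ennreal (t ^ DIM('a)) * k * ennreal (a * t powr (- a - 1))"
          using nn_integral_cball_homogeneous[of F t, OF _ hom] 2
          by (subst nn_integral_multc) (auto simp: k_def)
        also have "\<dots> = k * ennreal (a * (t powr n * t powr (- a - 1)))"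
          using 2 a by (simp add: n_def powr_realpow ennreal_mult mult_ac)
        also have "t powr n * t powr (- a - 1) = t powr (b - 1)"
          by (simp add: a_def flip: powr_add)
        finally show ?thesis using 2 a by (simp add: ennreal_mult)
      next
        case 3
        have "(\<integral>\<^sup>+z. F z * indicator (cball 0 1) z * (ennreal (a * t powr (- a - 1)) * (indicator {norm z..} t * indicator {0<..} t)) \<partial>lborel)
          = (\<integral>\<^sup>+z. (F z * indicator (cball 0 1) z) * ennreal (a * t powr (- a - 1)) \<partial>lborel)"
          using 3 by (intro nn_integral_cong) (auto simp: indicator_def)
        also have "\<dots> = k * ennreal (a * t powr (- a - 1))"
          by (subst nn_integral_multc) (auto simp: k_def)
        finally show ?thesis using 3 by simp
      qed
    qed
  qed
  also have "\<dots> = k * (ennreal a * ennreal (1 / b) + ennreal (1 powr (- a)))"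
    using ennreal_powr_eq_integral[OF a, of 1] nn_integral_powr_unit_interval[OF b(1)]
    by (simp add: nn_integral_cmult nn_integral_add)
  also have "ennreal a * ennreal (1 / b) + ennreal (1 powr (- a)) = ennreal (a * (1 / b) + 1)"
    using a b by (simp flip: ennreal_mult ennreal_plus add: ennreal_1[symmetric] del: ennreal_1)
  also have "a * (1 / b) + 1 = n / b"
    using b by (simp add: a_def field_simps)
  finally show ?thesis by (simp add: k_def n_def mult.commute)
qed

lemma nn_integral_homogeneous_powr_ball:
  fixes F :: "'a::euclidean_space \<Rightarrow> ennreal" and b r :: real
  assumes [measurable]: "F \<in> borel_measurable borel"
    and hom: "\<And>c z. c > 0 \<Longrightarrow> F (c *\<^sub>R z) = F z" and b: "0 < b" "b < DIM('a)" and "r > 0"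
  shows "(\<integral>\<^sup>+z. F z * ennreal (norm z powr (b - DIM('a))) * indicator (ball 0 r) z \<partial>lborel) =
    ennreal (DIM('a) / b * r powr b) * (\<integral>\<^sup>+z. F z * indicator (cball 0 1) z \<partial>lborel)"
proof -
  have "(\<integral>\<^sup>+z. F z * ennreal (norm z powr (b - DIM('a))) * indicator (ball 0 r) z \<partial>lborel) =
    ennreal (\<bar>r\<bar> ^ DIM('a)) * (\<integral>\<^sup>+z. F (r *\<^sub>R z) * ennreal (norm (r *\<^sub>R z) powr (b - DIM('a))) * indicator (ball 0 r) (r *\<^sub>R z) \<partial>lborel)"
    by (rule nn_integral_lborel_scaleR) (use \<open>r > 0\<close> in auto)
  also have "(\<integral>\<^sup>+z. F (r *\<^sub>R z) * ennreal (norm (r *\<^sub>R z) powr (b - DIM('a))) * indicator (ball 0 r) (r *\<^sub>R z) \<partial>lborel)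
     = (\<integral>\<^sup>+z. ennreal (r powr (b - DIM('a))) * (F z * ennreal (norm z powr (b - DIM('a))) * indicator (cball 0 1) z) \<partial>lborel)"
  proof (rule nn_integral_cong_AE)
    show "AE z in lborel. F (r *\<^sub>R z) * ennreal (norm (r *\<^sub>R z) powr (b - DIM('a))) * indicator (ball 0 r) (r *\<^sub>R z)
      = ennreal (r powr (b - DIM('a))) * (F z * ennreal (norm z powr (b - DIM('a))) * indicator (cball 0 1) z)"
      using AE_lborel_ball_cball[of "0::'a" 1, where 'b=ennreal]
    proof eventually_elim
      case (elim z)
      have "indicator (ball 0 r) (r *\<^sub>R z) = (indicator (ball 0 1) z :: ennreal)"
        using \<open>r > 0\<close> by (simp add: indicator_def)
      then show ?case
        using elim \<open>r > 0\<close> by (simp add: hom powr_mult ennreal_mult mult_ac)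
    qed
  qed
  also have "\<dots> = ennreal (r powr (b - DIM('a))) * (ennreal (DIM('a) / b) * (\<integral>\<^sup>+z. F z * indicator (cball 0 1) z \<partial>lborel))"
    using nn_integral_homogeneous_powr_unit_cball[of F b, OF _ hom] b by (subst nn_integral_cmult) auto
  also have "ennreal (\<bar>r\<bar> ^ DIM('a)) * \<dots> = ennreal (\<bar>r\<bar> ^ DIM('a) * r powr (b - DIM('a)) * (DIM('a) / b)) * (\<integral>\<^sup>+z. F z * indicator (cball 0 1) z \<partial>lborel)"
    using \<open>r > 0\<close> b by (subst ennreal_mult, simp, simp, subst ennreal_mult, simp, simp, simp only: mult_ac)
  also have "\<bar>r\<bar> ^ DIM('a) * r powr (b - DIM('a)) = r powr b"
    using \<open>r > 0\<close> by (simp add: powr_realpow[symmetric] flip: powr_add)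
  finally show ?thesis by (simp only: mult.commute)
qed

text \<open>A set function handed to \<open>measure_of\<close> determines the resulting measure only
  if it is countably additive. The cone formula is recognised here as the image of n times Lebesgue
  measure on the punctured unit ball under radial projection; \<open>e\<close> is an arbitrary value
  at the origin that keeps the projection inside the sphere.\<close>

lemma sphere_measure_eq_distr:
  fixes e :: "'a::euclidean_space"
  assumes e: "norm e = 1"
  shows "(sphere_measure :: 'a measure) =
    distr (density lborel (\<lambda>z. of_nat DIM('a) * indicator (cball 0 1 - {0}) z))
      (restrict_space lborel (sphere 0 1)) (\<lambda>z. if z = 0 then e else z /\<^sub>R norm z)"
proof -
  let ?R = "restrict_space lborel (sphere 0 1) :: 'a measure"
  let ?g = "\<lambda>z::'a. if z = 0 then e else z /\<^sub>R norm z"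
  define N where "N = distr (density lborel (\<lambda>z. of_nat DIM('a) * indicator (cball 0 1 - {0}) z)) ?R ?g"
  have gR [measurable]: "?g \<in> lborel \<rightarrow>\<^sub>M ?R"
    by (rule measurable_restrict_space2) (auto simp: e)
  have sp: "space ?R = sphere 0 1" by (simp add: space_restrict_space)
  have sN: "sets N = sets ?R" "space N = sphere 0 1" by (simp_all add: N_def sp)
  have "emeasure N A = of_nat DIM('a) * emeasure lborel {r *\<^sub>R x | r x. r \<in> {0<..1} \<and> x \<in> A}"
    if A: "A \<in> sets ?R" for A
  proof -
    have Asub: "A \<subseteq> sphere 0 1" using sets.sets_into_space[OF A] sp by simp
    have eq: "{r *\<^sub>R x | r x. r \<in> {0<..1} \<and> x \<in> A} = (cball 0 1 - {0}) \<inter> (?g -` A)"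
    proof (intro set_eqI iffI)
      fix z assume "z \<in> {r *\<^sub>R x | r x. r \<in> {0<..1} \<and> x \<in> A}"
      then obtain r x where z: "z = r *\<^sub>R x" "0 < r" "r \<le> 1" "x \<in> A" by auto
      then have "norm x = 1" using Asub by auto
      then show "z \<in> (cball 0 1 - {0}) \<inter> (?g -` A)" using z by auto
    next
      fix z assume "z \<in> (cball 0 1 - {0}) \<inter> (?g -` A)"
      then show "z \<in> {r *\<^sub>R x | r x. r \<in> {0<..1} \<and> x \<in> A}"
        by (auto intro!: exI[of _ "norm z"] exI[of _ "z /\<^sub>R norm z"])
    qed
    have [measurable]: "?g -` A \<in> sets borel"
      using measurable_sets[OF gR A] by simp
    have "emeasure N A = (\<integral>\<^sup>+z. of_nat DIM('a) * indicator (cball 0 1 - {0}) z * indicator (?g -` A) z \<partial>lborel)"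
      unfolding N_def using A gR
      by (subst emeasure_distr) (simp_all, subst emeasure_density, simp_all)
    also have "\<dots> = (\<integral>\<^sup>+z. of_nat DIM('a) * indicator ((cball 0 1 - {0}) \<inter> (?g -` A)) z \<partial>lborel)"
      by (intro nn_integral_cong) (simp add: indicator_def)
    also have "\<dots> = of_nat DIM('a) * emeasure lborel ((cball 0 1 - {0}) \<inter> (?g -` A))"
      by (subst nn_integral_cmult_indicator) auto
    finally show ?thesis by (simp only: eq)
  qed
  then have "(sphere_measure :: 'a measure) = measure_of (sphere 0 1) (sets ?R) (emeasure N)"
    unfolding sphere_measure_def
    using sets.sigma_sets_eq[of ?R] sets.space_closed[of ?R]
    by (intro measure_of_eq) (auto simp: sp)
  also have "\<dots> = N"
    using measure_of_of_measure[of N] by (simp add: sN)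
  finally show ?thesis by (simp add: N_def)
qed

text \<open>A function of degree 0 is unchanged by radial projection, so the change of variables
  leaves \<open>F\<close> itself under the integral.\<close>

lemma nn_integral_sphere_measure:
  fixes F :: "'a::euclidean_space \<Rightarrow> ennreal"
  assumes [measurable]: "F \<in> borel_measurable borel"
    and hom: "\<And>c z. c > 0 \<Longrightarrow> F (c *\<^sub>R z) = F z"
  shows "(\<integral>\<^sup>+z. F z \<partial>sphere_measure) = of_nat DIM('a) * (\<integral>\<^sup>+z. F z * indicator (cball 0 1) z \<partial>lborel)"
proof -
  obtain e :: 'a where e: "norm e = 1" using vector_choose_size[of 1] by auto
  let ?R = "restrict_space lborel (sphere 0 1) :: 'a measure"
  let ?g = "\<lambda>z::'a. if z = 0 then e else z /\<^sub>R norm z"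
  have gR [measurable]: "?g \<in> lborel \<rightarrow>\<^sub>M ?R"
    by (rule measurable_restrict_space2) (auto simp: e)
  have gR': "?g \<in> density lborel h \<rightarrow>\<^sub>M ?R" for h :: "'a \<Rightarrow> ennreal"
    using gR by simp
  have FR: "F \<in> borel_measurable (distr (density lborel h) ?R ?g)" for h :: "'a \<Rightarrow> ennreal"
    by (simp add: measurable_restrict_space1)
  have "(\<integral>\<^sup>+z. F z \<partial>sphere_measure) = (\<integral>\<^sup>+z. F (?g z) \<partial>(density lborel (\<lambda>z. of_nat DIM('a) * indicator (cball 0 1 - {0}) z)))"
    unfolding sphere_measure_eq_distr[OF e] by (rule nn_integral_distr[OF gR' FR])
  also have "\<dots> = (\<integral>\<^sup>+z. of_nat DIM('a) * indicator (cball 0 1 - {0}) z * F (?g z) \<partial>lborel)"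
    by (subst nn_integral_density) auto
  also have "\<dots> = (\<integral>\<^sup>+z. of_nat DIM('a) * (F z * indicator (cball 0 1) z) \<partial>lborel)"
  proof (rule nn_integral_cong_AE)
    show "AE z in lborel. of_nat DIM('a) * indicator (cball 0 1 - {0}) z * F (?g z) = of_nat DIM('a) * (F z * indicator (cball 0 1) z)"
      using AE_lborel_singleton[of "0::'a"]
    proof eventually_elim
      case (elim z)
      then have "F (?g z) = F z" using hom[of "inverse (norm z)" z] by simp
      then show ?case using elim by (simp add: indicator_def)
    qed
  qed
  also have "\<dots> = of_nat DIM('a) * (\<integral>\<^sup>+z. F z * indicator (cball 0 1) z \<partial>lborel)"
    by (rule nn_integral_cmult) simp
  finally show ?thesis .
qed

text \<open>The integrand extends |sigma_i|^p from the sphere to a function of degree 0, so n times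
  this ball integral is the sphere integral in \<open>K_const\<close>. Exponent \<open>p\<close>
  gives the constant of the theorem, exponent 2 the normalisation of the averaged difference
  quotients.\<close>

definition direction_moment :: "'n::finite \<Rightarrow> real \<Rightarrow> ennreal" where
  "direction_moment i p = (\<integral>\<^sup>+z. ennreal (\<bar>(z::real^'n) $ i\<bar> powr p / norm z powr p) * indicator (cball 0 1) z \<partial>lborel)"

lemma direction_moment_homogeneous:
  assumes "c > 0"
  shows "\<bar>(c *\<^sub>R z) $ i\<bar> powr p / norm (c *\<^sub>R z) powr p = \<bar>z $ i\<bar> powr p / norm (z::real^'n::finite) powr p"
  using assms by (simp add: abs_mult powr_mult)

lemma K_const_eq_direction_moment:
  fixes i :: "'n::finite"
  assumes "1 < p"
  shows "K_const i p = ennreal (real CARD('n) / p) * direction_moment i p"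
proof -
  let ?F = "\<lambda>z::real^'n. ennreal (\<bar>z $ i\<bar> powr p / norm z powr p)"
  have "(\<integral>\<^sup>+ \<sigma>. ennreal (\<bar>\<sigma> $ i\<bar> powr p) \<partial>(sphere_measure :: (real^'n) measure)) = (\<integral>\<^sup>+ \<sigma>. ?F \<sigma> \<partial>(sphere_measure :: (real^'n) measure))"
  proof (rule nn_integral_cong)
    fix \<sigma> assume "\<sigma> \<in> space (sphere_measure :: (real^'n) measure)"
    then have "norm \<sigma> = 1"
      by (subst (asm) sphere_measure_eq_distr[of "axis i 1"]) (auto simp: space_restrict_space norm_axis_1)
    then show "ennreal (\<bar>\<sigma> $ i\<bar> powr p) = ?F \<sigma>" by simp
  qed
  also have "\<dots> = of_nat DIM(real^'n) * direction_moment i p"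
    unfolding direction_moment_def
    by (rule nn_integral_sphere_measure) (auto simp: direction_moment_homogeneous simp del: vector_scaleR_component norm_scaleR)
  finally show ?thesis
    using assms by (simp add: K_const_def ennreal_mult ennreal_divide_numeral mult_ac divide_inverse ennreal_of_nat_eq_real_of_nat)
qed

lemma direction_moment_finite:
  fixes i :: "'n::finite"
  assumes "1 < p"
  shows "direction_moment i p < \<infinity>"
proof -
  have "direction_moment i p \<le> (\<integral>\<^sup>+z. indicator (cball (0::real^'n) 1) z \<partial>lborel)"
    unfolding direction_moment_def
  proof (rule nn_integral_mono)
    fix z :: "real^'n"
    have "\<bar>z $ i\<bar> powr p \<le> norm z powr p" using assms by (intro powr_mono2) (auto simp: component_le_norm_cart)
    then have "\<bar>z $ i\<bar> powr p / norm z powr p \<le> 1" by (simp add: divide_le_eq_1)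
    then show "ennreal (\<bar>z $ i\<bar> powr p / norm z powr p) * indicator (cball 0 1) z \<le> indicator (cball 0 1) z"
      by (simp add: indicator_def)
  qed
  also have "\<dots> < \<infinity>" using emeasure_lborel_cball_finite[of "0::real^'n" 1] by simp
  finally show ?thesis .
qed

text \<open>Inside the ball the integrand vanishes only on a hyperplane, a null set. Positivity
  makes K times infinity infinite when there is no weak gradient, and permits division by the second
  moment.\<close>

lemma direction_moment_pos:
  fixes i :: "'n::finite"
  shows "0 < direction_moment i p"
proof (rule ccontr)
  assume "\<not> 0 < direction_moment i p"
  then have "direction_moment i p = 0" by (simp add: zero_less_iff_neq_zero)
  then have "AE z in lborel. ennreal (\<bar>(z::real^'n) $ i\<bar> powr p / norm z powr p) * indicator (cball 0 1) z = 0"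
    unfolding direction_moment_def by (subst (asm) nn_integral_0_iff_AE) auto
  moreover have "AE z in lborel. (z::real^'n) $ i \<noteq> 0"
  proof -
    have "{z::real^'n. z $ i = 0} \<in> null_sets lebesgue"
      using negligible_standard_hyperplane_cart[of i] by (simp add: negligible_iff_null_sets)
    then have "{z::real^'n. z $ i = 0} \<in> null_sets lborel"
      using null_sets_completion_iff[of "{z::real^'n. z $ i = 0}" lborel] by simp
    from AE_not_in[OF this] show ?thesis by simp
  qed
  ultimately have "AE z in lborel. z \<notin> cball (0::real^'n) 1"
  proof eventually_elim
    case (elim z)
    then have "norm z \<noteq> 0" by auto
    then have "\<bar>z $ i\<bar> powr p / norm z powr p > 0" using elim(2) by simp
    then show ?case using elim(1) by (auto simp: indicator_def split: if_splits)
  qed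
  then have "emeasure lborel (cball (0::real^'n) 1) = 0"
    by (subst (asm) AE_iff_measurable[OF _ refl]) (auto simp: cball_def)
  then show False using unit_ball_vol_pos[of "real CARD('n)"] by (simp add: emeasure_cball)
qed

lemma K_const_pos_finite:
  fixes i :: "'n::finite"
  assumes "1 < p"
  shows "0 < K_const i p" "K_const i p < \<infinity>"
  using direction_moment_pos[of i p] direction_moment_finite[OF assms, of i] assms
  by (simp_all add: K_const_eq_direction_moment[OF assms] ennreal_zero_less_mult_iff ennreal_mult_less_top)

section \<open>Moments of the singular kernel over balls\<close>

lemma nn_integral_component_kernel:
  fixes i :: "'n::finite" and p b r :: real
  assumes p: "1 < p" and b: "0 < b" "b < 1" and r: "0 < r"
  shows "(\<integral>\<^sup>+h. ennreal (\<bar>(h::real^'n) $ i\<bar> powr p * norm h powr (b - CARD('n) - p)) * indicator (ball 0 r) h \<partial>lborel)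
    = ennreal (CARD('n) / b * r powr b) * direction_moment i p"
proof -
  have "b < DIM(real^'n)" using b by (simp add: less_le_trans[OF b(2)] Suc_leI)
  moreover have "(\<integral>\<^sup>+h. ennreal (\<bar>(h::real^'n) $ i\<bar> powr p * norm h powr (b - CARD('n) - p)) * indicator (ball 0 r) h \<partial>lborel)
    = (\<integral>\<^sup>+h. ennreal (\<bar>(h::real^'n) $ i\<bar> powr p / norm h powr p) * ennreal (norm h powr (b - DIM(real^'n))) * indicator (ball 0 r) h \<partial>lborel)"
  proof (rule nn_integral_cong)
    fix h :: "real^'n"
    show "ennreal (\<bar>h $ i\<bar> powr p * norm h powr (b - CARD('n) - p)) * indicator (ball 0 r) h
      = ennreal (\<bar>h $ i\<bar> powr p / norm h powr p) * ennreal (norm h powr (b - DIM(real^'n))) * indicator (ball 0 r) h"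
      unfolding powr_diff[of "norm h" "b - CARD('n)" p] by (simp flip: ennreal_mult')
  qed
  ultimately show ?thesis
    using nn_integral_homogeneous_powr_ball[of "\<lambda>z::real^'n. ennreal (\<bar>z $ i\<bar> powr p / norm z powr p)" b r, OF _ _ b(1) _ r]
    by (simp add: direction_moment_homogeneous direction_moment_def del: vector_scaleR_component norm_scaleR)
qed

text \<open>A rotation \<open>T\<close> taking |v| e_i to v gives v . T h = |v| h_i, which reduces
  every direction to the coordinate \<open>i\<close>. Only the right-hand side mentions
  \<open>i\<close>, so the constant does not depend on the coordinate chosen.\<close>

lemma nn_integral_direction_kernel:
  fixes v :: "real^'n::finite" and i :: 'n and p b r :: real
  assumes p: "1 < p" and b: "0 < b" "b < 1" and r: "0 < r"
  shows "(\<integral>\<^sup>+h. ennreal (\<bar>v \<bullet> h\<bar> powr p * norm h powr (b - CARD('n) - p)) * indicator (ball 0 r) h \<partial>lborel)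
    = ennreal (p / b * r powr b * norm v powr p) * K_const i p"
proof -
  obtain T :: "real^'n \<Rightarrow> real^'n" where T: "orthogonal_transformation T" "T (norm v *\<^sub>R axis i 1) = v"
    by (rule rotation_rightward_line[of v i]) blast
  have "v \<bullet> T h = norm v * h $ i" for h
  proof -
    have "v \<bullet> T h = T (norm v *\<^sub>R axis i 1) \<bullet> T h" by (simp add: T(2))
    also have "\<dots> = (norm v *\<^sub>R axis i 1) \<bullet> h" using T(1) by (simp only: orthogonal_transformation_def)
    finally show ?thesis by (simp add: inner_axis')
  qed
  note inner = this
  have "(\<integral>\<^sup>+h. ennreal (\<bar>v \<bullet> h\<bar> powr p * norm h powr (b - CARD('n) - p)) * indicator (ball 0 r) h \<partial>lborel)
    = (\<integral>\<^sup>+h. ennreal (\<bar>v \<bullet> T h\<bar> powr p * norm (T h) powr (b - CARD('n) - p)) * indicator (ball 0 r) (T h) \<partial>lborel)"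
    by (rule nn_integral_lborel_orthogonal[symmetric]) (auto simp: T)
  also have "\<dots> = (\<integral>\<^sup>+h. ennreal (norm v powr p) * (ennreal (\<bar>h $ i\<bar> powr p * norm h powr (b - CARD('n) - p)) * indicator (ball 0 r) h) \<partial>lborel)"
    by (intro nn_integral_cong)
       (simp add: inner orthogonal_transformation_norm[OF T(1)] abs_mult powr_mult indicator_def ennreal_mult' mult_ac)
  also have "\<dots> = ennreal (norm v powr p) * (ennreal (CARD('n) / b * r powr b) * direction_moment i p)"
    by (subst nn_integral_cmult) (auto simp: nn_integral_component_kernel[OF p b r])
  also have "\<dots> = ennreal (norm v powr p * (CARD('n) / b * r powr b)) * direction_moment i p"
    using b by (subst ennreal_mult, simp, simp, simp only: mult.assoc)
  also have "norm v powr p * (CARD('n) / b * r powr b) = (p / b * r powr b * norm v powr p) * (CARD('n) / p)"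
    using p b by (simp add: field_simps)
  also have "ennreal ((p / b * r powr b * norm v powr p) * (CARD('n) / p)) = ennreal (p / b * r powr b * norm v powr p) * ennreal (CARD('n) / p)"
    using p b by (intro ennreal_mult) auto
  finally show ?thesis
    by (simp only: K_const_eq_direction_moment[OF p] mult.assoc)
qed

lemma nn_integral_norm_kernel:
  fixes b r :: real
  assumes b: "0 < b" "b < 1" and r: "0 < r"
  shows "(\<integral>\<^sup>+h. ennreal (norm h powr (b - CARD('n))) * indicator (ball (0::real^'n::finite) r) h \<partial>lborel)
    = ennreal (CARD('n) / b * r powr b * measure lborel (cball (0::real^'n) 1))"
proof -
  have "b < DIM(real^'n)" using b by (simp add: less_le_trans[OF b(2)] Suc_leI)
  then have "(\<integral>\<^sup>+h. ennreal (norm h powr (b - CARD('n))) * indicator (ball (0::real^'n) r) h \<partial>lborel)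
    = ennreal (CARD('n) / b * r powr b) * emeasure lborel (cball (0::real^'n) 1)"
    using nn_integral_homogeneous_powr_ball[of "\<lambda>z::real^'n. 1" b r, OF _ _ b(1) _ r] by simp
  also have "emeasure lborel (cball (0::real^'n) 1) = ennreal (measure lborel (cball (0::real^'n) 1))"
    using emeasure_lborel_cball_finite[of "0::real^'n" 1] by (intro emeasure_eq_ennreal_measure) simp
  finally show ?thesis using b by (subst ennreal_mult) auto
qed

section \<open>Test functions\<close>

text \<open>The classical smooth function flat at 0, multiplied by powers of 1 / u. The powers make
  the family stable: dividing a member by u gives another member, and differentiating one gives a
  linear combination of members.\<close>

definition exp_tail :: "nat \<Rightarrow> real \<Rightarrow> real \<Rightarrow> real" where
  "exp_tail m c u = (if u > 0 then (1 / u) ^ m * exp (- (c / u)) else 0)"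

lemma exp_tail_tendsto_0:
  assumes "c > 0"
  shows "((\<lambda>u. exp_tail m c u) \<longlongrightarrow> 0) (at 0)"
proof -
  have "LIM u (at_right 0). c * inverse u :> at_top"
    using assms by (intro filterlim_tendsto_pos_mult_at_top[OF tendsto_const] filterlim_inverse_at_top_right)
  from filterlim_compose[OF tendsto_power_div_exp_0 this]
  have "((\<lambda>u. (1 / c) ^ m * ((c * inverse u) ^ m / exp (c * inverse u))) \<longlongrightarrow> (1 / c) ^ m * 0) (at_right 0)"
    by (rule tendsto_mult[OF tendsto_const])
  then have "((\<lambda>u. (1 / c) ^ m * ((c * inverse u) ^ m / exp (c * inverse u))) \<longlongrightarrow> 0) (at_right 0)" by simp
  moreover have "\<forall>\<^sub>F u in at_right 0. (1 / c) ^ m * ((c * inverse u) ^ m / exp (c * inverse u)) = exp_tail m c u"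
    using eventually_at_right_less[of "0::real"]
  proof eventually_elim
    case (elim u)
    then show ?case using assms
      by (simp add: exp_tail_def exp_minus field_simps power_divide)
  qed
  ultimately have right: "((\<lambda>u. exp_tail m c u) \<longlongrightarrow> 0) (at_right 0)"
    by (rule Lim_transform_eventually)
  have "\<forall>\<^sub>F u in at_left 0. exp_tail m c u = 0"
    by (simp add: eventually_at_filter exp_tail_def)
  then have left: "((\<lambda>u. exp_tail m c u) \<longlongrightarrow> 0) (at_left 0)"
    by (rule tendsto_eventually)
  show ?thesis using left right by (simp add: filterlim_split_at)
qed

lemma exp_tail_has_derivative:
  assumes "c > 0"
  shows "(exp_tail m c has_real_derivative (- real m * exp_tail (Suc m) c u + c * exp_tail (Suc (Suc m)) c u)) (at u)"
proof -
  consider "u < 0" | "u = 0" | "u > 0" by linarith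
  then show ?thesis
  proof cases
    case 1
    have "((\<lambda>u. 0) has_real_derivative 0) (at u)" by simp
    then have "(exp_tail m c has_real_derivative 0) (at u)"
      by (rule has_field_derivative_transform_within[where d="- u"]) (use 1 in \<open>auto simp: exp_tail_def dist_real_def\<close>)
    then show ?thesis using 1 by (simp add: exp_tail_def)
  next
    case 2
    \<comment> \<open>At 0 the difference quotient is itself the next member of the family, which
      tends to 0 there.\<close>
    have eq: "exp_tail m c h / h = exp_tail (Suc m) c h" for h
      by (simp add: exp_tail_def)
    have "(exp_tail m c has_real_derivative 0) (at 0)"
      using exp_tail_tendsto_0[OF assms, of "Suc m"]
      unfolding DERIV_def by (simp add: eq exp_tail_def[of m c 0])
    then show ?thesis using 2 by (simp add: exp_tail_def)
  next
    case 3
    have "((\<lambda>u. (1 / u) ^ m * exp (- (c / u))) has_real_derivative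
      (real m * (1 / u) ^ (m - 1) * (- (1 / u\<^sup>2))) * exp (- (c / u)) + (1 / u) ^ m * (exp (- (c / u)) * (c / u\<^sup>2))) (at u)"
      using 3 by (auto intro!: derivative_eq_intros simp: power2_eq_square)
    also have "(real m * (1 / u) ^ (m - 1) * (- (1 / u\<^sup>2))) = - real m * (1 / u) ^ Suc m"
      using 3 by (cases m) (auto simp: power2_eq_square field_simps)
    also have "- real m * (1 / u) ^ Suc m * exp (- (c / u)) + (1 / u) ^ m * (exp (- (c / u)) * (c / u\<^sup>2)) =
       - real m * exp_tail (Suc m) c u + c * exp_tail (Suc (Suc m)) c u"
      using 3 by (simp add: exp_tail_def power2_eq_square mult.commute mult.left_commute)
    finally show ?thesis
      by (rule has_field_derivative_transform_within[where d=u]) (use 3 in \<open>auto simp: exp_tail_def dist_real_def\<close>)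
  qed
qed

text \<open>An algebra of functions that is closed under partial derivatives, so that its members
  are smooth in the sense of iterated differentiability.\<close>

inductive_set exp_tail_algebra :: "(real^'n::finite \<Rightarrow> real) set" where
  gen: "c > 0 \<Longrightarrow> (\<lambda>x. exp_tail m c (\<alpha> * x $ i + \<beta>)) \<in> exp_tail_algebra"
| add: "\<phi> \<in> exp_tail_algebra \<Longrightarrow> \<psi> \<in> exp_tail_algebra \<Longrightarrow> (\<lambda>x. \<phi> x + \<psi> x) \<in> exp_tail_algebra"
| mult: "\<phi> \<in> exp_tail_algebra \<Longrightarrow> \<psi> \<in> exp_tail_algebra \<Longrightarrow> (\<lambda>x. \<phi> x * \<psi> x) \<in> exp_tail_algebra"
| scale: "\<phi> \<in> exp_tail_algebra \<Longrightarrow> (\<lambda>x. k * \<phi> x) \<in> exp_tail_algebra"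

lemma exp_tail_algebra_derivative:
  assumes "\<phi> \<in> exp_tail_algebra"
  shows "\<exists>\<phi>'. \<forall>x. (\<phi> has_derivative \<phi>' x) (at x) \<and> (\<forall>j. (\<lambda>x. \<phi>' x (axis j 1)) \<in> exp_tail_algebra)"
  using assms
proof induction
  case (gen c m \<alpha> i \<beta>)
  define e where "e x = - real m * exp_tail (Suc m) c (\<alpha> * x $ i + \<beta>) + c * exp_tail (Suc (Suc m)) c (\<alpha> * x $ i + \<beta>)"
    for x :: "real^'a"
  have d: "((\<lambda>x. exp_tail m c (\<alpha> * x $ i + \<beta>)) has_derivative (\<lambda>h. (\<alpha> * h $ i) * e x)) (at x)" for x :: "real^'a"
  proof -
    have "((\<lambda>x. \<alpha> * x $ i + \<beta>) has_derivative (\<lambda>h. \<alpha> * h $ i)) (at x)"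
      by (auto intro!: derivative_eq_intros bounded_linear_imp_has_derivative bounded_linear_vec_nth)
    from DERIV_compose_FDERIV[OF exp_tail_has_derivative[OF gen] this]
    show ?thesis by (simp add: e_def)
  qed
  have "(\<lambda>x. (\<alpha> * axis j 1 $ i) * e x) \<in> exp_tail_algebra" for j
    unfolding e_def using gen by (intro exp_tail_algebra.intros)
  then show ?case using d by (intro exI[of _ "\<lambda>x h. (\<alpha> * h $ i) * e x"]) auto
next
  case (add \<phi> \<psi>)
  then obtain \<phi>' \<psi>' where "\<And>x. (\<phi> has_derivative \<phi>' x) (at x)" "\<And>j. (\<lambda>x. \<phi>' x (axis j 1)) \<in> exp_tail_algebra"
    "\<And>x. (\<psi> has_derivative \<psi>' x) (at x)" "\<And>j. (\<lambda>x. \<psi>' x (axis j 1)) \<in> exp_tail_algebra" by blast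
  then show ?case
    by (intro exI[of _ "\<lambda>x h. \<phi>' x h + \<psi>' x h"]) (auto intro!: exp_tail_algebra.intros has_derivative_add)
next
  case (mult \<phi> \<psi>)
  then obtain \<phi>' \<psi>' where "\<And>x. (\<phi> has_derivative \<phi>' x) (at x)" "\<And>j. (\<lambda>x. \<phi>' x (axis j 1)) \<in> exp_tail_algebra"
    "\<And>x. (\<psi> has_derivative \<psi>' x) (at x)" "\<And>j. (\<lambda>x. \<psi>' x (axis j 1)) \<in> exp_tail_algebra" by blast
  then show ?case using mult.hyps
    by (intro exI[of _ "\<lambda>x h. \<phi> x * \<psi>' x h + \<phi>' x h * \<psi> x"]) (auto intro!: exp_tail_algebra.intros has_derivative_mult)
next
  case (scale \<phi> k)
  then obtain \<phi>' where "\<And>x. (\<phi> has_derivative \<phi>' x) (at x)" "\<And>j. (\<lambda>x. \<phi>' x (axis j 1)) \<in> exp_tail_algebra" by blast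
  then show ?case
    by (intro exI[of _ "\<lambda>x h. k * \<phi>' x h"]) (auto intro!: exp_tail_algebra.intros has_derivative_mult_right)
qed

lemma partial_deriv_eq:
  assumes "\<And>x. (\<phi> has_derivative \<phi>' x) (at x)"
  shows "partial_deriv i \<phi> = (\<lambda>x. \<phi>' x (axis i 1))"
  using frechet_derivative_at[OF assms] by (auto simp: partial_deriv_def fun_eq_iff)

lemma exp_tail_algebra_partial_deriv:
  assumes "\<phi> \<in> exp_tail_algebra"
  shows "partial_deriv i \<phi> \<in> exp_tail_algebra"
proof -
  obtain \<phi>' where d: "\<And>x. (\<phi> has_derivative \<phi>' x) (at x)" and a: "\<And>j. (\<lambda>x. \<phi>' x (axis j 1)) \<in> exp_tail_algebra"
    using exp_tail_algebra_derivative[OF assms] by blast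
  show ?thesis using a[of i] unfolding partial_deriv_eq[OF d] .
qed

lemma exp_tail_algebra_smooth:
  assumes "\<phi> \<in> exp_tail_algebra"
  shows "smooth_fun \<phi>"
  unfolding smooth_fun_def
proof (intro allI)
  fix l :: "'a list" and x
  have "foldr partial_deriv l \<phi> \<in> exp_tail_algebra"
    by (induction l) (auto simp: assms exp_tail_algebra_partial_deriv)
  from exp_tail_algebra_derivative[OF this]
  show "foldr partial_deriv l \<phi> differentiable at x" by (auto simp: differentiable_def)
qed

text \<open>Two one-sided exponentials per coordinate. As 1 / (k + 1) tends to 0, these bumps
  converge to the indicator of the open box while staying between 0 and 1; this links test functions
  to integrals over boxes.\<close>

definition box_bump :: "nat \<Rightarrow> real^'n \<Rightarrow> real^'n \<Rightarrow> real^'n::finite \<Rightarrow> real" where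
  "box_bump k a b x = (\<Prod>i\<in>UNIV. exp_tail 0 (1 / real (Suc k)) (x $ i - a $ i) * exp_tail 0 (1 / real (Suc k)) (b $ i - x $ i))"

lemma prod_in_exp_tail_algebra:
  assumes "finite I" "I \<noteq> {}" "\<And>i. i \<in> I \<Longrightarrow> F i \<in> exp_tail_algebra"
  shows "(\<lambda>x. \<Prod>i\<in>I. F i x) \<in> exp_tail_algebra"
  using assms by (induction I rule: finite_ne_induct) (auto intro!: exp_tail_algebra.mult)

lemma box_bump_in_exp_tail_algebra: "box_bump k a b \<in> exp_tail_algebra"
proof -
  have "(\<lambda>x. exp_tail 0 (1 / real (Suc k)) (x $ i - a $ i) * exp_tail 0 (1 / real (Suc k)) (b $ i - x $ i)) \<in> exp_tail_algebra" for i
  proof (rule exp_tail_algebra.mult)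
    show "(\<lambda>x. exp_tail 0 (1 / real (Suc k)) (x $ i - a $ i)) \<in> exp_tail_algebra"
      using exp_tail_algebra.gen[of "1 / real (Suc k)" 0 1 i "- (a $ i)"] by simp
    show "(\<lambda>x. exp_tail 0 (1 / real (Suc k)) (b $ i - x $ i)) \<in> exp_tail_algebra"
      using exp_tail_algebra.gen[of "1 / real (Suc k)" 0 "-1" i "b $ i"] by simp
  qed
  then show ?thesis
    unfolding box_bump_def[abs_def] by (intro prod_in_exp_tail_algebra) auto
qed

lemma exp_tail_0_bounds: "c > 0 \<Longrightarrow> 0 \<le> exp_tail 0 c u" "c > 0 \<Longrightarrow> exp_tail 0 c u \<le> 1"
  by (auto simp: exp_tail_def)

lemma box_bump_bounds: "0 \<le> box_bump k a b x" "box_bump k a b x \<le> 1"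
proof -
  show "0 \<le> box_bump k a b x"
    unfolding box_bump_def by (intro prod_nonneg mult_nonneg_nonneg exp_tail_0_bounds ballI) auto
  show "box_bump k a b x \<le> 1"
    unfolding box_bump_def
    by (intro prod_le_1 conjI mult_nonneg_nonneg mult_le_one exp_tail_0_bounds) auto
qed

lemma box_bump_eq_0:
  assumes "x \<notin> box a b"
  shows "box_bump k a b x = 0"
proof -
  obtain i where "\<not> (a $ i < x $ i \<and> x $ i < b $ i)" using assms by (auto simp: mem_box_cart)
  then have "exp_tail 0 (1 / real (Suc k)) (x $ i - a $ i) * exp_tail 0 (1 / real (Suc k)) (b $ i - x $ i) = 0"
    by (auto simp: exp_tail_def)
  then show ?thesis unfolding box_bump_def by (intro prod_zero) auto
qed

lemma box_bump_tendsto: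
  fixes a :: "real^'n::finite"
  shows "(\<lambda>k. box_bump k a b x) \<longlonglongrightarrow> indicator (box a b) x"
proof (cases "x \<in> box a b")
  case False
  then show ?thesis by (simp add: box_bump_eq_0)
next
  case True
  have e1: "(\<lambda>k. exp_tail 0 (1 / real (Suc k)) u) \<longlonglongrightarrow> 1" if "u > 0" for u
  proof -
    have "(\<lambda>k. exp (- (1 / u * inverse (real (Suc k))))) \<longlonglongrightarrow> exp (- (1 / u * 0))"
      by (intro tendsto_intros LIMSEQ_inverse_real_of_nat)
    then show ?thesis using that by (simp add: exp_tail_def field_simps)
  qed
  have "(\<lambda>k. box_bump k a b x) \<longlonglongrightarrow> (\<Prod>i\<in>(UNIV::'n set). 1 * 1)"
    unfolding box_bump_def using True by (intro tendsto_prod tendsto_mult e1) (auto simp: mem_box_cart)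
  then show ?thesis using True by simp
qed

lemma test_fun_box_bump:
  assumes "cbox a b \<subseteq> \<Omega>"
  shows "test_fun \<Omega> (box_bump k a b)"
proof -
  have sub: "{x. box_bump k a b x \<noteq> 0} \<subseteq> cbox a b"
    using box_bump_eq_0 box_subset_cbox by blast
  then have cl: "closure {x. box_bump k a b x \<noteq> 0} \<subseteq> cbox a b"
    by (intro closure_minimal) (auto intro: closed_cbox)
  then have "compact (closure {x. box_bump k a b x \<noteq> 0})"
    using compact_cbox closed_closure by (metis bounded_cbox bounded_subset compact_eq_bounded_closed)
  then show ?thesis
    using cl assms exp_tail_algebra_smooth[OF box_bump_in_exp_tail_algebra] unfolding test_fun_def by blast
qed

section \<open>Regularity, support and bounds of test functions\<close>

lemma test_fun_differentiable: "test_fun \<Omega> \<phi> \<Longrightarrow> \<phi> differentiable (at x)"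
  unfolding test_fun_def smooth_fun_def by (metis foldr_Nil id_apply)

lemma test_fun_continuous_on: "test_fun \<Omega> \<phi> \<Longrightarrow> continuous_on S \<phi>"
  using test_fun_differentiable differentiable_imp_continuous_within
  by (metis continuous_at_imp_continuous_on)

lemma test_fun_measurable [measurable_dest]: "test_fun \<Omega> \<phi> \<Longrightarrow> \<phi> \<in> borel_measurable borel"
  using test_fun_continuous_on borel_measurable_continuous_onI by blast

lemma partial_deriv_test_fun_continuous_on:
  assumes "test_fun \<Omega> \<phi>"
  shows "continuous_on S (partial_deriv i \<phi>)"
proof -
  have "foldr partial_deriv [i] \<phi> differentiable at x" for x
    using assms unfolding test_fun_def smooth_fun_def by blast
  then show ?thesis
    using differentiable_imp_continuous_within by (auto intro!: continuous_at_imp_continuous_on)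
qed

lemma partial_deriv_test_fun_measurable [measurable_dest]:
  "test_fun \<Omega> \<phi> \<Longrightarrow> partial_deriv i \<phi> \<in> borel_measurable borel"
  using partial_deriv_test_fun_continuous_on borel_measurable_continuous_onI by blast

lemma test_fun_support:
  assumes "test_fun \<Omega> \<phi>"
  obtains K where "compact K" "K \<subseteq> \<Omega>" "\<And>x. x \<notin> K \<Longrightarrow> \<phi> x = 0" "\<And>x i. x \<notin> K \<Longrightarrow> partial_deriv i \<phi> x = 0"
proof (rule that[of "closure {x. \<phi> x \<noteq> 0}"])
  show "compact (closure {x. \<phi> x \<noteq> 0})" "closure {x. \<phi> x \<noteq> 0} \<subseteq> \<Omega>"
    using assms by (auto simp: test_fun_def)
  show "\<phi> x = 0" if "x \<notin> closure {x. \<phi> x \<noteq> 0}" for x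
    using that closure_subset[of "{x. \<phi> x \<noteq> 0}"] by auto
  show "partial_deriv i \<phi> x = 0" if "x \<notin> closure {x. \<phi> x \<noteq> 0}" for x i
  proof -
    have "((\<lambda>_. 0) has_derivative (\<lambda>_. 0)) (at x)" by simp
    then have "(\<phi> has_derivative (\<lambda>_. 0)) (at x)"
      by (rule has_derivative_transform_within_open[where s="- closure {x. \<phi> x \<noteq> 0}"])
         (use that closure_subset[of "{x. \<phi> x \<noteq> 0}"] in \<open>auto intro!: open_Compl\<close>)
    from frechet_derivative_at[OF this, symmetric] show ?thesis by (simp add: partial_deriv_def)
  qed
qed

lemma test_fun_bounded:
  assumes "test_fun \<Omega> \<phi>"
  obtains B where "B > 0" "\<And>x. \<bar>\<phi> x\<bar> \<le> B" "\<And>x i. \<bar>partial_deriv i \<phi> x\<bar> \<le> B"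
proof -
  obtain K where K: "compact K" "\<And>x. x \<notin> K \<Longrightarrow> \<phi> x = 0" "\<And>x i. x \<notin> K \<Longrightarrow> partial_deriv i \<phi> x = 0"
    using test_fun_support[OF assms] by metis
  have bd: "\<exists>B. \<forall>x. \<bar>\<psi> x\<bar> \<le> B" if "continuous_on K \<psi>" "\<And>x. x \<notin> K \<Longrightarrow> \<psi> x = 0" for \<psi> :: "real^'a \<Rightarrow> real"
  proof -
    have "bounded (\<psi> ` K)" using compact_continuous_image[OF that(1) K(1)] compact_imp_bounded by blast
    then obtain B where "\<And>x. x \<in> K \<Longrightarrow> \<bar>\<psi> x\<bar> \<le> B" by (auto simp: bounded_iff)
    then have "\<bar>\<psi> x\<bar> \<le> max B 0" for x using that(2)[of x] by (cases "x \<in> K") force+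
    then show ?thesis by blast
  qed
  obtain B0 where B0: "\<And>x. \<bar>\<phi> x\<bar> \<le> B0"
    using bd[OF test_fun_continuous_on[OF assms] K(2)] by blast
  have "\<forall>i. \<exists>B. \<forall>x. \<bar>partial_deriv i \<phi> x\<bar> \<le> B"
    using bd[OF partial_deriv_test_fun_continuous_on[OF assms] K(3)] by blast
  then obtain B where B: "\<And>i x. \<bar>partial_deriv i \<phi> x\<bar> \<le> B i" by metis
  define C where "C = \<bar>B0\<bar> + (\<Sum>i\<in>UNIV. \<bar>B i\<bar>) + 1"
  have "\<bar>B i\<bar> \<le> (\<Sum>i\<in>UNIV. \<bar>B i\<bar>)" for i by (rule member_le_sum) auto
  then have "\<bar>partial_deriv i \<phi> x\<bar> \<le> C" for i x
    using B[of i x] unfolding C_def by (smt (verit, best))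
  moreover have sB: "(\<Sum>i\<in>UNIV. \<bar>B i\<bar>) \<ge> 0" by (rule sum_nonneg) auto
  moreover have "C > 0" using sB unfolding C_def by linarith
  moreover have "\<bar>\<phi> x\<bar> \<le> C" for x using B0[of x] sB unfolding C_def by linarith
  ultimately show ?thesis using that by blast
qed

lemma test_fun_has_derivative:
  assumes "test_fun \<Omega> \<phi>"
  shows "(\<phi> has_derivative (\<lambda>h. \<Sum>i\<in>UNIV. h $ i * partial_deriv i \<phi> x)) (at x)"
proof -
  define D where "D = frechet_derivative \<phi> (at x)"
  have D: "(\<phi> has_derivative D) (at x)"
    using test_fun_differentiable[OF assms] frechet_derivative_works unfolding D_def by blast
  then interpret D: linear D by (rule has_derivative_linear)
  have "D h = (\<Sum>i\<in>UNIV. h $ i * partial_deriv i \<phi> x)" for h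
  proof -
    have "h = (\<Sum>i\<in>UNIV. h $ i *\<^sub>R axis i 1)"
      using basis_expansion[of h] by (simp add: scalar_mult_eq_scaleR)
    then have "D h = D (\<Sum>i\<in>UNIV. h $ i *\<^sub>R axis i 1)" by simp
    also have "\<dots> = (\<Sum>i\<in>UNIV. h $ i * partial_deriv i \<phi> x)"
      unfolding D.sum D.scale by (simp add: partial_deriv_def D_def)
    finally show ?thesis .
  qed
  then show ?thesis using D by presburger
qed

section \<open>The fundamental lemma of the calculus of variations\<close>

lemma lborel_null_of_negligible:
  assumes "negligible S" "S \<in> sets borel"
  shows "S \<in> null_sets lborel"
  using assms null_sets_completion_iff[of S lborel] by (simp add: negligible_iff_null_sets)

text \<open>Bumps converging to the indicator of a box show that \<open>u\<close> has integral 0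
  over each open box whose closed box lies in \<open>U\<close>. Boxes are stable under intersection
  and generate the Borel sets, so the integrals over all Borel subsets of such a box vanish as well,
  and these determine a density almost everywhere.\<close>

lemma AE_zero_of_test_integrals:
  fixes u :: "real^'n::finite \<Rightarrow> real"
  assumes [measurable]: "u \<in> borel_measurable borel" and U: "open U"
    and int: "\<And>K. compact K \<Longrightarrow> K \<subseteq> U \<Longrightarrow> set_integrable lborel K u"
    and zero: "\<And>\<phi>. test_fun U \<phi> \<Longrightarrow> (LINT x|lborel. u x * \<phi> x) = 0"
  shows "AE x in lborel. x \<in> U \<longrightarrow> u x = 0"
proof -
  have box0: "(LINT x:box a b|lborel. u x) = 0" if "cbox a b \<subseteq> U" for a b
  proof -
    have i: "set_integrable lborel (cbox a b) u" using int that by simp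
    have "(\<lambda>k. LINT x|lborel. u x * box_bump k a b x) \<longlonglongrightarrow> (LINT x|lborel. u x * indicator (box a b) x)"
    proof (rule integral_dominated_convergence[where w="\<lambda>x. \<bar>indicator (cbox a b) x *\<^sub>R u x\<bar>"])
      show "(\<lambda>x. u x * box_bump k a b x) \<in> borel_measurable lborel" for k
        using test_fun_measurable[OF test_fun_box_bump[OF that]] by simp
      show "integrable lborel (\<lambda>x. \<bar>indicator (cbox a b) x *\<^sub>R u x\<bar>)"
        using i unfolding set_integrable_def by simp
      show "AE x in lborel. (\<lambda>k. u x * box_bump k a b x) \<longlonglongrightarrow> u x * indicator (box a b) x"
        by (intro AE_I2 tendsto_mult tendsto_const box_bump_tendsto)
      show "AE x in lborel. norm (u x * box_bump k a b x) \<le> \<bar>indicator (cbox a b) x *\<^sub>R u x\<bar>" for k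
      proof (intro AE_I2)
        fix x
        show "norm (u x * box_bump k a b x) \<le> \<bar>indicator (cbox a b) x *\<^sub>R u x\<bar>"
          using box_bump_bounds[of k a b x] box_bump_eq_0[of x a b k] box_subset_cbox[of a b]
          by (cases "x \<in> box a b") (auto simp: abs_mult indicator_def mult_left_le)
      qed
    qed simp
    moreover have "(LINT x|lborel. u x * box_bump k a b x) = 0" for k
      using zero[OF test_fun_box_bump[OF that]] .
    ultimately have "(LINT x|lborel. u x * indicator (box a b) x) = 0"
      by (simp add: LIMSEQ_const_iff)
    then show ?thesis by (simp add: set_lebesgue_integral_def mult.commute)
  qed
  have cbox0: "AE x in lborel. x \<in> cbox a b \<longrightarrow> u x = 0" if ab: "cbox a b \<subseteq> U" for a b
  proof -
    \<comment> \<open>The cut-off function is integrable on the whole space with total integral 0;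
      this is what the complement step of the induction over Borel sets uses.\<close>
    define v where "v x = indicator (box a b) x *\<^sub>R u x" for x
    have iv: "integrable lborel v"
      using set_integrable_subset[OF int[OF compact_cbox ab], of "box a b"] box_subset_cbox[of a b]
      by (simp add: v_def[abs_def] set_integrable_def)
    have sb: "sets (lborel :: (real^'n) measure) = sigma_sets UNIV (range (\<lambda>(a, b). box a b :: (real^'n) set))"
      by (simp, subst borel_eq_box, simp)
    have v0: "(LINT x:A|lborel. v x) = 0" if "A \<in> sigma_sets UNIV (range (\<lambda>(a, b). box a b :: (real^'n) set))" for A
    proof (rule sigma_sets_induct_disjoint[OF _ _ that])
      show "Int_stable (range (\<lambda>(a, b). box a b :: (real^'n) set))"
        by (auto simp: Int_stable_def box_Int_box)
      show "range (\<lambda>(a, b). box a b) \<subseteq> Pow (UNIV :: (real^'n) set)" by simp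
    next
      fix A assume "A \<in> range (\<lambda>(a, b). box a b :: (real^'n) set)"
      then obtain c d where A: "A = box c d" by auto
      define e f where "e = (\<Sum>i\<in>Basis. max (c\<bullet>i) (a\<bullet>i) *\<^sub>R i)" and "f = (\<Sum>i\<in>Basis. min (d\<bullet>i) (b\<bullet>i) *\<^sub>R i)"
      have eq: "box c d \<inter> box a b = box e f" by (simp add: e_def f_def box_Int_box)
      have "cbox e f \<subseteq> cbox a b" by (auto simp: mem_box e_def f_def)
      then have "(LINT x:box e f|lborel. u x) = 0" using box0 ab by blast
      moreover have "indicator A x *\<^sub>R v x = indicator (box e f) x *\<^sub>R u x" for x
        unfolding eq[symmetric] A v_def by (simp add: indicator_def)
      ultimately show "(LINT x:A|lborel. v x) = 0" by (simp add: set_lebesgue_integral_def)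
    next
      fix A assume A: "A \<in> sigma_sets UNIV (range (\<lambda>(a, b). box a b :: (real^'n) set))" and A0: "(LINT x:A|lborel. v x) = 0"
      have [measurable]: "A \<in> sets borel" using A sb by simp
      have "(LINT x:UNIV - A|lborel. v x) = (LINT x|lborel. v x - indicator A x *\<^sub>R v x)"
        unfolding set_lebesgue_integral_def by (intro Bochner_Integration.integral_cong) (auto simp: indicator_def)
      also have "\<dots> = (LINT x|lborel. v x) - (LINT x:A|lborel. v x)"
        unfolding set_lebesgue_integral_def
        by (intro Bochner_Integration.integral_diff iv integrable_mult_indicator) simp
      also have "(LINT x|lborel. v x) = 0"
        using box0[OF ab] by (simp add: set_lebesgue_integral_def v_def)
      finally show "(LINT x:UNIV - A|lborel. v x) = 0" using A0 by simp
    next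
      fix A :: "nat \<Rightarrow> (real^'n) set"
      assume dj: "disjoint_family A" and r: "range A \<subseteq> sigma_sets UNIV (range (\<lambda>(a, b). box a b :: (real^'n) set))"
        and A0: "\<And>i. (LINT x:A i|lborel. v x) = 0"
      have ms: "A i \<in> sets lborel" for i using r unfolding sb by blast
      have "set_integrable lborel (\<Union>i. A i) v"
        unfolding set_integrable_def by (intro integrable_mult_indicator iv sets.countable_UN) (use ms in auto)
      then have "(LINT x:(\<Union>i. A i)|lborel. v x) = (\<Sum>i. (LINT x:(A i)|lborel. v x))"
        using dj ms by (intro lebesgue_integral_countable_add) (auto simp: disjoint_family_on_def)
      then show "(LINT x:(\<Union>i. A i)|lborel. v x) = 0" by (simp add: A0)
    qed (simp add: set_lebesgue_integral_def)
    have "AE x in lborel. v x = (0::real)"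
    proof (rule density_unique_real[OF iv])
      show "(LINT x:A|lborel. v x) = (LINT x:A|lborel. (0::real))" if "A \<in> sets lborel" for A
        using v0[of A] that unfolding sb by (simp add: set_lebesgue_integral_def)
    qed simp
    moreover have "AE x in lborel. x \<notin> cbox a b - box a b"
      by (intro AE_not_in lborel_null_of_negligible negligible_frontier_interval) simp
    ultimately show ?thesis by eventually_elim (auto simp: v_def indicator_def split: if_splits)
  qed
  obtain D where D: "countable D" "D \<subseteq> Pow U" "\<And>X. X \<in> D \<Longrightarrow> \<exists>a b. X = cbox a b" "\<Union>D = U"
    by (rule open_countable_Union_open_cbox[OF U]) auto
  have "AE x in lborel. \<forall>X\<in>D. x \<in> X \<longrightarrow> u x = 0"
    unfolding AE_ball_countable[OF D(1)]
  proof
    fix X assume "X \<in> D"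
    moreover from this obtain a b where "X = cbox a b" using D(3) by blast
    ultimately show "AE x in lborel. x \<in> X \<longrightarrow> u x = 0" using cbox0[of a b] D(2) by auto
  qed
  then show ?thesis by eventually_elim (use D(4) in auto)
qed

section \<open>Weak gradients along segments\<close>

lemma borel_measurable_vec_component [measurable (raw)]:
  fixes f :: "'a \<Rightarrow> real^'n::finite"
  assumes [measurable]: "f \<in> borel_measurable M"
  shows "(\<lambda>x. f x $ i) \<in> borel_measurable M"
proof -
  have "(\<lambda>v::real^'n. v $ i) \<in> borel_measurable borel"
    by (intro borel_measurable_continuous_onI continuous_intros)
  then show ?thesis by (rule measurable_compose[OF assms])
qed

lemma integrable_lborel_pairI:
  fixes H :: "'a::euclidean_space \<times> 'b::euclidean_space \<Rightarrow> real"
  assumes [measurable]: "H \<in> borel_measurable (lborel \<Otimes>\<^sub>M lborel)"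
    and fin: "(\<integral>\<^sup>+x. \<integral>\<^sup>+y. ennreal \<bar>H (x, y)\<bar> \<partial>lborel \<partial>lborel) < \<infinity>"
  shows "integrable (lborel \<Otimes>\<^sub>M lborel) H"
proof (rule integrableI_bounded)
  show "(\<integral>\<^sup>+z. ennreal (norm (H z)) \<partial>(lborel \<Otimes>\<^sub>M lborel)) < \<infinity>"
    using fin by (subst lborel.nn_integral_fst[symmetric]) auto
qed simp

lemma integrable_compact_support_mult:
  fixes f \<psi> :: "'a::euclidean_space \<Rightarrow> real"
  assumes f: "set_integrable lborel K f" and [measurable]: "\<psi> \<in> borel_measurable borel" "f \<in> borel_measurable borel"
    and B: "\<And>x. \<bar>\<psi> x\<bar> \<le> B" and z: "\<And>x. x \<notin> K \<Longrightarrow> \<psi> x = 0"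
  shows "integrable lborel (\<lambda>x. f x * \<psi> x)"
proof (rule Bochner_Integration.integrable_bound[where f="\<lambda>x. B * norm (indicator K x *\<^sub>R f x)"])
  show "integrable lborel (\<lambda>x. B * norm (indicator K x *\<^sub>R f x))"
    using f unfolding set_integrable_def by (intro integrable_mult_right integrable_norm)
  show "AE x in lborel. norm (f x * \<psi> x) \<le> norm (B * norm (indicator K x *\<^sub>R f x))"
  proof (rule AE_I2)
    fix x
    show "norm (f x * \<psi> x) \<le> norm (B * norm (indicator K x *\<^sub>R f x))"
      using B[of x] z[of x] mult_mono[of "\<bar>\<psi> x\<bar>" "\<bar>B\<bar>" "\<bar>f x\<bar>" "\<bar>f x\<bar>"]
      by (cases "x \<in> K") (auto simp: abs_mult mult.commute)
  qed
qed simp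

lemma partial_deriv_translate:
  assumes "\<And>x. \<phi> differentiable (at x)"
  shows "partial_deriv i (\<lambda>x. \<phi> (x - c)) = (\<lambda>x. partial_deriv i \<phi> (x - c))"
proof
  fix x
  have d: "(\<phi> has_derivative frechet_derivative \<phi> (at (x - c))) (at (x - c))"
    using assms frechet_derivative_works by blast
  have "((\<lambda>x. x - c) has_derivative (\<lambda>h. h)) (at x)" by (auto intro!: derivative_eq_intros)
  from has_derivative_compose[OF this d]
  have "((\<lambda>x. \<phi> (x - c)) has_derivative frechet_derivative \<phi> (at (x - c))) (at x)" by simp
  from frechet_derivative_at[OF this, symmetric]
  show "partial_deriv i (\<lambda>x. \<phi> (x - c)) x = partial_deriv i \<phi> (x - c)"
    by (simp add: partial_deriv_def)
qed

lemma test_fun_translate: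
  assumes \<phi>: "test_fun U \<phi>" and sub: "\<And>x. x \<in> U \<Longrightarrow> x + c \<in> \<Omega>"
  shows "test_fun \<Omega> (\<lambda>x. \<phi> (x - c))"
    and "partial_deriv i (\<lambda>x. \<phi> (x - c)) = (\<lambda>x. partial_deriv i \<phi> (x - c))"
proof -
  have sm: "\<And>l x. foldr partial_deriv l \<phi> differentiable (at x)"
    using \<phi> unfolding test_fun_def smooth_fun_def by blast
  have eq: "foldr partial_deriv l (\<lambda>x. \<phi> (x - c)) = (\<lambda>x. foldr partial_deriv l \<phi> (x - c))" for l
    by (induction l) (auto simp: partial_deriv_translate[OF sm])
  have "smooth_fun (\<lambda>x. \<phi> (x - c))"
    unfolding smooth_fun_def eq
  proof (intro allI)
    fix l x
    have "(\<lambda>x. x - c) differentiable (at x)" by (intro differentiable_diff) auto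
    from differentiable_chain_at[OF this sm[of l "x - c"]]
    show "(\<lambda>x. foldr partial_deriv l \<phi> (x - c)) differentiable (at x)" by (simp add: o_def)
  qed
  moreover have S: "{x. \<phi> (x - c) \<noteq> 0} = (+) c ` {x. \<phi> x \<noteq> 0}"
    by (auto simp: image_iff) (metis add.commute diff_add_cancel)
  moreover have cl: "closure {x. \<phi> (x - c) \<noteq> 0} = (+) c ` closure {x. \<phi> x \<noteq> 0}"
    unfolding S by (rule closure_translation)
  moreover have "compact ((+) c ` closure {x. \<phi> x \<noteq> 0})"
    using \<phi> by (intro compact_translation) (simp add: test_fun_def)
  moreover have "(+) c ` closure {x. \<phi> x \<noteq> 0} \<subseteq> \<Omega>"
    using \<phi> sub by (force simp: test_fun_def add.commute)
  ultimately show "test_fun \<Omega> (\<lambda>x. \<phi> (x - c))" unfolding test_fun_def by simp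
  show "partial_deriv i (\<lambda>x. \<phi> (x - c)) = (\<lambda>x. partial_deriv i \<phi> (x - c))"
    using sm[of "[]"] by (intro partial_deriv_translate) simp
qed

text \<open>Tested against \<open>\<phi>\<close>, the difference becomes the integral of f(y)
  (\<open>\<phi>\<close>(y - h) - \<open>\<phi>\<close>(y)), and the bracket is an integral over t
  of directional derivatives of the translates of \<open>\<phi>\<close> by t h. The segment
  condition makes each translate a test function on \<open>\<Omega>\<close>, so the weak gradient
  enters for each t separately; \<open>AE_zero_of_test_integrals\<close> finally removes
  \<open>\<phi>\<close>.\<close>

lemma translate_diff_eq_segment_integral:
  fixes f :: "real^'n::finite \<Rightarrow> real" and g :: "real^'n \<Rightarrow> real^'n" and h :: "real^'n"
  assumes [measurable]: "f \<in> borel_measurable borel" "g \<in> borel_measurable borel"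
    and U: "open U" and seg: "\<And>x t. x \<in> U \<Longrightarrow> 0 \<le> t \<Longrightarrow> t \<le> 1 \<Longrightarrow> x + t *\<^sub>R h \<in> \<Omega>"
    and fint: "\<And>K. compact K \<Longrightarrow> K \<subseteq> \<Omega> \<Longrightarrow> set_integrable lborel K f"
    and gint: "\<And>K. compact K \<Longrightarrow> K \<subseteq> \<Omega> \<Longrightarrow> set_integrable lborel K g"
    and weak: "\<And>\<phi> i. test_fun \<Omega> \<phi> \<Longrightarrow>
      (LINT x|lborel. f x * partial_deriv i \<phi> x) = - (LINT x|lborel. g x $ i * \<phi> x)"
  shows "AE x in lborel. x \<in> U \<longrightarrow>
    set_integrable lborel {0..1} (\<lambda>t. g (x + t *\<^sub>R h) \<bullet> h) \<and>
    f (x + h) - f x = (LINT t:{0..1}|lborel. g (x + t *\<^sub>R h) \<bullet> h)"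
proof -
  define I where "I = (indicator {0..1} :: real \<Rightarrow> real)"
  have [measurable]: "I \<in> borel_measurable borel" by (simp add: I_def)
  have I01: "0 \<le> I t" "I t \<le> 1" for t by (auto simp: I_def indicator_def)
  define G where "G x t = I t * (g (x + t *\<^sub>R h) \<bullet> h)" for x t
  have [measurable]: "case_prod G \<in> borel_measurable (borel \<Otimes>\<^sub>M borel)"
    unfolding G_def by measurable
  define w where "w x = (LINT t|lborel. G x t)" for x
  have [measurable]: "w \<in> borel_measurable borel"
    unfolding w_def by (rule lborel.borel_measurable_lebesgue_integral) measurable
  \<comment> \<open>The set swept by the segments starting in \<open>K\<close>. It is a compact
    subset of \<open>\<Omega>\<close> when \<open>K\<close> is one of \<open>U\<close>, so local
    integrability of \<open>f\<close> and \<open>g\<close> on it supplies the bounds for both uses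
    of Fubini.\<close>
  define K' where "K' K = (\<lambda>(x, t). x + t *\<^sub>R h) ` (K \<times> {0..1::real})" for K
  have K'_compact: "compact (K' K)" if "compact K" for K
    unfolding K'_def using that
    by (intro compact_continuous_image compact_Times) (auto intro!: continuous_intros simp: split_beta)
  have K'_sub: "K' K \<subseteq> \<Omega>" if "K \<subseteq> U" for K
    unfolding K'_def using that seg by auto
  have K'_mem: "x + t *\<^sub>R h \<in> K' K" if "x \<in> K" "0 \<le> t" "t \<le> 1" for x t K
    unfolding K'_def using that by force
  have G_int: "integrable (lborel \<Otimes>\<^sub>M lborel) (\<lambda>(x, t). indicator K x * G x t)" if K: "compact K" "K \<subseteq> U" for K
  proof (rule integrable_lborel_pairI)
    have [measurable]: "K \<in> sets borel" "K' K \<in> sets borel"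
      using K K'_compact borel_compact by auto
    have gK: "(\<integral>\<^sup>+x. ennreal (norm (indicator (K' K) x *\<^sub>R g x)) \<partial>lborel) < \<infinity>"
      using gint[OF K'_compact[OF K(1)] K'_sub[OF K(2)]] unfolding set_integrable_def integrable_iff_bounded by simp
    show "(\<lambda>(x, t). indicator K x * G x t) \<in> borel_measurable (lborel \<Otimes>\<^sub>M lborel)" by measurable
    have "(\<integral>\<^sup>+x. \<integral>\<^sup>+t. ennreal \<bar>indicator K x * G x t\<bar> \<partial>lborel \<partial>lborel) = (\<integral>\<^sup>+t. \<integral>\<^sup>+x. ennreal \<bar>indicator K x * G x t\<bar> \<partial>lborel \<partial>lborel)"
      by (rule lborel_pair.Fubini'[symmetric]) measurable
    also have "\<dots> \<le> (\<integral>\<^sup>+t. ennreal (norm h) * (\<integral>\<^sup>+x. ennreal (norm (indicator (K' K) x *\<^sub>R g x)) \<partial>lborel) * indicator {0..1::real} t \<partial>lborel)"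
    proof (rule nn_integral_mono)
      fix t :: real
      have "(\<integral>\<^sup>+x. ennreal \<bar>indicator K x * G x t\<bar> \<partial>lborel) \<le> (\<integral>\<^sup>+x. ennreal (norm h) * ennreal (norm (indicator (K' K) (x + t *\<^sub>R h) *\<^sub>R g (x + t *\<^sub>R h))) * indicator {0..1} t \<partial>lborel)"
      proof (rule nn_integral_mono)
        fix x
        show "ennreal \<bar>indicator K x * G x t\<bar> \<le> ennreal (norm h) * ennreal (norm (indicator (K' K) (x + t *\<^sub>R h) *\<^sub>R g (x + t *\<^sub>R h))) * indicator {0..1} t"
          using K'_mem[of x K t] Cauchy_Schwarz_ineq2[of "g (x + t *\<^sub>R h)" h]
          by (cases "x \<in> K \<and> 0 \<le> t \<and> t \<le> 1") (auto simp: G_def I_def indicator_def mult.commute simp flip: ennreal_mult')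
      qed
      also have "\<dots> = ennreal (norm h) * (\<integral>\<^sup>+x. ennreal (norm (indicator (K' K) (x + t *\<^sub>R h) *\<^sub>R g (x + t *\<^sub>R h))) \<partial>lborel) * indicator {0..1} t"
        by (simp add: nn_integral_cmult nn_integral_multc)
      also have "(\<integral>\<^sup>+x. ennreal (norm (indicator (K' K) (x + t *\<^sub>R h) *\<^sub>R g (x + t *\<^sub>R h))) \<partial>lborel) = (\<integral>\<^sup>+x. ennreal (norm (indicator (K' K) x *\<^sub>R g x)) \<partial>lborel)"
        by (rule nn_integral_lborel_translate[of "\<lambda>x. ennreal (norm (indicator (K' K) x *\<^sub>R g x))"]) measurable
      finally show "(\<integral>\<^sup>+x. ennreal \<bar>indicator K x * G x t\<bar> \<partial>lborel) \<le>
        ennreal (norm h) * (\<integral>\<^sup>+x. ennreal (norm (indicator (K' K) x *\<^sub>R g x)) \<partial>lborel) * indicator {0..1} t" .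
    qed
    also have "\<dots> = ennreal (norm h) * (\<integral>\<^sup>+x. ennreal (norm (indicator (K' K) x *\<^sub>R g x)) \<partial>lborel)"
      by (subst nn_integral_cmult_indicator) auto
    also have "\<dots> < \<infinity>" using gK by (simp add: ennreal_mult_less_top)
    finally show "(\<integral>\<^sup>+x. \<integral>\<^sup>+t. ennreal \<bar>case (x, t) of (x, t) \<Rightarrow> indicator K x * G x t\<bar> \<partial>lborel \<partial>lborel) < \<infinity>"
      by simp
  qed
  have w_int: "set_integrable lborel K w" if "compact K" "K \<subseteq> U" for K
    unfolding set_integrable_def using lborel_pair.integrable_fst'[OF G_int[OF that]]
    by (simp add: w_def)
  have f_int: "set_integrable lborel K f" if "compact K" "K \<subseteq> U" for K
    using fint[OF that(1)] seg[of _ 0] that by auto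
  have fh_int: "set_integrable lborel K (\<lambda>x. f (x + h))" if K: "compact K" "K \<subseteq> U" for K
  proof -
    have "compact ((+) h ` K)" using K by (intro compact_translation)
    moreover have "(+) h ` K \<subseteq> \<Omega>" using K seg[of _ 1] by (auto simp: add.commute)
    ultimately have "set_integrable lborel ((+) h ` K) f" by (rule fint)
    from integrable_lborel_translate[OF this[unfolded set_integrable_def], of h]
    have "integrable lborel (\<lambda>x. indicator ((+) h ` K) (x + h) *\<^sub>R f (x + h))" .
    moreover have "indicator ((+) h ` K) (x + h) = (indicator K x :: real)" for x
      by (auto simp: indicator_def add.commute)
    ultimately show ?thesis by (simp add: set_integrable_def)
  qed
  have "AE x in lborel. x \<in> U \<longrightarrow> (f (x + h) - f x) - w x = 0"
  proof (rule AE_zero_of_test_integrals[OF _ U])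
    show "(\<lambda>x. f (x + h) - f x - w x) \<in> borel_measurable borel" by measurable
    show "set_integrable lborel K (\<lambda>x. f (x + h) - f x - w x)" if "compact K" "K \<subseteq> U" for K
      using that by (intro set_integral_diff fh_int f_int w_int)
    fix \<phi> :: "real^'n \<Rightarrow> real" assume \<phi>: "test_fun U \<phi>"
    obtain K where K: "compact K" "K \<subseteq> U" and z: "\<And>x. x \<notin> K \<Longrightarrow> \<phi> x = 0" "\<And>x i. x \<notin> K \<Longrightarrow> partial_deriv i \<phi> x = 0"
      using test_fun_support[OF \<phi>] by metis
    obtain B where B: "B > 0" "\<And>x. \<bar>\<phi> x\<bar> \<le> B" "\<And>x i. \<bar>partial_deriv i \<phi> x\<bar> \<le> B"
      using test_fun_bounded[OF \<phi>] by metis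
    have [measurable]: "\<phi> \<in> borel_measurable borel" "\<And>i. partial_deriv i \<phi> \<in> borel_measurable borel"
      using test_fun_measurable[OF \<phi>] partial_deriv_test_fun_measurable[OF \<phi>] by auto
    have [measurable]: "K \<in> sets borel" "K' K \<in> sets borel" using K K'_compact borel_compact by auto
    define D where "D x = (\<Sum>i\<in>UNIV. h $ i * partial_deriv i \<phi> x)" for x
    have [measurable]: "D \<in> borel_measurable borel" unfolding D_def by measurable
    have D_bound: "\<bar>D x\<bar> \<le> (\<Sum>i\<in>UNIV. \<bar>h $ i\<bar> * B)" for x
      unfolding D_def by (rule order_trans[OF sum_abs]) (auto intro!: sum_mono mult_left_mono B simp: abs_mult)
    have D_zero: "D x = 0" if "x \<notin> K" for x using z(2)[OF that] by (simp add: D_def)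
    define BD where "BD = (\<Sum>i\<in>UNIV. \<bar>h $ i\<bar> * B)"
    have BD: "BD \<ge> 0" unfolding BD_def using B(1) by (intro sum_nonneg) auto
    have fK': "set_integrable lborel (K' K) f" by (intro fint K'_compact K'_sub K)
    have gK': "set_integrable lborel (K' K) (\<lambda>x. g x $ i)" for i
    proof -
      have "integrable lborel (\<lambda>x. (indicator (K' K) x *\<^sub>R g x) $ i)"
        using gint[OF K'_compact[OF K(1)] K'_sub[OF K(2)]] unfolding set_integrable_def
        by (rule integrable_bounded_linear[OF bounded_linear_vec_nth])
      then show ?thesis by (simp add: set_integrable_def)
    qed
    have zero_shift: "y - t *\<^sub>R h \<notin> K" if "y \<notin> K' K" "0 \<le> t" "t \<le> 1" for y t
      using K'_mem[of "y - t *\<^sub>R h" K t] that by auto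
    have ftc: "\<phi> (y - h) - \<phi> y = (LINT t|lborel. I t * (- D (y - t *\<^sub>R h)))" for y
    proof -
      have "(LINT t|lborel. indicator {0..1} t *\<^sub>R (- D (y - t *\<^sub>R h))) = \<phi> (y - 1 *\<^sub>R h) - \<phi> (y - 0 *\<^sub>R h)"
      proof (rule integral_FTC_atLeastAtMost)
        fix t :: real
        have "((\<lambda>t. y - t *\<^sub>R h) has_derivative (\<lambda>s. - (s *\<^sub>R h))) (at t)"
          by (auto intro!: derivative_eq_intros)
        from has_derivative_compose[OF this test_fun_has_derivative[OF \<phi>]]
        have "((\<lambda>t. \<phi> (y - t *\<^sub>R h)) has_derivative (\<lambda>s. s * (- D (y - t *\<^sub>R h)))) (at t)"
          by (simp add: D_def sum_negf sum_distrib_left mult.assoc)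
        then have "((\<lambda>t. \<phi> (y - t *\<^sub>R h)) has_vector_derivative (- D (y - t *\<^sub>R h))) (at t)"
          by (simp add: has_vector_derivative_def)
        then show "((\<lambda>t. \<phi> (y - t *\<^sub>R h)) has_vector_derivative (- D (y - t *\<^sub>R h))) (at t within {0..1})"
          by (rule has_vector_derivative_at_within)
      next
        have "continuous_on UNIV D"
          unfolding D_def by (intro continuous_intros partial_deriv_test_fun_continuous_on[OF \<phi>])
        then show "continuous_on {0..1} (\<lambda>t. - D (y - t *\<^sub>R h))"
          by (intro continuous_on_minus continuous_on_compose2[of UNIV D "{0..1}" "\<lambda>t. y - t *\<^sub>R h"])
             (auto intro!: continuous_intros)
      qed simp
      then show ?thesis by (simp add: I_def)
    qed
    have H_int: "integrable (lborel \<Otimes>\<^sub>M lborel) (\<lambda>(y, t). f y * (I t * (- D (y - t *\<^sub>R h))))"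
    proof (rule integrable_lborel_pairI)
      show "(\<lambda>(y, t). f y * (I t * (- D (y - t *\<^sub>R h)))) \<in> borel_measurable (lborel \<Otimes>\<^sub>M lborel)" by measurable
      have "(\<integral>\<^sup>+y. \<integral>\<^sup>+t. ennreal \<bar>f y * (I t * (- D (y - t *\<^sub>R h)))\<bar> \<partial>lborel \<partial>lborel)
        \<le> (\<integral>\<^sup>+y. \<integral>\<^sup>+t. ennreal (norm (indicator (K' K) y *\<^sub>R f y)) * ennreal BD * indicator {0..1::real} t \<partial>lborel \<partial>lborel)"
      proof (intro nn_integral_mono)
        fix y t
        show "ennreal \<bar>f y * (I t * (- D (y - t *\<^sub>R h)))\<bar> \<le> ennreal (norm (indicator (K' K) y *\<^sub>R f y)) * ennreal BD * indicator {0..1} t"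
          using zero_shift[of y t] D_zero[of "y - t *\<^sub>R h"] D_bound[of "y - t *\<^sub>R h"] BD
          by (cases "y \<in> K' K \<and> 0 \<le> t \<and> t \<le> 1")
             (auto simp: I_def indicator_def abs_mult BD_def[symmetric] simp flip: ennreal_mult intro!: ennreal_leI mult_left_mono)
      qed
      also have "\<dots> = (\<integral>\<^sup>+y. ennreal (norm (indicator (K' K) y *\<^sub>R f y)) * ennreal BD \<partial>lborel)"
        by (intro nn_integral_cong) (simp add: nn_integral_cmult_indicator)
      also have "\<dots> < \<infinity>"
        using fK' unfolding set_integrable_def integrable_iff_bounded
        by (simp add: nn_integral_multc ennreal_mult_less_top)
      finally show "(\<integral>\<^sup>+y. \<integral>\<^sup>+t. ennreal \<bar>case (y, t) of (y, t) \<Rightarrow> f y * (I t * (- D (y - t *\<^sub>R h)))\<bar> \<partial>lborel \<partial>lborel) < \<infinity>"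
        by simp
    qed
    \<comment> \<open>For fixed t the translate \<open>\<psi>\<close> of \<open>\<phi>\<close> is
      admissible on \<open>\<Omega>\<close>. The weak identities for \<open>\<psi>\<close>, summed
      over the coordinates with weights h_i, transfer the derivative to \<open>g\<close>; a
      translation by t h then brings \<open>g\<close> to the segment.\<close>
    have slice: "(LINT y|lborel. f y * (I t * (- D (y - t *\<^sub>R h)))) = (LINT x|lborel. (indicator K x * G x t) * \<phi> x)" for t
    proof (cases "0 \<le> t \<and> t \<le> 1")
      case False
      then show ?thesis by (simp add: I_def G_def)
    next
      case True
      define \<psi> where "\<psi> = (\<lambda>y. \<phi> (y - t *\<^sub>R h))"
      have \<psi>: "test_fun \<Omega> \<psi>" "\<And>i. partial_deriv i \<psi> = (\<lambda>y. partial_deriv i \<phi> (y - t *\<^sub>R h))"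
        unfolding \<psi>_def using test_fun_translate[OF \<phi>, of "t *\<^sub>R h" \<Omega>] seg True by auto
      have [measurable]: "\<psi> \<in> borel_measurable borel" unfolding \<psi>_def by measurable
      have i1: "integrable lborel (\<lambda>y. f y * partial_deriv i \<psi> y)" for i
        unfolding \<psi>(2) using z(2) zero_shift True B(3)
        by (intro integrable_compact_support_mult[OF fK', where B=B]) auto
      have i2: "integrable lborel (\<lambda>y. g y $ i * \<psi> y)" for i
        unfolding \<psi>_def using z(1) zero_shift True B(2)
        by (intro integrable_compact_support_mult[OF gK', where B=B]) auto
      have "(LINT y|lborel. f y * (I t * (- D (y - t *\<^sub>R h)))) = (LINT y|lborel. (\<Sum>i\<in>UNIV. (- (h $ i)) * (f y * partial_deriv i \<psi> y)))"
        using True by (intro Bochner_Integration.integral_cong)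
          (auto simp: I_def D_def \<psi>(2) sum_distrib_left sum_negf mult_ac)
      also have "\<dots> = (\<Sum>i\<in>UNIV. (- (h $ i)) * (LINT y|lborel. f y * partial_deriv i \<psi> y))"
        using i1 by (subst Bochner_Integration.integral_sum) auto
      also have "\<dots> = (\<Sum>i\<in>UNIV. h $ i * (LINT y|lborel. g y $ i * \<psi> y))"
        by (simp add: weak[OF \<psi>(1)])
      also have "\<dots> = (LINT y|lborel. (\<Sum>i\<in>UNIV. h $ i * (g y $ i * \<psi> y)))"
        using i2 by (subst Bochner_Integration.integral_sum) auto
      also have "\<dots> = (LINT y|lborel. (g y \<bullet> h) * \<phi> (y - t *\<^sub>R h))"
        by (intro Bochner_Integration.integral_cong) (auto simp: inner_vec_def sum_distrib_right sum_distrib_left \<psi>_def mult_ac)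
      also have "\<dots> = (LINT x|lborel. (g (x + t *\<^sub>R h) \<bullet> h) * \<phi> (x + t *\<^sub>R h - t *\<^sub>R h))"
        by (rule integral_lborel_translate[symmetric, of "\<lambda>y. (g y \<bullet> h) * \<phi> (y - t *\<^sub>R h)"]) measurable
      also have "\<dots> = (LINT x|lborel. (indicator K x * G x t) * \<phi> x)"
        using True z(1) by (intro Bochner_Integration.integral_cong) (auto simp: G_def I_def indicator_def)
      finally show ?thesis .
    qed
    have G\<phi>_int: "integrable (lborel \<Otimes>\<^sub>M lborel) (\<lambda>(x, t). (indicator K x * G x t) * \<phi> x)"
    proof (rule Bochner_Integration.integrable_bound[where f="\<lambda>z. B * (case z of (x, t) \<Rightarrow> indicator K x * G x t)"])
      show "integrable (lborel \<Otimes>\<^sub>M lborel) (\<lambda>z. B * (case z of (x, t) \<Rightarrow> indicator K x * G x t))"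
        by (rule integrable_mult_right) (rule G_int[OF K])
      show "AE z in lborel \<Otimes>\<^sub>M lborel. norm (case z of (x, t) \<Rightarrow> (indicator K x * G x t) * \<phi> x) \<le> norm (B * (case z of (x, t) \<Rightarrow> indicator K x * G x t))"
        using B by (intro AE_I2) (auto simp: abs_mult mult.commute[of _ "\<bar>\<phi> _\<bar>"] intro!: mult_right_mono)
    qed measurable
    have i3: "integrable lborel (\<lambda>x. f (x + h) * \<phi> x)" "integrable lborel (\<lambda>x. f x * \<phi> x)" "integrable lborel (\<lambda>x. w x * \<phi> x)"
      using K z B by (auto intro!: integrable_compact_support_mult[where K=K and B=B] fh_int f_int w_int)
    have i4: "integrable lborel (\<lambda>x. f x * \<phi> (x - h))"
      using integrable_lborel_translate[OF i3(1), of "- h"] by simp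
    have "(LINT x|lborel. (f (x + h) - f x - w x) * \<phi> x) = (LINT x|lborel. f (x + h) * \<phi> x) - (LINT x|lborel. f x * \<phi> x) - (LINT x|lborel. w x * \<phi> x)"
      using i3 by (simp add: left_diff_distrib)
    also have "(LINT x|lborel. f (x + h) * \<phi> x) = (LINT x|lborel. f x * \<phi> (x - h))"
      using integral_lborel_translate[of "\<lambda>x. f x * \<phi> (x - h)" h] by simp
    also have "(LINT x|lborel. f x * \<phi> (x - h)) - (LINT x|lborel. f x * \<phi> x) = (LINT x|lborel. f x * (\<phi> (x - h) - \<phi> x))"
      using i3(2) i4 by (simp add: right_diff_distrib)
    also have "\<dots> = (LINT y|lborel. LINT t|lborel. f y * (I t * (- D (y - t *\<^sub>R h))))"
      unfolding ftc by simp
    also have "\<dots> = (LINT t|lborel. LINT y|lborel. f y * (I t * (- D (y - t *\<^sub>R h))))"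
      by (rule lborel_pair.Fubini_integral[symmetric]) (rule H_int)
    also have "\<dots> = (LINT t|lborel. LINT x|lborel. (indicator K x * G x t) * \<phi> x)"
      by (simp only: slice)
    also have "\<dots> = (LINT x|lborel. LINT t|lborel. (indicator K x * G x t) * \<phi> x)"
      by (rule lborel_pair.Fubini_integral) (rule G\<phi>_int)
    also have "\<dots> = (LINT x|lborel. w x * \<phi> x)"
      using z(1) by (intro Bochner_Integration.integral_cong) (auto simp: w_def indicator_def)
    finally show "(LINT x|lborel. (f (x + h) - f x - w x) * \<phi> x) = 0" by simp
  qed
  \<comment> \<open>A Bochner integral takes the value 0 when its integrand is not integrable, so
    the identity alone does not give integrability along the segment. It is obtained on a countable
    cover of \<open>U\<close> by compact boxes.\<close>
  moreover have "AE x in lborel. x \<in> U \<longrightarrow> integrable lborel (G x)"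
  proof -
    obtain \<D> where \<D>: "countable \<D>" "\<D> \<subseteq> Pow U" "\<And>X. X \<in> \<D> \<Longrightarrow> \<exists>a b. X = cbox a b" "\<Union>\<D> = U"
      by (rule open_countable_Union_open_cbox[OF U]) auto
    have "AE x in lborel. \<forall>X\<in>\<D>. x \<in> X \<longrightarrow> integrable lborel (G x)"
      unfolding AE_ball_countable[OF \<D>(1)]
    proof
      fix X assume X: "X \<in> \<D>"
      then have "compact X" "X \<subseteq> U" using \<D>(2) \<D>(3)[OF X] by auto
      from lborel_pair.AE_integrable_fst'[OF G_int[OF this]]
      show "AE x in lborel. x \<in> X \<longrightarrow> integrable lborel (G x)"
        by eventually_elim auto
    qed
    then show ?thesis by eventually_elim (use \<D>(4) in auto)
  qed
  ultimately show ?thesis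
    by eventually_elim (auto simp: set_integrable_def set_lebesgue_integral_def w_def G_def[abs_def] I_def)
qed

section \<open>Bounds for the nonlocal energy\<close>

text \<open>With y = x + h the weight depends on h alone, so after Tonelli everything can be
  estimated for one displacement h at a time. The radius stays abstract; the theorem uses
  \<open>\<tau>\<close> times the distance to the frontier.\<close>

definition ball_energy ::
    "(real^'n::finite) set \<Rightarrow> (real^'n \<Rightarrow> real) \<Rightarrow> (real^'n \<Rightarrow> real) \<Rightarrow> real \<Rightarrow> real \<Rightarrow> ennreal" where
  "ball_energy \<Omega> \<rho> f p b = (\<integral>\<^sup>+x. \<integral>\<^sup>+h.
     indicator \<Omega> x * indicator (ball 0 (\<rho> x)) h *
     ennreal (\<bar>f (x + h) - f x\<bar> powr p * norm h powr (b - CARD('n) - p)) \<partial>lborel \<partial>lborel)"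

lemma compact_radius_gt:
  fixes \<rho> :: "'a::topological_space \<Rightarrow> real"
  assumes C: "compact C" and cont: "continuous_on UNIV \<rho>" and pos: "\<And>x. x \<in> C \<Longrightarrow> 0 < \<rho> x"
  obtains r where "0 < r" "\<And>x. x \<in> C \<Longrightarrow> r < \<rho> x"
proof (cases "C = {}")
  case True
  then show ?thesis using that[of 1] by simp
next
  case False
  have "continuous_on C \<rho>" using cont continuous_on_subset by blast
  then obtain x0 where x0: "x0 \<in> C" "\<And>x. x \<in> C \<Longrightarrow> \<rho> x0 \<le> \<rho> x"
    using continuous_attains_inf[OF C False] by blast
  show ?thesis
  proof (rule that[of "\<rho> x0 / 2"])
    show "0 < \<rho> x0 / 2" using pos[OF x0(1)] by simp
    show "\<rho> x0 / 2 < \<rho> x" if "x \<in> C" for x using pos[OF x0(1)] x0(2)[OF that] by linarith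
  qed
qed

lemma jensen_powr_unit_interval:
  fixes u :: "real \<Rightarrow> real"
  assumes p: "1 < p" and u: "set_integrable lborel {0..1} u"
  shows "ennreal (\<bar>LINT t:{0..1}|lborel. u t\<bar> powr p) \<le> (\<integral>\<^sup>+t. ennreal (\<bar>u t\<bar> powr p) * indicator {0..1} t \<partial>lborel)"
proof -
  let ?M = "restrict_space lborel {0..1::real}"
  have e: "emeasure ?M (space ?M) = 1" by (subst emeasure_restrict_space) (auto simp: space_restrict_space)
  interpret finite_measure ?M by (rule finite_measureI, unfold e, simp)
  have m: "measure ?M (space ?M) = 1" using e by (simp add: measure_def)
  have pos: "0 < measure ?M (space ?M)" unfolding m by simp
  have "integrable ?M u" using u by (simp add: integrable_restrict_space set_integrable_def)
  from jensen_powr_of_pos_measure[OF p this pos, unfolded m] show ?thesis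
    by (simp add: integral_restrict_space nn_integral_restrict_space set_lebesgue_integral_def)
qed

text \<open>\<open>g\<close> is assumed integrable on compact subsets of \<open>\<Omega>\<close>
  only, so gradients whose p-th power is not integrable are covered.\<close>

locale weak_gradient_setting =
  fixes \<Omega> :: "(real^'n::finite) set" and \<rho> :: "real^'n \<Rightarrow> real"
    and f :: "real^'n \<Rightarrow> real" and g :: "real^'n \<Rightarrow> real^'n"
  assumes open_domain: "open \<Omega>"
    and cont_radius: "continuous_on UNIV \<rho>"
    and radius_pos: "x \<in> \<Omega> \<Longrightarrow> 0 < \<rho> x"
    and ball_subset: "x \<in> \<Omega> \<Longrightarrow> norm h < \<rho> x \<Longrightarrow> x + h \<in> \<Omega>"
    and measurable_f [measurable]: "f \<in> borel_measurable borel"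
    and measurable_g [measurable]: "g \<in> borel_measurable borel"
    and f_integrable: "compact C \<Longrightarrow> C \<subseteq> \<Omega> \<Longrightarrow> set_integrable lborel C f"
    and g_integrable: "compact C \<Longrightarrow> C \<subseteq> \<Omega> \<Longrightarrow> set_integrable lborel C g"
    and weak: "test_fun \<Omega> \<phi> \<Longrightarrow>
      (LINT x|lborel. f x * partial_deriv i \<phi> x) = - (LINT x|lborel. g x $ i * \<phi> x)"
begin

lemma measurable_domain [measurable]: "\<Omega> \<in> sets borel" using open_domain by simp

lemma measurable_radius [measurable]: "\<rho> \<in> borel_measurable borel"
  using cont_radius by (rule borel_measurable_continuous_onI)

lemma AE_diff_eq_segment_integral:
  "AE x in lborel. x \<in> \<Omega> \<and> norm h < \<rho> x \<longrightarrow>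
    set_integrable lborel {0..1} (\<lambda>t. g (x + t *\<^sub>R h) \<bullet> h) \<and>
    f (x + h) - f x = (LINT t:{0..1}|lborel. g (x + t *\<^sub>R h) \<bullet> h)"
proof -
  have seg: "x + t *\<^sub>R h \<in> \<Omega>" if "x \<in> {x\<in>\<Omega>. norm h < \<rho> x}" "0 \<le> t" "t \<le> 1" for x t
  proof (rule ball_subset)
    show "x \<in> \<Omega>" using that by simp
    have "norm (t *\<^sub>R h) \<le> norm h" using that by (simp add: mult_left_le_one_le)
    then show "norm (t *\<^sub>R h) < \<rho> x" using that by simp
  qed
  have "open (\<Omega> \<inter> \<rho> -` {norm h<..})"
    using open_domain cont_radius by (intro open_Int open_vimage) auto
  moreover have "\<Omega> \<inter> \<rho> -` {norm h<..} = {x\<in>\<Omega>. norm h < \<rho> x}" by auto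
  ultimately have "open {x\<in>\<Omega>. norm h < \<rho> x}" by simp
  from translate_diff_eq_segment_integral[OF measurable_f measurable_g this seg f_integrable g_integrable weak]
  show ?thesis by simp
qed

text \<open>For fixed h, Jensen's inequality along the segment replaces the difference by an average
  over t of |g(x + t h) . h|^p. Integrating in x before t lets every t contribute the same amount,
  and the kernel moments finish the estimate. The varying radius is enlarged to \<open>R\<close>, at
  the price of the factor R^b.\<close>

theorem ball_energy_le:
  fixes i :: 'n and p b R :: real
  assumes p: "1 < p" and b: "0 < b" "b < 1" and R: "0 < R" "\<And>x. x \<in> \<Omega> \<Longrightarrow> \<rho> x \<le> R"
  shows "ball_energy \<Omega> \<rho> f p b \<le> ennreal (p / b * R powr b) * K_const i p *
    (\<integral>\<^sup>+x. ennreal (norm (g x) powr p) * indicator \<Omega> x \<partial>lborel)"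
proof -
  define k where "k h = norm h powr (b - CARD('n) - p)" for h :: "real^'n"
  have [measurable]: "k \<in> borel_measurable borel" unfolding k_def by measurable
  have k0: "0 \<le> k h" for h by (simp add: k_def)
  \<comment> \<open>Of the conditions on x and h only |h| < R and the membership in
    \<open>\<Omega>\<close> of the point where \<open>g\<close> is evaluated are kept, so the
    translation by t h in x removes t completely.\<close>
  define \<gamma> where "\<gamma> h x = indicator (ball 0 R) h * (ennreal (\<bar>g x \<bullet> h\<bar> powr p * k h) * indicator \<Omega> x)" for h x
  have [measurable]: "case_prod \<gamma> \<in> borel_measurable (borel \<Otimes>\<^sub>M borel)" unfolding \<gamma>_def by measurable
  have "ball_energy \<Omega> \<rho> f p b = (\<integral>\<^sup>+h. \<integral>\<^sup>+x. indicator \<Omega> x * indicator (ball 0 (\<rho> x)) h *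
     ennreal (\<bar>f (x + h) - f x\<bar> powr p * k h) \<partial>lborel \<partial>lborel)"
    unfolding ball_energy_def k_def by (rule lborel_pair.Fubini'[symmetric]) (simp add: indicator_def)
  also have "\<dots> \<le> (\<integral>\<^sup>+h. \<integral>\<^sup>+x. \<gamma> h x \<partial>lborel \<partial>lborel)"
  proof (rule nn_integral_mono)
    fix h :: "real^'n"
    have "(\<integral>\<^sup>+x. indicator \<Omega> x * indicator (ball 0 (\<rho> x)) h * ennreal (\<bar>f (x + h) - f x\<bar> powr p * k h) \<partial>lborel)
      \<le> (\<integral>\<^sup>+x. \<integral>\<^sup>+t. \<gamma> h (x + t *\<^sub>R h) * indicator {0..1} t \<partial>lborel \<partial>lborel)"
    proof (rule nn_integral_mono_AE)
      show "AE x in lborel. indicator \<Omega> x * indicator (ball 0 (\<rho> x)) h * ennreal (\<bar>f (x + h) - f x\<bar> powr p * k h)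
        \<le> (\<integral>\<^sup>+t. \<gamma> h (x + t *\<^sub>R h) * indicator {0..1} t \<partial>lborel)"
        using AE_diff_eq_segment_integral[of h]
      proof eventually_elim
        case (elim x)
        show ?case
        proof (cases "x \<in> \<Omega> \<and> norm h < \<rho> x")
          case True
          have hR: "norm h < R" using R(2)[of x] True by linarith
          have mem: "x + t *\<^sub>R h \<in> \<Omega>" if "0 \<le> t" "t \<le> 1" for t
          proof (rule ball_subset)
            have "norm (t *\<^sub>R h) \<le> norm h" using that by (simp add: mult_left_le_one_le)
            then show "norm (t *\<^sub>R h) < \<rho> x" using True by simp
          qed (use True in simp)
          have "ennreal (\<bar>f (x + h) - f x\<bar> powr p * k h) = ennreal (\<bar>LINT t:{0..1}|lborel. g (x + t *\<^sub>R h) \<bullet> h\<bar> powr p) * ennreal (k h)"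
            using elim True k0 by (simp add: ennreal_mult)
          also have "\<dots> \<le> (\<integral>\<^sup>+t. ennreal (\<bar>g (x + t *\<^sub>R h) \<bullet> h\<bar> powr p) * indicator {0..1} t \<partial>lborel) * ennreal (k h)"
            using elim True by (intro mult_right_mono jensen_powr_unit_interval p) auto
          also have "\<dots> = (\<integral>\<^sup>+t. ennreal (\<bar>g (x + t *\<^sub>R h) \<bullet> h\<bar> powr p) * indicator {0..1} t * ennreal (k h) \<partial>lborel)"
            by (rule nn_integral_multc[symmetric]) measurable
          also have "\<dots> = (\<integral>\<^sup>+t. \<gamma> h (x + t *\<^sub>R h) * indicator {0..1} t \<partial>lborel)"
            using mem hR k0 by (intro nn_integral_cong) (auto simp: \<gamma>_def indicator_def ennreal_mult)
          finally show ?thesis using True by simp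
        next
          case False
          then show ?thesis by (auto simp: indicator_def)
        qed
      qed
    qed
    also have "\<dots> = (\<integral>\<^sup>+t. \<integral>\<^sup>+x. \<gamma> h (x + t *\<^sub>R h) * indicator {0..1} t \<partial>lborel \<partial>lborel)"
      by (rule lborel_pair.Fubini'[symmetric]) measurable
    also have "\<dots> = (\<integral>\<^sup>+t. (\<integral>\<^sup>+x. \<gamma> h x \<partial>lborel) * indicator {0..1::real} t \<partial>lborel)"
    proof (rule nn_integral_cong)
      fix t :: real
      have "(\<integral>\<^sup>+x. \<gamma> h (x + t *\<^sub>R h) * indicator {0..1} t \<partial>lborel) = (\<integral>\<^sup>+x. \<gamma> h (x + t *\<^sub>R h) \<partial>lborel) * indicator {0..1} t"
        by (rule nn_integral_multc) measurable
      also have "(\<integral>\<^sup>+x. \<gamma> h (x + t *\<^sub>R h) \<partial>lborel) = (\<integral>\<^sup>+x. \<gamma> h x \<partial>lborel)"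
        by (rule nn_integral_lborel_translate) measurable
      finally show "(\<integral>\<^sup>+x. \<gamma> h (x + t *\<^sub>R h) * indicator {0..1} t \<partial>lborel) = (\<integral>\<^sup>+x. \<gamma> h x \<partial>lborel) * indicator {0..1} t" .
    qed
    also have "\<dots> = (\<integral>\<^sup>+x. \<gamma> h x \<partial>lborel)"
      by (subst nn_integral_cmult_indicator) auto
    finally show "(\<integral>\<^sup>+x. indicator \<Omega> x * indicator (ball 0 (\<rho> x)) h * ennreal (\<bar>f (x + h) - f x\<bar> powr p * k h) \<partial>lborel)
      \<le> (\<integral>\<^sup>+x. \<gamma> h x \<partial>lborel)" .
  qed
  also have "\<dots> = (\<integral>\<^sup>+x. \<integral>\<^sup>+h. \<gamma> h x \<partial>lborel \<partial>lborel)"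
    by (rule lborel_pair.Fubini'[symmetric]) measurable
  also have "\<dots> = (\<integral>\<^sup>+x. (ennreal (p / b * R powr b) * K_const i p) * (ennreal (norm (g x) powr p) * indicator \<Omega> x) \<partial>lborel)"
  proof (rule nn_integral_cong)
    fix x
    have "(\<integral>\<^sup>+h. \<gamma> h x \<partial>lborel) = (\<integral>\<^sup>+h. indicator \<Omega> x * (ennreal (\<bar>g x \<bullet> h\<bar> powr p * norm h powr (b - CARD('n) - p)) * indicator (ball 0 R) h) \<partial>lborel)"
      by (intro nn_integral_cong) (simp add: \<gamma>_def k_def mult_ac)
    also have "\<dots> = indicator \<Omega> x * (ennreal (p / b * R powr b * norm (g x) powr p) * K_const i p)"
      by (subst nn_integral_cmult) (auto simp: nn_integral_direction_kernel[OF p b R(1), where i=i])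
    also have "ennreal (p / b * R powr b * norm (g x) powr p) = ennreal (p / b * R powr b) * ennreal (norm (g x) powr p)"
      using p b by (intro ennreal_mult) auto
    finally show "(\<integral>\<^sup>+h. \<gamma> h x \<partial>lborel) = (ennreal (p / b * R powr b) * K_const i p) * (ennreal (norm (g x) powr p) * indicator \<Omega> x)"
      by (simp only: mult_ac)
  qed
  also have "\<dots> = ennreal (p / b * R powr b) * K_const i p * (\<integral>\<^sup>+x. ennreal (norm (g x) powr p) * indicator \<Omega> x \<partial>lborel)"
    by (rule nn_integral_cmult) measurable
  finally show ?thesis .
qed

text \<open>Cutting \<open>g\<close> off at a compact neighbourhood \<open>C'\<close> of
  \<open>C\<close> inside \<open>\<Omega>\<close> makes it integrable on the whole space. For x in
  \<open>C\<close> and short h both x and x + h lie in \<open>C'\<close>, so the cut-off is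
  invisible there.\<close>

lemma compact_translates_L1_small:
  assumes C: "compact C" "C \<subseteq> \<Omega>" and e: "0 < e"
  obtains r where "0 < r" "\<And>x. x \<in> C \<Longrightarrow> r < \<rho> x"
    "\<And>h. norm h < r \<Longrightarrow> (\<integral>\<^sup>+x. indicator C x * ennreal (norm (g (x + h) - g x)) \<partial>lborel) \<le> ennreal e"
proof -
  obtain r1 where r1: "r1 > 0" "\<And>x. x \<in> C \<Longrightarrow> r1 < \<rho> x"
    by (rule compact_radius_gt[OF C(1) cont_radius]) (use C(2) radius_pos in auto)
  define C' where "C' = (\<lambda>(x, y). x + y) ` (C \<times> cball 0 r1)"
  have C'c: "compact C'"
    unfolding C'_def using C by (intro compact_continuous_image compact_Times) (auto intro!: continuous_intros simp: split_beta)
  have C's: "C' \<subseteq> \<Omega>"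
    unfolding C'_def using ball_subset r1 C(2) by (force simp: subset_iff)
  have C'm: "x + h \<in> C'" if "x \<in> C" "norm h \<le> r1" for x h
    unfolding C'_def using that by force
  have [measurable]: "C \<in> sets borel" "C' \<in> sets borel" using C C'c borel_compact by auto
  have "integrable lborel (\<lambda>x. indicator C' x *\<^sub>R g x)"
    using g_integrable[OF C'c C's] by (simp add: set_integrable_def)
  from translate_L1_small[OF this e] obtain d where d: "d > 0"
    "\<And>h. norm h < d \<Longrightarrow> (LINT x|lborel. norm (indicator C' (x + h) *\<^sub>R g (x + h) - indicator C' x *\<^sub>R g x)) < e" by blast
  show ?thesis
  proof (rule that[of "min r1 d"])
    show "0 < min r1 d" using r1 d by simp
    show "min r1 d < \<rho> x" if "x \<in> C" for x using r1(2)[OF that] by simp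
    fix h :: "real^'n" assume h: "norm h < min r1 d"
    have int: "integrable lborel (\<lambda>x. indicator C' (x + h) *\<^sub>R g (x + h) - indicator C' x *\<^sub>R g x)"
      using \<open>integrable lborel (\<lambda>x. indicator C' x *\<^sub>R g x)\<close> integrable_lborel_translate[OF \<open>integrable lborel (\<lambda>x. indicator C' x *\<^sub>R g x)\<close>, of h]
      by (rule Bochner_Integration.integrable_diff[rotated])
    have "(\<integral>\<^sup>+x. indicator C x * ennreal (norm (g (x + h) - g x)) \<partial>lborel)
      \<le> (\<integral>\<^sup>+x. ennreal (norm (indicator C' (x + h) *\<^sub>R g (x + h) - indicator C' x *\<^sub>R g x)) \<partial>lborel)"
    proof (rule nn_integral_mono)
      fix x
      show "indicator C x * ennreal (norm (g (x + h) - g x)) \<le> ennreal (norm (indicator C' (x + h) *\<^sub>R g (x + h) - indicator C' x *\<^sub>R g x))"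
        using C'm[of x h] C'm[of x 0] h r1 by (cases "x \<in> C") auto
    qed
    also have "\<dots> = ennreal (LINT x|lborel. norm (indicator C' (x + h) *\<^sub>R g (x + h) - indicator C' x *\<^sub>R g x))"
      using int by (intro nn_integral_eq_integral integrable_norm) auto
    also have "\<dots> \<le> ennreal e" using d(2)[of h] h by (intro ennreal_leI) auto
    finally show "(\<integral>\<^sup>+x. indicator C x * ennreal (norm (g (x + h) - g x)) \<partial>lborel) \<le> ennreal e" .
  qed
qed

text \<open>On the set where \<open>|g| \<le> N\<close>, the tangent-line inequality for \<open>t \<mapsto> |t|\<^sup>p\<close> compares the
  difference quotient with the directional derivative, up to the \<open>L\<^sup>1\<close> modulus of continuity of \<open>g\<close>.\<close>

theorem ball_energy_ge:
  fixes i :: 'n and p e N :: real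
  assumes p: "1 < p" and C: "compact C" "C \<subseteq> \<Omega>" and e: "0 < e" and N: "0 \<le> N"
  obtains r where "0 < r" "\<And>b. 0 < b \<Longrightarrow> b < 1 \<Longrightarrow>
    ennreal (p / b * r powr b) * K_const i p * (\<integral>\<^sup>+x. ennreal (norm (g x) powr p) * indicator {x\<in>C. norm (g x) \<le> N} x \<partial>lborel)
    \<le> ball_energy \<Omega> \<rho> f p b + ennreal (p * N powr (p - 1) * e * (CARD('n) / b * r powr b * measure lborel (cball (0::real^'n) 1)))"
proof -
  obtain r where r: "0 < r" "\<And>x. x \<in> C \<Longrightarrow> r < \<rho> x"
    "\<And>h. norm h < r \<Longrightarrow> (\<integral>\<^sup>+x. indicator C x * ennreal (norm (g (x + h) - g x)) \<partial>lborel) \<le> ennreal e"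
    by (rule compact_translates_L1_small[OF C e]) blast
  have [measurable]: "C \<in> sets borel" using C borel_compact by auto
  define S where "S = {x\<in>C. norm (g x) \<le> N}"
  have [measurable]: "S \<in> sets borel" unfolding S_def by measurable
  define c where "c = p * N powr (p - 1)"
  have c: "0 \<le> c" using p by (simp add: c_def)
  show ?thesis
  proof (rule that[OF r(1)])
    fix b :: real assume b: "0 < b" "b < 1"
    define k where "k h = norm h powr (b - CARD('n) - p)" for h :: "real^'n"
    have [measurable]: "k \<in> borel_measurable borel" unfolding k_def by measurable
    have k0: "0 \<le> k h" for h by (simp add: k_def)
    define m where "m h = ennreal (norm h powr (b - CARD('n)))" for h :: "real^'n"
    have [measurable]: "m \<in> borel_measurable borel" unfolding m_def by measurable
    \<comment> \<open>The mean oscillation of \<open>g\<close> along the segment. It dominates the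
      distance between difference quotient and directional derivative, and its integral over
      \<open>S\<close> will be at most \<open>e\<close>.\<close>
    define W where "W h x = (\<integral>\<^sup>+t. ennreal (norm (g (x + t *\<^sub>R h) - g x)) * indicator {0..1} t \<partial>lborel)" for h x
    have [measurable]: "case_prod W \<in> borel_measurable (borel \<Otimes>\<^sub>M borel)"
      unfolding W_def by measurable
    have "ennreal (p / b * r powr b) * K_const i p * (\<integral>\<^sup>+x. ennreal (norm (g x) powr p) * indicator S x \<partial>lborel)
      = (\<integral>\<^sup>+x. (ennreal (p / b * r powr b) * K_const i p) * (ennreal (norm (g x) powr p) * indicator S x) \<partial>lborel)"
      by (rule nn_integral_cmult[symmetric]) measurable
    also have "\<dots> = (\<integral>\<^sup>+x. \<integral>\<^sup>+h. indicator S x * (ennreal (\<bar>g x \<bullet> h\<bar> powr p * k h) * indicator (ball 0 r) h) \<partial>lborel \<partial>lborel)"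
    proof (rule nn_integral_cong)
      fix x
      have "(\<integral>\<^sup>+h. indicator S x * (ennreal (\<bar>g x \<bullet> h\<bar> powr p * k h) * indicator (ball 0 r) h) \<partial>lborel) = indicator S x * (ennreal (p / b * r powr b * norm (g x) powr p) * K_const i p)"
        unfolding k_def by (subst nn_integral_cmult) (auto simp: nn_integral_direction_kernel[OF p b r(1), where i=i])
      also have "ennreal (p / b * r powr b * norm (g x) powr p) = ennreal (p / b * r powr b) * ennreal (norm (g x) powr p)"
        using p b by (intro ennreal_mult) auto
      finally show "(ennreal (p / b * r powr b) * K_const i p) * (ennreal (norm (g x) powr p) * indicator S x) =
        (\<integral>\<^sup>+h. indicator S x * (ennreal (\<bar>g x \<bullet> h\<bar> powr p * k h) * indicator (ball 0 r) h) \<partial>lborel)"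
        by (simp only: mult_ac)
    qed
    also have "\<dots> = (\<integral>\<^sup>+h. \<integral>\<^sup>+x. indicator S x * (ennreal (\<bar>g x \<bullet> h\<bar> powr p * k h) * indicator (ball 0 r) h) \<partial>lborel \<partial>lborel)"
      by (rule lborel_pair.Fubini'[symmetric]) measurable
    also have "\<dots> \<le> (\<integral>\<^sup>+h. (\<integral>\<^sup>+x. indicator \<Omega> x * indicator (ball 0 (\<rho> x)) h * ennreal (\<bar>f (x + h) - f x\<bar> powr p * k h) \<partial>lborel)
       + (m h * indicator (ball 0 r) h) * (ennreal c * ennreal e) \<partial>lborel)"
    proof (rule nn_integral_mono_AE)
      show "AE h in lborel. (\<integral>\<^sup>+x. indicator S x * (ennreal (\<bar>g x \<bullet> h\<bar> powr p * k h) * indicator (ball 0 r) h) \<partial>lborel)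
        \<le> (\<integral>\<^sup>+x. indicator \<Omega> x * indicator (ball 0 (\<rho> x)) h * ennreal (\<bar>f (x + h) - f x\<bar> powr p * k h) \<partial>lborel)
           + (m h * indicator (ball 0 r) h) * (ennreal c * ennreal e)"
        using AE_lborel_singleton[of "0::real^'n"]
      proof eventually_elim
        case (elim h)
        show ?case
        proof (cases "norm h < r")
          case False
          then show ?thesis by simp
        next
          case hr: True
          have kh: "k h = norm h powr (b - CARD('n)) / norm h powr p" by (simp add: k_def powr_diff)
          have "(\<integral>\<^sup>+x. indicator S x * (ennreal (\<bar>g x \<bullet> h\<bar> powr p * k h) * indicator (ball 0 r) h) \<partial>lborel)
            \<le> (\<integral>\<^sup>+x. indicator \<Omega> x * indicator (ball 0 (\<rho> x)) h * ennreal (\<bar>f (x + h) - f x\<bar> powr p * k h)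
                 + (m h * ennreal c) * (indicator S x * W h x) \<partial>lborel)"
          proof (rule nn_integral_mono_AE)
            show "AE x in lborel. indicator S x * (ennreal (\<bar>g x \<bullet> h\<bar> powr p * k h) * indicator (ball 0 r) h)
              \<le> indicator \<Omega> x * indicator (ball 0 (\<rho> x)) h * ennreal (\<bar>f (x + h) - f x\<bar> powr p * k h)
                 + (m h * ennreal c) * (indicator S x * W h x)"
              using AE_diff_eq_segment_integral[of h]
            proof eventually_elim
              case (elim x)
              show ?case
              proof (cases "x \<in> S")
                case False
                then show ?thesis by simp
              next
                case True
                then have x: "x \<in> \<Omega>" "norm h < \<rho> x" "norm (g x) \<le> N" using C(2) hr r(2)[of x] by (auto simp: S_def)
                \<comment> \<open>Directional derivative and difference quotient in the direction h
                  / |h|. Dividing by |h| turns the weight |h|^(b - n - p) into |h|^(b - n), which is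
                  integrable over the ball and can therefore carry the error term.\<close>
                define a where "a = (g x \<bullet> h) / norm h"
                define q where "q = (f (x + h) - f x) / norm h"
                have hpos: "norm h > 0" using \<open>h \<noteq> 0\<close> by simp
                have "\<bar>g x \<bullet> h\<bar> \<le> norm (g x) * norm h" by (rule Cauchy_Schwarz_ineq2)
                also have "\<dots> \<le> N * norm h" using x(3) by (intro mult_right_mono) auto
                finally have aN: "\<bar>a\<bar> \<le> N" using hpos by (simp add: a_def divide_le_eq)
                have iu: "set_integrable lborel {0..1} (\<lambda>t. g (x + t *\<^sub>R h) \<bullet> h)"
                  and eq: "f (x + h) - f x = (LINT t:{0..1}|lborel. g (x + t *\<^sub>R h) \<bullet> h)" using elim x by auto
                have "ennreal \<bar>q - a\<bar> \<le> W h x"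
                proof -
                  have "integrable lborel (indicator {0..1::real} :: real \<Rightarrow> real)"
                    by (simp add: integrable_indicator_iff)
                  then have ic: "set_integrable lborel {0..1::real} (\<lambda>t. g x \<bullet> h)"
                    unfolding set_integrable_def real_scaleR_def by (intro integrable_mult_left)
                  have "(LINT t:{0..1::real}|lborel. g x \<bullet> h) = g x \<bullet> h"
                    by (simp add: set_lebesgue_integral_def)
                  then have "(f (x + h) - f x) - g x \<bullet> h = (LINT t:{0..1}|lborel. (g (x + t *\<^sub>R h) \<bullet> h) - g x \<bullet> h)"
                    unfolding eq using set_integral_diff(2)[OF iu ic] by simp
                  also have "\<dots> = (LINT t:{0..1}|lborel. (g (x + t *\<^sub>R h) - g x) \<bullet> h)"
                    by (simp add: inner_diff_left)
                  finally have d: "q - a = (LINT t:{0..1}|lborel. (g (x + t *\<^sub>R h) - g x) \<bullet> h) / norm h"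
                    by (simp add: q_def a_def flip: diff_divide_distrib)
                  have "set_integrable lborel {0..1} (\<lambda>t. (g (x + t *\<^sub>R h) - g x) \<bullet> h)"
                    using set_integral_diff(1)[OF iu ic] by (simp add: inner_diff_left)
                  then have i3: "integrable lborel (\<lambda>t. indicator {0..1} t *\<^sub>R ((g (x + t *\<^sub>R h) - g x) \<bullet> h))"
                    by (simp add: set_integrable_def)
                  have "ennreal (norm (LINT t:{0..1}|lborel. (g (x + t *\<^sub>R h) - g x) \<bullet> h)) \<le>
                     (\<integral>\<^sup>+t. ennreal (norm (indicator {0..1} t *\<^sub>R ((g (x + t *\<^sub>R h) - g x) \<bullet> h))) \<partial>lborel)"
                    unfolding set_lebesgue_integral_def using i3 by (rule integral_norm_bound_ennreal)
                  also have "\<dots> \<le> (\<integral>\<^sup>+t. (ennreal (norm (g (x + t *\<^sub>R h) - g x)) * indicator {0..1} t) * ennreal (norm h) \<partial>lborel)"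
                    using Cauchy_Schwarz_ineq2[of "g (x + _ *\<^sub>R h) - g x" h]
                    by (intro nn_integral_mono) (auto simp: indicator_def Cauchy_Schwarz_ineq2 simp flip: ennreal_mult intro!: ennreal_leI)
                  also have "\<dots> = W h x * ennreal (norm h)"
                    unfolding W_def by (rule nn_integral_multc) measurable
                  finally have "ennreal (\<bar>q - a\<bar> * norm h) \<le> W h x * ennreal (norm h)"
                    using hpos by (simp add: d abs_divide)
                  then show ?thesis
                    using hpos by (simp add: ennreal_mult ennreal_mult_le_mult_iff mult.commute[of _ "ennreal (norm h)"])
                qed
                note qa = this
                have "\<bar>g x \<bullet> h\<bar> powr p * k h = norm h powr (b - CARD('n)) * \<bar>a\<bar> powr p"
                  using hpos by (simp add: kh a_def abs_divide powr_divide)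
                also have "\<dots> \<le> norm h powr (b - CARD('n)) * (\<bar>q\<bar> powr p + c * \<bar>q - a\<bar>)"
                  using powr_le_powr_plus_diff[OF p aN, of q] by (intro mult_left_mono) (auto simp: c_def)
                also have "\<dots> = \<bar>f (x + h) - f x\<bar> powr p * k h + norm h powr (b - CARD('n)) * c * \<bar>q - a\<bar>"
                  using hpos by (simp add: kh q_def abs_divide powr_divide algebra_simps)
                finally have "ennreal (\<bar>g x \<bullet> h\<bar> powr p * k h) \<le> ennreal (\<bar>f (x + h) - f x\<bar> powr p * k h + norm h powr (b - CARD('n)) * c * \<bar>q - a\<bar>)"
                  by (rule ennreal_leI)
                also have "\<dots> = ennreal (\<bar>f (x + h) - f x\<bar> powr p * k h) + (m h * ennreal c) * ennreal \<bar>q - a\<bar>"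
                  using c k0 by (simp add: m_def ennreal_plus ennreal_mult)
                also have "\<dots> \<le> ennreal (\<bar>f (x + h) - f x\<bar> powr p * k h) + (m h * ennreal c) * W h x"
                  using qa by (intro add_left_mono mult_left_mono) auto
                finally show ?thesis using True x hr by simp
              qed
            qed
          qed
          also have "\<dots> = (\<integral>\<^sup>+x. indicator \<Omega> x * indicator (ball 0 (\<rho> x)) h * ennreal (\<bar>f (x + h) - f x\<bar> powr p * k h) \<partial>lborel)
              + (m h * ennreal c) * (\<integral>\<^sup>+x. indicator S x * W h x \<partial>lborel)"
            by (subst nn_integral_add) (auto simp: nn_integral_cmult indicator_def)
          \<comment> \<open>For t in [0, 1] the vector t h is shorter than \<open>r\<close>, so the
            translation estimate applies to each t after exchanging the integrals.\<close>
          also have "(\<integral>\<^sup>+x. indicator S x * W h x \<partial>lborel) \<le> ennreal e"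
          proof -
            have "(\<integral>\<^sup>+x. indicator S x * W h x \<partial>lborel) = (\<integral>\<^sup>+x. \<integral>\<^sup>+t. indicator S x * (ennreal (norm (g (x + t *\<^sub>R h) - g x)) * indicator {0..1} t) \<partial>lborel \<partial>lborel)"
              unfolding W_def by (intro nn_integral_cong nn_integral_cmult[symmetric]) measurable
            also have "\<dots> = (\<integral>\<^sup>+t. \<integral>\<^sup>+x. indicator S x * (ennreal (norm (g (x + t *\<^sub>R h) - g x)) * indicator {0..1} t) \<partial>lborel \<partial>lborel)"
              by (rule lborel_pair.Fubini'[symmetric]) measurable
            also have "\<dots> \<le> (\<integral>\<^sup>+t. ennreal e * indicator {0..1::real} t \<partial>lborel)"
            proof (rule nn_integral_mono)
              fix t :: real
              show "(\<integral>\<^sup>+x. indicator S x * (ennreal (norm (g (x + t *\<^sub>R h) - g x)) * indicator {0..1} t) \<partial>lborel) \<le> ennreal e * indicator {0..1} t"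
              proof (cases "0 \<le> t \<and> t \<le> 1")
                case True
                have "norm (t *\<^sub>R h) \<le> norm h" using True by (simp add: mult_left_le_one_le)
                then have th: "norm (t *\<^sub>R h) < r" using hr by linarith
                have "(\<integral>\<^sup>+x. indicator S x * (ennreal (norm (g (x + t *\<^sub>R h) - g x)) * indicator {0..1} t) \<partial>lborel) \<le> (\<integral>\<^sup>+x. indicator C x * ennreal (norm (g (x + t *\<^sub>R h) - g x)) \<partial>lborel)"
                  by (intro nn_integral_mono) (auto simp: S_def indicator_def)
                also have "\<dots> \<le> ennreal e" by (rule r(3)[OF th])
                finally show ?thesis using True by simp
              qed simp
            qed
            also have "\<dots> = ennreal e" by (subst nn_integral_cmult_indicator) auto
            finally show ?thesis .
          qed
          finally show ?thesis using hr by (simp add: mult.assoc add_left_mono mult_left_mono)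
        qed
      qed
    qed
    also have "\<dots> = (\<integral>\<^sup>+h. \<integral>\<^sup>+x. indicator \<Omega> x * indicator (ball 0 (\<rho> x)) h * ennreal (\<bar>f (x + h) - f x\<bar> powr p * k h) \<partial>lborel \<partial>lborel)
       + (\<integral>\<^sup>+h. m h * indicator (ball 0 r) h \<partial>lborel) * (ennreal c * ennreal e)"
      by (subst nn_integral_add) (auto simp: nn_integral_multc indicator_def)
    also have "(\<integral>\<^sup>+h. \<integral>\<^sup>+x. indicator \<Omega> x * indicator (ball 0 (\<rho> x)) h * ennreal (\<bar>f (x + h) - f x\<bar> powr p * k h) \<partial>lborel \<partial>lborel) = ball_energy \<Omega> \<rho> f p b"
      unfolding ball_energy_def k_def by (rule lborel_pair.Fubini') (simp add: indicator_def)
    also have "(\<integral>\<^sup>+h. m h * indicator (ball 0 r) h \<partial>lborel) * (ennreal c * ennreal e) =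
      ennreal (p * N powr (p - 1) * e * (CARD('n) / b * r powr b * measure lborel (cball (0::real^'n) 1)))"
      using c e b p unfolding m_def nn_integral_norm_kernel[OF b r(1)]
      by (simp add: c_def mult_ac flip: ennreal_mult)
    finally show "ennreal (p / b * r powr b) * K_const i p * (\<integral>\<^sup>+x. ennreal (norm (g x) powr p) * indicator {x\<in>C. norm (g x) \<le> N} x \<partial>lborel)
      \<le> ball_energy \<Omega> \<rho> f p b + ennreal (p * N powr (p - 1) * e * (CARD('n) / b * r powr b * measure lborel (cball (0::real^'n) 1)))"
      unfolding S_def .
  qed
qed

end

section \<open>Weak limits of sequences bounded in the mean of order p\<close>

text \<open>In the proof \<open>A\<close>, \<open>B\<close>, \<open>D\<close> are the lengths of the
  plane vectors (1, a), (1, b) and of their sum, so the gap is the defect in the triangle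
  inequality. Lagrange's identity \<open>h1\<close> relates (a - b)^2, the squared determinant of
  the two vectors, to A B and their inner product, and (A + B)^2 - D^2 is twice the difference of
  these. The constant comes from A, B <= 1 + N.\<close>

lemma sqrt_convexity_gap:
  fixes a b N :: real
  assumes N: "\<bar>a\<bar> \<le> N" "\<bar>b\<bar> \<le> N"
  shows "(a - b)\<^sup>2 \<le> 4 * (1 + N) ^ 3 * (sqrt (1 + a\<^sup>2) + sqrt (1 + b\<^sup>2) - 2 * sqrt (1 + ((a + b) / 2)\<^sup>2))"
    and "0 \<le> sqrt (1 + a\<^sup>2) + sqrt (1 + b\<^sup>2) - 2 * sqrt (1 + ((a + b) / 2)\<^sup>2)"
proof -
  define A B D where "A = sqrt (1 + a\<^sup>2)" and "B = sqrt (1 + b\<^sup>2)" and "D = 2 * sqrt (1 + ((a + b) / 2)\<^sup>2)"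
  have A2: "A\<^sup>2 = 1 + a\<^sup>2" and B2: "B\<^sup>2 = 1 + b\<^sup>2" and D2: "D\<^sup>2 = 4 + (a + b)\<^sup>2"
    by (auto simp: A_def B_def D_def power_mult_distrib power_divide)
  have pos: "1 \<le> A" "1 \<le> B" "0 \<le> D" by (auto simp: A_def B_def D_def)
  have AN: "A \<le> 1 + N" "B \<le> 1 + N"
  proof -
    have "A \<le> 1 + \<bar>a\<bar>" "B \<le> 1 + \<bar>b\<bar>"
      unfolding A_def B_def by (auto intro!: real_le_lsqrt simp: power2_eq_square algebra_simps)
    then show "A \<le> 1 + N" "B \<le> 1 + N" using N by auto
  qed
  have h1: "(A * B)\<^sup>2 = (1 + a * b)\<^sup>2 + (a - b)\<^sup>2"
    unfolding power_mult_distrib A2 B2 by algebra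
  have h2: "\<bar>1 + a * b\<bar> \<le> A * B"
    using h1 pos by (intro abs_le_square_iff[THEN iffD2, of "1 + a * b" "A * B", THEN order_trans]) auto
  have "(A * B - (1 + a * b)) * (A * B + (1 + a * b)) = (a - b)\<^sup>2"
    using h1 by (simp add: power2_eq_square algebra_simps)
  moreover have "(A * B - (1 + a * b)) * (A * B + (1 + a * b)) \<le> (A * B - (1 + a * b)) * (2 * (A * B))"
    using h2 by (intro mult_left_mono) auto
  ultimately have h3: "(a - b)\<^sup>2 \<le> (A * B - (1 + a * b)) * (2 * (A * B))" by simp
  have h4: "(A + B)\<^sup>2 - D\<^sup>2 = 2 * (A * B - (1 + a * b))"
    unfolding power2_sum A2 B2 D2 by (simp add: power2_sum algebra_simps)
  have "D\<^sup>2 \<le> (A + B)\<^sup>2" using h4 h2 by argo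
  from power2_le_imp_le[OF this] have D_le: "D \<le> A + B" using pos by linarith
  then show gap0: "0 \<le> sqrt (1 + a\<^sup>2) + sqrt (1 + b\<^sup>2) - 2 * sqrt (1 + ((a + b) / 2)\<^sup>2)"
    by (simp add: A_def B_def D_def)
  have "2 * (A * B - (1 + a * b)) = (A + B - D) * (A + B + D)"
    using h4 by (simp add: power2_eq_square algebra_simps)
  also have "\<dots> \<le> (A + B - D) * (2 * (A + B))" using D_le by (intro mult_left_mono) auto
  finally have "2 * (A * B - (1 + a * b)) * (A * B) \<le> (A + B - D) * (2 * (A + B)) * (A * B)"
    using pos by (intro mult_right_mono) auto
  then have "(a - b)\<^sup>2 \<le> (A + B - D) * (2 * (A + B) * (A * B))" using h3 by (simp add: algebra_simps)
  moreover have "2 * (A + B) * (A * B) \<le> 2 * ((1 + N) + (1 + N)) * ((1 + N) * (1 + N))"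
    using AN pos by (intro mult_mono add_mono) auto
  then have "2 * (A + B) * (A * B) \<le> 4 * (1 + N) ^ 3" by (simp add: power3_eq_cube algebra_simps)
  then have "(A + B - D) * (2 * (A + B) * (A * B)) \<le> (A + B - D) * (4 * (1 + N) ^ 3)"
    using D_le by (intro mult_left_mono) auto
  ultimately have "(a - b)\<^sup>2 \<le> 4 * (1 + N) ^ 3 * (A + B - D)" by (simp add: mult.commute)
  then show "(a - b)\<^sup>2 \<le> 4 * (1 + N) ^ 3 * (sqrt (1 + a\<^sup>2) + sqrt (1 + b\<^sup>2) - 2 * sqrt (1 + ((a + b) / 2)\<^sup>2))"
    by (simp add: A_def B_def D_def)
qed

text \<open>Turns the convexity gap into control of first powers. For values up to \<open>N\<close>
  use |t| <= \<open>\<delta>\<close> + t^2 / \<open>\<delta>\<close>; otherwise the larger absolute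
  value m exceeds \<open>N\<close> and satisfies m <= N^(1 - p) m^p, so the p-th powers control the
  rest with a factor that is small for large \<open>N\<close>.\<close>

lemma abs_diff_le_gap:
  fixes a b N \<delta> p :: real
  assumes p: "1 < p" and N: "1 \<le> N" and \<delta>: "0 < \<delta>"
  shows "\<bar>a - b\<bar> \<le> \<delta> + 4 * (1 + N) ^ 3 / \<delta> * (sqrt (1 + a\<^sup>2) + sqrt (1 + b\<^sup>2) - 2 * sqrt (1 + ((a + b) / 2)\<^sup>2))
    + 2 * N powr (1 - p) * (\<bar>a\<bar> powr p + \<bar>b\<bar> powr p)"
proof -
  define gap where "gap = sqrt (1 + a\<^sup>2) + sqrt (1 + b\<^sup>2) - 2 * sqrt (1 + ((a + b) / 2)\<^sup>2)"
  have gap0: "0 \<le> gap"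
    unfolding gap_def by (rule sqrt_convexity_gap(2)[of _ "max \<bar>a\<bar> \<bar>b\<bar>"]) auto
  have c0: "0 \<le> 4 * (1 + N) ^ 3 / \<delta>" using N \<delta> by auto
  show ?thesis
  proof (cases "\<bar>a\<bar> \<le> N \<and> \<bar>b\<bar> \<le> N")
    case True
    have "\<bar>a - b\<bar> \<le> \<delta> + (a - b)\<^sup>2 / \<delta>"
    proof (cases "\<bar>a - b\<bar> \<le> \<delta>")
      case False
      then have "\<bar>a - b\<bar> * \<delta> \<le> \<bar>a - b\<bar> * \<bar>a - b\<bar>" by (intro mult_left_mono) auto
      then have "\<bar>a - b\<bar> \<le> (a - b)\<^sup>2 / \<delta>" using \<delta> by (simp add: pos_le_divide_eq power2_eq_square)
      then show ?thesis using \<delta> by simp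
    qed (use \<delta> in \<open>auto intro: add_increasing2\<close>)
    also have "(a - b)\<^sup>2 / \<delta> \<le> 4 * (1 + N) ^ 3 * gap / \<delta>"
      using sqrt_convexity_gap(1)[of a N b] True \<delta> unfolding gap_def by (intro divide_right_mono) auto
    finally have "\<bar>a - b\<bar> \<le> \<delta> + 4 * (1 + N) ^ 3 / \<delta> * gap" by simp
    moreover have "0 \<le> 2 * N powr (1 - p) * (\<bar>a\<bar> powr p + \<bar>b\<bar> powr p)" by simp
    ultimately show ?thesis unfolding gap_def by linarith
  next
    case False
    define m where "m = max \<bar>a\<bar> \<bar>b\<bar>"
    have m: "N < m" using False by (auto simp: m_def)
    then have "m = m powr (1 - p) * m powr p" using N by (simp flip: powr_add)
    also have "\<dots> \<le> N powr (1 - p) * m powr p"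
      using m N p by (intro mult_right_mono powr_mono2') auto
    also have "\<dots> \<le> N powr (1 - p) * (\<bar>a\<bar> powr p + \<bar>b\<bar> powr p)"
      by (intro mult_left_mono) (auto simp: m_def max_def)
    finally have "2 * m \<le> 2 * N powr (1 - p) * (\<bar>a\<bar> powr p + \<bar>b\<bar> powr p)" by simp
    moreover have "\<bar>a - b\<bar> \<le> 2 * m" by (auto simp: m_def)
    moreover have "0 \<le> 4 * (1 + N) ^ 3 / \<delta> * gap" using c0 gap0 by (intro mult_nonneg_nonneg)
    ultimately show ?thesis using \<delta> unfolding gap_def by linarith
  qed
qed

lemma powr_midpoint_le:
  fixes a b p :: real
  assumes "1 < p"
  shows "\<bar>(a + b) / 2\<bar> powr p \<le> (\<bar>a\<bar> powr p + \<bar>b\<bar> powr p) / 2"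
proof -
  define m where "m = (a + b) / 2"
  have "\<bar>m\<bar> powr p + p * sgn m * \<bar>m\<bar> powr (p - 1) * (a - m) \<le> \<bar>a\<bar> powr p"
    "\<bar>m\<bar> powr p + p * sgn m * \<bar>m\<bar> powr (p - 1) * (b - m) \<le> \<bar>b\<bar> powr p"
    using powr_tangent_le[OF assms] by blast+
  moreover have "p * sgn m * \<bar>m\<bar> powr (p - 1) * (a - m) + p * sgn m * \<bar>m\<bar> powr (p - 1) * (b - m) = 0"
    by (simp add: m_def flip: distrib_left)
  ultimately show ?thesis unfolding m_def[symmetric] by argo
qed

lemma abs_le_1_plus_powr:
  fixes a p :: real
  assumes "1 < p"
  shows "\<bar>a\<bar> \<le> 1 + \<bar>a\<bar> powr p"
proof (cases "\<bar>a\<bar> \<le> 1")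
  case False
  then have "\<bar>a\<bar> powr 1 \<le> \<bar>a\<bar> powr p" using assms by (intro powr_mono) auto
  then show ?thesis using False by simp
qed (simp add: add_increasing2)

text \<open>Completeness of L^1 as a telescoping series: along a fast subsequence the increments
  have norm at most 2^(-j), so their sum converges absolutely almost everywhere and in the mean, and
  can be tested termwise with a bounded function.\<close>

lemma L1_Cauchy_imp_weak_limit:
  fixes w :: "nat \<Rightarrow> 'a \<Rightarrow> real"
  assumes w: "\<And>k. integrable M (w k)"
    and cauchy: "\<And>e. 0 < e \<Longrightarrow> \<exists>n. \<forall>k\<ge>n. \<forall>l\<ge>k. (LINT x|M. \<bar>w k x - w l x\<bar>) \<le> e"
  obtains u where "integrable M u"
    "\<And>\<phi> B T. \<phi> \<in> borel_measurable M \<Longrightarrow> (\<And>x. \<bar>\<phi> x\<bar> \<le> B) \<Longrightarrow> (\<lambda>k. LINT x|M. w k x * \<phi> x) \<longlonglongrightarrow> T \<Longrightarrow>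
      (LINT x|M. u x * \<phi> x) = T"
proof -
  have [measurable]: "w k \<in> borel_measurable M" for k using w[of k] by auto
  have "\<forall>j. \<exists>n. \<forall>k\<ge>n. \<forall>l\<ge>k. (LINT x|M. \<bar>w k x - w l x\<bar>) \<le> (1 / 2) ^ j"
    using cauchy by simp
  then obtain n where n: "\<And>j k l. n j \<le> k \<Longrightarrow> k \<le> l \<Longrightarrow> (LINT x|M. \<bar>w k x - w l x\<bar>) \<le> (1 / 2) ^ j" by metis
  \<comment> \<open>The partial sum dominates \<open>n j\<close>, and the summand \<open>j\<close>
    makes the indices strictly increasing.\<close>
  define r where "r j = (\<Sum>i\<le>j. n i) + j" for j
  have r_ge: "n j \<le> r j" for j
  proof -
    have "n j \<le> (\<Sum>i\<le>j. n i)" by (rule member_le_sum) auto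
    then show ?thesis by (simp add: r_def)
  qed
  have r_mono: "strict_mono r" by (rule strict_monoI_Suc) (simp add: r_def)
  define d where "d j x = w (r (Suc j)) x - w (r j) x" for j x
  have d_int: "integrable M (d j)" for j unfolding d_def[abs_def] using w by simp
  then have [measurable]: "d j \<in> borel_measurable M" for j by auto
  have d_le: "(LINT x|M. norm (d j x)) \<le> (1 / 2) ^ j" for j
    using n[OF r_ge[of j], of "r (Suc j)"] strict_monoD[OF r_mono, of j "Suc j"]
    by (simp add: d_def abs_minus_commute)
  have sum_d: "summable (\<lambda>j. LINT x|M. norm (d j x))"
    by (rule summable_comparison_test'[where g="\<lambda>j. (1 / 2) ^ j" and N=0]) (use d_le in \<open>auto simp: abs_of_nonneg\<close>)
  have ae: "AE x in M. summable (\<lambda>j. norm (d j x))"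
  proof -
    have "(\<integral>\<^sup>+x. (\<Sum>j. ennreal (norm (d j x))) \<partial>M) = (\<Sum>j. \<integral>\<^sup>+x. ennreal (norm (d j x)) \<partial>M)"
      by (rule nn_integral_suminf) measurable
    also have "\<dots> = (\<Sum>j. ennreal (LINT x|M. norm (d j x)))"
      using d_int by (intro suminf_cong nn_integral_eq_integral integrable_norm) auto
    also have "\<dots> = ennreal (\<Sum>j. LINT x|M. norm (d j x))"
      using sum_d by (intro suminf_ennreal2) auto
    finally have "(\<integral>\<^sup>+x. (\<Sum>j. ennreal (norm (d j x))) \<partial>M) \<noteq> \<infinity>" by simp
    then have "AE x in M. (\<Sum>j. ennreal (norm (d j x))) \<noteq> \<infinity>"
      by (intro nn_integral_PInf_AE) auto
    then show ?thesis by eventually_elim (auto intro!: summable_suminf_not_top)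
  qed
  define u where "u x = w (r 0) x + (\<Sum>j. d j x)" for x
  have sd_int: "integrable M (\<lambda>x. \<Sum>j. d j x)"
    by (rule integrable_suminf[OF d_int ae sum_d])
  show ?thesis
  proof (rule that)
    show "integrable M u" unfolding u_def[abs_def] using w sd_int by simp
    fix \<phi> :: "'a \<Rightarrow> real" and B T :: real
    assume [measurable]: "\<phi> \<in> borel_measurable M" and B: "\<And>x. \<bar>\<phi> x\<bar> \<le> B"
      and T: "(\<lambda>k. LINT x|M. w k x * \<phi> x) \<longlonglongrightarrow> T"
    have B0: "0 \<le> B" using B[of undefined] by linarith
    have mult_int: "integrable M (\<lambda>x. v x * \<phi> x)" if "integrable M v" for v :: "'a \<Rightarrow> real"
    proof (rule Bochner_Integration.integrable_bound[where f="\<lambda>x. B * v x"])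
      show "AE x in M. norm (v x * \<phi> x) \<le> norm (B * v x)"
        using B B0 by (intro AE_I2) (auto simp: abs_mult mult.commute[of "\<bar>v _\<bar>"] intro!: mult_right_mono)
    qed (use that in auto)
    have le: "norm (d j x * \<phi> x) \<le> B * norm (d j x)" for j x
      using B[of x] by (auto simp: abs_mult mult.commute[of "\<bar>d j x\<bar>"] intro!: mult_right_mono)
    have ae\<phi>: "AE x in M. summable (\<lambda>j. norm (d j x * \<phi> x))"
      using ae
    proof eventually_elim
      case (elim x)
      show ?case
        by (rule summable_comparison_test'[OF summable_mult[OF elim, of B], of 0]) (use le in auto)
    qed
    have sum\<phi>: "summable (\<lambda>j. LINT x|M. norm (d j x * \<phi> x))"
    proof (rule summable_comparison_test'[OF summable_mult[OF sum_d, of B], of 0])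
      fix j :: nat
      have "(LINT x|M. norm (d j x * \<phi> x)) \<le> (LINT x|M. B * norm (d j x))"
        using le d_int mult_int[OF d_int] by (intro integral_mono integrable_norm integrable_mult_right) auto
      then show "norm (LINT x|M. norm (d j x * \<phi> x)) \<le> B * (LINT x|M. norm (d j x))"
        by simp
    qed
    have "(\<lambda>j. LINT x|M. d j x * \<phi> x) sums (LINT x|M. (\<Sum>j. d j x * \<phi> x))"
      by (rule sums_integral[OF mult_int[OF d_int] ae\<phi> sum\<phi>])
    then have "(\<lambda>m. \<Sum>j<m. LINT x|M. d j x * \<phi> x) \<longlonglongrightarrow> (LINT x|M. (\<Sum>j. d j x * \<phi> x))"
      by (simp add: sums_def)
    moreover have "(\<Sum>j<m. LINT x|M. d j x * \<phi> x) = (LINT x|M. w (r m) x * \<phi> x) - (LINT x|M. w (r 0) x * \<phi> x)" for m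
    proof -
      have "(LINT x|M. d j x * \<phi> x) = (LINT x|M. w (r (Suc j)) x * \<phi> x) - (LINT x|M. w (r j) x * \<phi> x)" for j
        using mult_int[OF w] by (simp add: d_def left_diff_distrib)
      then show ?thesis using sum_lessThan_telescope[of "\<lambda>m. LINT x|M. w (r m) x * \<phi> x" m] by simp
    qed
    moreover have "(\<lambda>m. (LINT x|M. w (r m) x * \<phi> x) - (LINT x|M. w (r 0) x * \<phi> x)) \<longlonglongrightarrow> T - (LINT x|M. w (r 0) x * \<phi> x)"
      using LIMSEQ_subseq_LIMSEQ[OF T r_mono] by (intro tendsto_diff tendsto_const) (simp add: o_def)
    ultimately have "(LINT x|M. (\<Sum>j. d j x * \<phi> x)) = T - (LINT x|M. w (r 0) x * \<phi> x)"
      by (simp add: LIMSEQ_unique)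
    moreover have "(LINT x|M. (\<Sum>j. d j x * \<phi> x)) = (LINT x|M. (\<Sum>j. d j x) * \<phi> x)"
    proof (rule integral_cong_AE)
      show "AE x in M. (\<Sum>j. d j x * \<phi> x) = (\<Sum>j. d j x) * \<phi> x"
        using ae by eventually_elim (auto intro!: suminf_mult2[symmetric] dest: summable_rabs_cancel)
    qed measurable
    ultimately show "(LINT x|M. u x * \<phi> x) = T"
      using mult_int[OF w] mult_int[OF sd_int] by (simp add: u_def distrib_right)
  qed
qed

text \<open>Instead of convex combinations, minimise \<open>\<integral> sqrt (1 + u\<^sup>2)\<close> over the decreasing convex sets
  of functions \<open>u\<close> whose moments approximate the limits at least as well as all \<open>v j\<close> with
  \<open>j \<ge> k\<close>. By uniform convexity near-minimisers form a Cauchy sequence in the mean.\<close>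

theorem (in finite_measure) weak_limit_of_bounded_powr_integrals:
  fixes v :: "nat \<Rightarrow> 'a \<Rightarrow> real" and p C :: real
  assumes p: "1 < p" and v: "\<And>k. v k \<in> borel_measurable M"
    and bd: "\<And>k. (\<integral>\<^sup>+x. ennreal (\<bar>v k x\<bar> powr p) \<partial>M) \<le> ennreal C" and C: "0 \<le> C"
  obtains u where "integrable M u"
    "\<And>\<phi> B T. \<phi> \<in> borel_measurable M \<Longrightarrow> (\<And>x. \<bar>\<phi> x\<bar> \<le> B) \<Longrightarrow> (\<lambda>k. LINT x|M. v k x * \<phi> x) \<longlonglongrightarrow> T \<Longrightarrow>
      (LINT x|M. u x * \<phi> x) = T"
proof -
  define L where "L = {u \<in> borel_measurable M. integrable M (\<lambda>x. \<bar>u x\<bar> powr p) \<and> (LINT x|M. \<bar>u x\<bar> powr p) \<le> C}"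
  define P where "P = {(\<phi> :: 'a \<Rightarrow> real, T). \<phi> \<in> borel_measurable M \<and> (\<exists>B. \<forall>x. \<bar>\<phi> x\<bar> \<le> B) \<and> (\<lambda>k. LINT x|M. v k x * \<phi> x) \<longlonglongrightarrow> T}"
  \<comment> \<open>Each condition confines a linear functional of u to an interval around
    \<open>T\<close>, so it survives midpoints. \<open>P\<close> holds only test functions whose
    integrals against \<open>v\<close> already converge, so no diagonal subsequence is
    extracted.\<close>
  define \<C> where "\<C> k = {u \<in> L. \<forall>(\<phi>, T)\<in>P. \<forall>e. (\<forall>j\<ge>k. \<bar>(LINT x|M. v j x * \<phi> x) - T\<bar> \<le> e) \<longrightarrow> \<bar>(LINT x|M. u x * \<phi> x) - T\<bar> \<le> e}" for k :: nat
  \<comment> \<open>Linear growth keeps \<open>J\<close> finite and bounded on \<open>L\<close>,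
    because |a| <= 1 + |a|^p; strict convexity forces near-minimisers to be close.\<close>
  define J where "J u = (LINT x|M. sqrt (1 + (u x)\<^sup>2))" for u
  have L_meas: "u \<in> borel_measurable M" if "u \<in> L" for u using that by (simp add: L_def)
  have L_int: "integrable M u" if u: "u \<in> L" for u
  proof (rule Bochner_Integration.integrable_bound[where f="\<lambda>x. 1 + \<bar>u x\<bar> powr p"])
    show "integrable M (\<lambda>x. 1 + \<bar>u x\<bar> powr p)" using u by (simp add: L_def)
    show "AE x in M. norm (u x) \<le> norm (1 + \<bar>u x\<bar> powr p)"
      using abs_le_1_plus_powr[OF p] by (intro AE_I2) auto
  qed (rule L_meas[OF u])
  have sqrt_le: "sqrt (1 + a\<^sup>2) \<le> 1 + \<bar>a\<bar>" for a :: real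
    by (auto intro!: real_le_lsqrt simp: power2_eq_square algebra_simps)
  have J_int: "integrable M (\<lambda>x. sqrt (1 + (u x)\<^sup>2))" if u: "u \<in> L" for u
  proof (rule Bochner_Integration.integrable_bound[where f="\<lambda>x. 1 + \<bar>u x\<bar>"])
    show "integrable M (\<lambda>x. 1 + \<bar>u x\<bar>)" using L_int[OF u] by simp
    show "AE x in M. norm (sqrt (1 + (u x)\<^sup>2)) \<le> norm (1 + \<bar>u x\<bar>)"
      using sqrt_le by (intro AE_I2) auto
  qed (use L_meas[OF u] in measurable)
  have J_nonneg: "0 \<le> J u" for u unfolding J_def by (rule Bochner_Integration.integral_nonneg) simp
  have J_bound: "J u \<le> 2 * measure M (space M) + C" if u: "u \<in> L" for u
  proof -
    have "sqrt (1 + (u x)\<^sup>2) \<le> 2 + \<bar>u x\<bar> powr p" for x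
      using sqrt_le[of "u x"] abs_le_1_plus_powr[OF p, of "u x"] by linarith
    then have "J u \<le> (LINT x|M. 2 + \<bar>u x\<bar> powr p)"
      unfolding J_def using J_int[OF u] u by (intro integral_mono) (auto simp: L_def)
    also have "\<dots> = 2 * measure M (space M) + (LINT x|M. \<bar>u x\<bar> powr p)"
      using u by (simp add: L_def)
    finally show ?thesis using u by (simp add: L_def)
  qed
  have L_mid: "(\<lambda>x. (u x + u' x) / 2) \<in> L" if u: "u \<in> L" "u' \<in> L" for u u'
  proof -
    have [measurable]: "u \<in> borel_measurable M" "u' \<in> borel_measurable M" using u L_meas by auto
    have i: "integrable M (\<lambda>x. (\<bar>u x\<bar> powr p + \<bar>u' x\<bar> powr p) / 2)" using u by (simp add: L_def)
    have i2: "integrable M (\<lambda>x. \<bar>(u x + u' x) / 2\<bar> powr p)"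
      by (rule Bochner_Integration.integrable_bound[OF i]) (use powr_midpoint_le[OF p] in auto)
    have "(LINT x|M. \<bar>(u x + u' x) / 2\<bar> powr p) \<le> (LINT x|M. (\<bar>u x\<bar> powr p + \<bar>u' x\<bar> powr p) / 2)"
      by (rule integral_mono[OF i2 i]) (rule powr_midpoint_le[OF p])
    also have "\<dots> \<le> C" using u by (simp add: L_def)
    finally show ?thesis using i2 by (simp add: L_def)
  qed
  have mult_int: "integrable M (\<lambda>x. u x * \<phi> x)" if u: "u \<in> L" and \<phi>: "(\<phi>, T) \<in> P" for u \<phi> T
  proof -
    obtain B where B: "\<And>x. \<bar>\<phi> x\<bar> \<le> B" and [measurable]: "\<phi> \<in> borel_measurable M" using \<phi> by (auto simp: P_def)
    have [measurable]: "u \<in> borel_measurable M" using u L_meas by auto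
    show ?thesis
    proof (rule Bochner_Integration.integrable_bound[where f="\<lambda>x. B * u x"])
      show "AE x in M. norm (u x * \<phi> x) \<le> norm (B * u x)"
        using order_trans[OF B abs_ge_self]
        by (intro AE_I2) (auto simp: abs_mult mult.commute[of "\<bar>u _\<bar>"] intro!: mult_right_mono)
    qed (use L_int[OF u] in auto)
  qed
  have C_mid: "(\<lambda>x. (u x + u' x) / 2) \<in> \<C> k" if u: "u \<in> \<C> k" "u' \<in> \<C> k" for u u' k
  proof -
    have uL: "u \<in> L" "u' \<in> L" using u by (auto simp: \<C>_def)
    have "\<bar>(LINT x|M. (u x + u' x) / 2 * \<phi> x) - T\<bar> \<le> e"
      if \<phi>: "(\<phi>, T) \<in> P" and e: "\<forall>j\<ge>k. \<bar>(LINT x|M. v j x * \<phi> x) - T\<bar> \<le> e" for \<phi> T e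
    proof -
      have "\<bar>(LINT x|M. u x * \<phi> x) - T\<bar> \<le> e" "\<bar>(LINT x|M. u' x * \<phi> x) - T\<bar> \<le> e"
        using u \<phi> e unfolding \<C>_def by blast+
      moreover have "(LINT x|M. (u x + u' x) / 2 * \<phi> x) = ((LINT x|M. u x * \<phi> x) + (LINT x|M. u' x * \<phi> x)) / 2"
        using mult_int[OF uL(1) \<phi>] mult_int[OF uL(2) \<phi>] by (simp add: add_divide_distrib distrib_right)
      ultimately show ?thesis by argo
    qed
    then show ?thesis using L_mid[OF uL] unfolding \<C>_def by blast
  qed
  have C_mono: "\<C> l \<subseteq> \<C> k" if "k \<le> l" for k l
  proof
    fix u assume u: "u \<in> \<C> l"
    have "\<bar>(LINT x|M. u x * \<phi> x) - T\<bar> \<le> e"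
      if \<phi>: "(\<phi>, T) \<in> P" and e: "\<forall>j\<ge>k. \<bar>(LINT x|M. v j x * \<phi> x) - T\<bar> \<le> e" for \<phi> T e
    proof -
      have "\<forall>j\<ge>l. \<bar>(LINT x|M. v j x * \<phi> x) - T\<bar> \<le> e" using e \<open>k \<le> l\<close> by auto
      then show ?thesis using u \<phi> unfolding \<C>_def by blast
    qed
    then show "u \<in> \<C> k" using u unfolding \<C>_def by blast
  qed
  have vC: "v k \<in> \<C> k" for k
  proof -
    have [measurable]: "v k \<in> borel_measurable M" by (rule v)
    have i: "integrable M (\<lambda>x. \<bar>v k x\<bar> powr p)"
      using bd[of k] by (intro integrableI_nonneg) (auto intro: le_less_trans)
    have "ennreal (LINT x|M. \<bar>v k x\<bar> powr p) \<le> ennreal C"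
      using bd[of k] nn_integral_eq_integral[OF i] by simp
    then have "(LINT x|M. \<bar>v k x\<bar> powr p) \<le> C" using C by simp
    then have "v k \<in> L" using i by (simp add: L_def)
    then show ?thesis by (auto simp: \<C>_def)
  qed
  have CL: "u \<in> L" if "u \<in> \<C> k" for u k using that by (simp add: \<C>_def)
  define m where "m k = Inf (J ` \<C> k)" for k
  have bddb: "bdd_below (J ` \<C> k)" for k using J_nonneg by (intro bdd_belowI[of _ 0]) auto
  have m_le: "m k \<le> J u" if "u \<in> \<C> k" for u k
    unfolding m_def using that bddb by (intro cInf_lower) auto
  have m_mono: "m k \<le> m l" if "k \<le> l" for k l
    unfolding m_def using C_mono[OF that] vC[of l] bddb by (intro cInf_superset_mono) auto
  have m_bd: "m k \<le> 2 * measure M (space M) + C" for k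
    using m_le[OF vC] J_bound[OF CL[OF vC]] by (rule order_trans)
  have "\<exists>u\<in>\<C> k. J u < m k + 1 / real (Suc k)" for k
  proof -
    have "Inf (J ` \<C> k) < m k + 1 / real (Suc k)" by (simp add: m_def)
    then have "\<exists>y\<in>J ` \<C> k. y < m k + 1 / real (Suc k)"
      using vC[of k] bddb[of k] by (subst cInf_less_iff[symmetric]) auto
    then show ?thesis by blast
  qed
  then obtain w where w: "\<And>k. w k \<in> \<C> k" "\<And>k. J (w k) < m k + 1 / real (Suc k)" by metis
  have wL: "w k \<in> L" for k using w CL by blast
  have "incseq m" using m_mono by (auto simp: incseq_def)
  then obtain m0 where m0: "m \<longlonglongrightarrow> m0" "\<And>k. m k \<le> m0"
    using incseq_convergent[of m "2 * measure M (space M) + C"] m_bd by blast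
  \<comment> \<open>\<open>w k\<close>, \<open>w l\<close> and their midpoint all lie in
    \<open>\<C> k\<close>, so \<open>J\<close> is at least \<open>m k\<close> at the midpoint, while
    its values at \<open>w k\<close> and \<open>w l\<close> exceed \<open>m k\<close> and
    \<open>m l\<close> by at most 1 / (k + 1). With \<open>m l\<close> at most \<open>m0\<close>,
    the gap has integral at most m0 - m k + 2 / (k + 1).\<close>
  have diff_le: "(LINT x|M. \<bar>w k x - w l x\<bar>) \<le> \<delta> * measure M (space M) + 4 * (1 + N) ^ 3 / \<delta> * (m0 - m k + 2 / real (Suc k)) + 4 * N powr (1 - p) * C"
    if kl: "k \<le> l" and N: "1 \<le> N" and \<delta>: "0 < \<delta>" for k l N \<delta>
  proof -
    let ?mid = "\<lambda>x. (w k x + w l x) / 2"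
    have wl: "w l \<in> \<C> k" using C_mono[OF kl] w by blast
    have midL: "?mid \<in> L" using L_mid wL by blast
    have Jmid: "m k \<le> J ?mid" by (rule m_le[OF C_mid[OF w(1) wl]])
    define c where "c = 4 * (1 + N) ^ 3 / \<delta>"
    have c: "0 \<le> c" using N \<delta> by (auto simp: c_def)
    define R where "R x = \<delta> + c * (sqrt (1 + (w k x)\<^sup>2) + sqrt (1 + (w l x)\<^sup>2) - 2 * sqrt (1 + (?mid x)\<^sup>2))
       + 2 * N powr (1 - p) * (\<bar>w k x\<bar> powr p + \<bar>w l x\<bar> powr p)" for x
    have pint: "integrable M (\<lambda>x. \<bar>w k x\<bar> powr p)" for k using wL by (simp add: L_def)
    have "(LINT x|M. \<bar>w k x - w l x\<bar>) \<le> (LINT x|M. R x)"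
    proof (rule integral_mono)
      show "integrable M (\<lambda>x. \<bar>w k x - w l x\<bar>)" using L_int[OF wL] by simp
      show "integrable M R" unfolding R_def
        using J_int[OF wL] J_int[OF midL] pint by simp
      show "\<bar>w k x - w l x\<bar> \<le> R x" for x
        unfolding R_def c_def by (rule abs_diff_le_gap[OF p N \<delta>])
    qed
    also have "(LINT x|M. R x) = \<delta> * measure M (space M) + c * (J (w k) + J (w l) - 2 * J ?mid)
       + 2 * N powr (1 - p) * ((LINT x|M. \<bar>w k x\<bar> powr p) + (LINT x|M. \<bar>w l x\<bar> powr p))"
      unfolding R_def J_def using J_int[OF wL] J_int[OF midL] pint by simp
    also have "\<dots> \<le> \<delta> * measure M (space M) + c * (m0 - m k + 2 / real (Suc k)) + 2 * N powr (1 - p) * (C + C)"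
    proof (intro add_mono mult_left_mono order_refl c)
      have "1 / real (Suc l) \<le> 1 / real (Suc k)" using kl by (simp add: frac_le)
      then show "J (w k) + J (w l) - 2 * J ?mid \<le> m0 - m k + 2 / real (Suc k)"
        using w(2)[of k] w(2)[of l] m0(2)[of l] Jmid by argo
      show "(LINT x|M. \<bar>w k x\<bar> powr p) \<le> C" "(LINT x|M. \<bar>w l x\<bar> powr p) \<le> C" using wL by (auto simp: L_def)
    qed (use \<delta> in auto)
    finally show ?thesis by (simp add: c_def)
  qed
  have cauchy: "\<exists>n. \<forall>k\<ge>n. \<forall>l\<ge>k. (LINT x|M. \<bar>w k x - w l x\<bar>) \<le> e" if e: "0 < e" for e :: real
  proof -
    \<comment> \<open>Three terms get a third of \<open>e\<close> each. The order of the choices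
      matters: \<open>\<delta>\<close> first, then a large \<open>N\<close>, and only then
      \<open>n\<close>, because the factor of the convexity gap depends on both
      \<open>\<delta>\<close> and \<open>N\<close>.\<close>
    define \<delta> where "\<delta> = e / (3 * (measure M (space M) + 1))"
    have mpos: "0 < measure M (space M) + 1" using measure_nonneg[of M "space M"] by linarith
    have \<delta>: "0 < \<delta>" using e mpos by (simp add: \<delta>_def)
    have \<delta>e: "\<delta> * measure M (space M) \<le> e / 3"
    proof -
      have "\<delta> * measure M (space M) \<le> \<delta> * (measure M (space M) + 1)" using \<delta> by (intro mult_left_mono) auto
      also have "\<dots> = e / 3" using mpos by (simp add: \<delta>_def field_simps)
      finally show ?thesis .
    qed
    have "((\<lambda>N. 4 * N powr (1 - p) * C) \<longlongrightarrow> 4 * 0 * C) at_top"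
      using p by (intro tendsto_intros tendsto_neg_powr filterlim_ident) auto
    then have "eventually (\<lambda>N. 4 * N powr (1 - p) * C < e / 3) at_top"
      using e by (intro order_tendstoD(2)) auto
    then obtain N0 where N0: "\<And>N. N0 \<le> N \<Longrightarrow> 4 * N powr (1 - p) * C < e / 3"
      by (auto simp: eventually_at_top_linorder)
    define N where "N = max 1 N0"
    have N: "1 \<le> N" "4 * N powr (1 - p) * C < e / 3" using N0 by (auto simp: N_def)
    have "(\<lambda>k. 4 * (1 + N) ^ 3 / \<delta> * (m0 - m k + 2 * inverse (real (Suc k)))) \<longlonglongrightarrow> 4 * (1 + N) ^ 3 / \<delta> * (m0 - m0 + 2 * 0)"
      by (intro tendsto_mult tendsto_add tendsto_diff tendsto_const m0(1) LIMSEQ_inverse_real_of_nat)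
    then have "eventually (\<lambda>k. 4 * (1 + N) ^ 3 / \<delta> * (m0 - m k + 2 * inverse (real (Suc k))) < e / 3) sequentially"
      using e by (intro order_tendstoD(2)) auto
    then obtain n where n': "\<forall>k\<ge>n. 4 * (1 + N) ^ 3 / \<delta> * (m0 - m k + 2 * inverse (real (Suc k))) < e / 3"
      unfolding eventually_sequentially by blast
    have n: "4 * (1 + N) ^ 3 / \<delta> * (m0 - m k + 2 / real (Suc k)) < e / 3" if "n \<le> k" for k
      using n'[rule_format, OF that] by (simp only: divide_inverse)
    show ?thesis
    proof (intro exI allI impI)
      fix k l assume "n \<le> k" "k \<le> l"
      then show "(LINT x|M. \<bar>w k x - w l x\<bar>) \<le> e"
        using diff_le[OF \<open>k \<le> l\<close> N(1) \<delta>] n[OF \<open>n \<le> k\<close>] \<delta>e N(2) by linarith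
    qed
  qed
  obtain u where u: "integrable M u"
    "\<And>\<phi> B T. \<phi> \<in> borel_measurable M \<Longrightarrow> (\<And>x. \<bar>\<phi> x\<bar> \<le> B) \<Longrightarrow> (\<lambda>k. LINT x|M. w k x * \<phi> x) \<longlonglongrightarrow> T \<Longrightarrow>
      (LINT x|M. u x * \<phi> x) = T"
    by (rule L1_Cauchy_imp_weak_limit[of M w, OF L_int[OF wL] cauchy]) blast+
  show ?thesis
  proof (rule that[OF u(1)])
    fix \<phi> :: "'a \<Rightarrow> real" and B T :: real
    assume \<phi>: "\<phi> \<in> borel_measurable M" and B: "\<And>x. \<bar>\<phi> x\<bar> \<le> B"
      and T: "(\<lambda>k. LINT x|M. v k x * \<phi> x) \<longlonglongrightarrow> T"
    have \<phi>P: "(\<phi>, T) \<in> P" using \<phi> B T by (auto simp: P_def)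
    \<comment> \<open>The near-minimisers have the same limits as \<open>v\<close>: a bound on the
      deviation of all \<open>v j\<close> with j >= k holds for \<open>w k\<close> by membership in
      \<open>\<C> k\<close>.\<close>
    have "(\<lambda>k. LINT x|M. w k x * \<phi> x) \<longlonglongrightarrow> T"
    proof (rule LIMSEQ_I)
      fix e :: real assume "0 < e"
      then obtain n where n: "\<And>j. n \<le> j \<Longrightarrow> \<bar>(LINT x|M. v j x * \<phi> x) - T\<bar> < e / 2"
        using LIMSEQ_D[OF T, of "e / 2"] by auto
      show "\<exists>n. \<forall>k\<ge>n. norm ((LINT x|M. w k x * \<phi> x) - T) < e"
      proof (intro exI allI impI)
        fix k assume "n \<le> k"
        then have "\<forall>j\<ge>k. \<bar>(LINT x|M. v j x * \<phi> x) - T\<bar> \<le> e / 2" using n by (meson less_imp_le order_trans)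
        then have "\<bar>(LINT x|M. w k x * \<phi> x) - T\<bar> \<le> e / 2" using w(1)[of k] \<phi>P unfolding \<C>_def by blast
        then show "norm ((LINT x|M. w k x * \<phi> x) - T) < e" using \<open>0 < e\<close> by simp
      qed
    qed
    then show "(LINT x|M. u x * \<phi> x) = T" using u(2)[OF \<phi> B] by blast
  qed
qed

section \<open>Weak differentiability from bounded energies\<close>

lemma distr_lborel_orthogonal:
  fixes T :: "'a::euclidean_space \<Rightarrow> 'a"
  assumes T: "orthogonal_transformation T"
  shows "distr lborel borel T = lborel"
proof (rule measure_eqI)
  have "linear T" using T by (rule orthogonal_transformation_linear)
  then have [measurable]: "T \<in> borel_measurable borel"
    by (intro borel_measurable_continuous_onI linear_continuous_on linear_conv_bounded_linear[THEN iffD1])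
  fix A :: "'a set" assume "A \<in> sets (distr lborel borel T)"
  then have [measurable]: "A \<in> sets borel" by simp
  have "emeasure (distr lborel borel T) A = (\<integral>\<^sup>+x. indicator A x \<partial>distr lborel borel T)" by simp
  also have "\<dots> = (\<integral>\<^sup>+x. indicator A (T x) \<partial>lborel)" by (rule nn_integral_distr) auto
  also have "\<dots> = (\<integral>\<^sup>+x. indicator A x \<partial>lborel)" by (rule nn_integral_lborel_orthogonal) (auto simp: T)
  finally show "emeasure (distr lborel borel T) A = emeasure lborel A" by simp
qed simp

lemma integral_lborel_orthogonal:
  fixes T :: "'a::euclidean_space \<Rightarrow> 'a" and u :: "'a \<Rightarrow> real"
  assumes T: "orthogonal_transformation T" and [measurable]: "u \<in> borel_measurable borel"
  shows "(LINT x|lborel. u (T x)) = (LINT x|lborel. u x)"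
proof -
  have "linear T" using T by (rule orthogonal_transformation_linear)
  then have [measurable]: "T \<in> borel_measurable borel"
    by (intro borel_measurable_continuous_onI linear_continuous_on linear_conv_bounded_linear[THEN iffD1])
  have "(LINT x|lborel. u x) = (LINT x|distr lborel borel T. u x)"
    by (simp add: distr_lborel_orthogonal[OF T])
  also have "\<dots> = (LINT x|lborel. u (T x))" by (rule integral_distr) auto
  finally show ?thesis by simp
qed

lemma orthogonal_coordinate_reflection:
  "orthogonal_transformation (\<lambda>h::real^'n::finite. \<chi> j. if j = i then - h $ j else h $ j)"
  unfolding orthogonal_transformation_def
proof (intro conjI allI)
  show "linear (\<lambda>h::real^'n. \<chi> j. if j = i then - h $ j else h $ j)"
    by (rule linearI) (auto simp: vec_eq_iff)
  show "(\<chi> j. if j = i then - v $ j else v $ j) \<bullet> (\<chi> j. if j = i then - w $ j else w $ j) = v \<bullet> w" for v w :: "real^'n"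
    unfolding inner_vec_def by (intro sum.cong) auto
qed

lemma compact_support_uniformly_continuous:
  fixes u :: "'a::euclidean_space \<Rightarrow> real"
  assumes cont: "continuous_on UNIV u" and K: "compact K" "\<And>x. x \<notin> K \<Longrightarrow> u x = 0" and e: "0 < e"
  obtains d where "0 < d" "\<And>x y. dist x y < d \<Longrightarrow> \<bar>u x - u y\<bar> < e"
proof -
  obtain R where "\<forall>x\<in>K. norm x \<le> R" using compact_imp_bounded[OF K(1)] unfolding bounded_iff by blast
  then have R: "K \<subseteq> cball 0 R" by auto
  have "uniformly_continuous_on (cball 0 (R + 1)) u"
    using cont by (intro compact_uniformly_continuous) (auto intro: continuous_on_subset)
  then obtain d where d: "0 < d" "\<And>x y. x \<in> cball 0 (R + 1) \<Longrightarrow> y \<in> cball 0 (R + 1) \<Longrightarrow> dist y x < d \<Longrightarrow> dist (u y) (u x) < e"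
    using e unfolding uniformly_continuous_on_def by meson
  show ?thesis
  proof (rule that[of "min d 1"])
    show "0 < min d 1" using d by simp
    fix x y :: 'a assume xy: "dist x y < min d 1"
    show "\<bar>u x - u y\<bar> < e"
    proof (cases "x \<in> K \<or> y \<in> K")
      case True
      have "norm x \<le> norm y + dist x y" "norm y \<le> norm x + dist x y"
        by (auto simp: dist_norm norm_triangle_sub norm_minus_commute) (metis norm_minus_commute norm_triangle_sub)
      then have "norm x \<le> R + 1 \<and> norm y \<le> R + 1" using True R xy by force
      then show ?thesis using d(2)[of y x] xy by (simp add: dist_real_def)
    next
      case False
      then show ?thesis using K(2) e by auto
    qed
  qed
qed

text \<open>A first-order Taylor estimate with one \<open>d\<close> for all points: compact support
  makes the partial derivatives uniformly continuous, and the mean value inequality bounds the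
  remainder.\<close>

lemma test_fun_linearization:
  fixes \<phi> :: "real^'n::finite \<Rightarrow> real"
  assumes \<phi>: "test_fun \<Omega> \<phi>" and e: "0 < e"
  obtains d where "0 < d"
    "\<And>x h. norm h < d \<Longrightarrow> \<bar>\<phi> (x - h) - \<phi> x + (\<Sum>j\<in>UNIV. h $ j * partial_deriv j \<phi> x)\<bar> \<le> e * norm h"
proof -
  obtain K where K: "compact K" "\<And>x i. x \<notin> K \<Longrightarrow> partial_deriv i \<phi> x = 0"
    using test_fun_support[OF \<phi>] by metis
  \<comment> \<open>Each of the n coordinates contributes at most e' times the norm of the vector to
    the operator norm of the difference of derivatives.\<close>
  define e' where "e' = e / real CARD('n)"
  have e': "0 < e'" using e by (simp add: e'_def)
  have "\<forall>j. \<exists>d>0. \<forall>x y. dist x y < d \<longrightarrow> \<bar>partial_deriv j \<phi> x - partial_deriv j \<phi> y\<bar> < e'"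
  proof
    fix j
    show "\<exists>d>0. \<forall>x y. dist x y < d \<longrightarrow> \<bar>partial_deriv j \<phi> x - partial_deriv j \<phi> y\<bar> < e'"
      by (rule compact_support_uniformly_continuous[OF partial_deriv_test_fun_continuous_on[OF \<phi>] K(1) K(2)[of _ j] e']) blast+
  qed
  then obtain D where D: "\<And>j. 0 < D j" "\<And>j x y. dist x y < D j \<Longrightarrow> \<bar>partial_deriv j \<phi> x - partial_deriv j \<phi> y\<bar> < e'"
    by metis
  define d where "d = Min (range D)"
  have d: "0 < d" "\<And>j. d \<le> D j" using D(1) by (auto simp: d_def)
  show ?thesis
  proof (rule that[OF d(1)])
    fix x h :: "real^'n" assume h: "norm h < d"
    let ?f' = "\<lambda>y h. \<Sum>j\<in>UNIV. h $ j * partial_deriv j \<phi> y"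
    have "norm (\<phi> (x - h) - \<phi> x - ?f' x ((x - h) - x)) \<le> norm ((x - h) - x) * e"
    proof (rule differentiable_bound_linearization[where S="ball x d" and f'="?f'"])
      show "x + t *\<^sub>R ((x - h) - x) \<in> ball x d" if "t \<in> {0..1}" for t
      proof -
        have "norm (t *\<^sub>R h) \<le> norm h" using that by (simp add: mult_left_le_one_le)
        then show ?thesis using h by (simp add: dist_norm)
      qed
      show "(\<phi> has_derivative ?f' y) (at y within ball x d)" for y
        using test_fun_has_derivative[OF \<phi>] has_derivative_at_withinI by blast
      show "onorm (?f' y - ?f' x) \<le> e" if y: "y \<in> ball x d" for y
        unfolding fun_diff_def
      proof (rule onorm_le)
        fix v :: "real^'n"
        have "\<bar>?f' y v - ?f' x v\<bar> = \<bar>\<Sum>j\<in>UNIV. v $ j * (partial_deriv j \<phi> y - partial_deriv j \<phi> x)\<bar>"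
          by (simp add: sum_subtractf right_diff_distrib)
        also have "\<dots> \<le> (\<Sum>j\<in>(UNIV::'n set). norm v * e')"
        proof (rule order_trans[OF sum_abs], rule sum_mono)
          fix j :: 'n
          have "dist y x < D j" using y d(2)[of j] by (simp add: dist_commute)
          then have "\<bar>partial_deriv j \<phi> y - partial_deriv j \<phi> x\<bar> \<le> e'" using D(2)[of y x j] by simp
          then show "\<bar>v $ j * (partial_deriv j \<phi> y - partial_deriv j \<phi> x)\<bar> \<le> norm v * e'"
            by (simp add: abs_mult component_le_norm_cart mult_mono)
        qed
        also have "\<dots> = e * norm v" by (simp add: e'_def)
        finally show "norm (?f' y v - ?f' x v) \<le> e * norm v" by simp
      qed
    qed (use d in auto)
    then show "\<bar>\<phi> (x - h) - \<phi> x + (\<Sum>j\<in>UNIV. h $ j * partial_deriv j \<phi> x)\<bar> \<le> e * norm h"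
      by (simp add: sum_negf mult.commute)
  qed
qed

lemma norm_kernel_integral:
  fixes b r :: real
  assumes b: "0 < b" "b < 1" and r: "0 < r"
  shows "integrable lborel (\<lambda>h::real^'n::finite. indicator (ball 0 r) h * norm h powr (b - CARD('n)))"
    and "(LINT h|lborel. indicator (ball 0 r) (h::real^'n) * norm h powr (b - CARD('n))) =
      CARD('n) / b * r powr b * measure lborel (cball (0::real^'n) 1)"
proof -
  have nn: "(\<integral>\<^sup>+h. ennreal (indicator (ball 0 r) (h::real^'n) * norm h powr (b - CARD('n))) \<partial>lborel)
      = ennreal (CARD('n) / b * r powr b * measure lborel (cball (0::real^'n) 1))"
    unfolding nn_integral_norm_kernel[OF b r, symmetric]
    by (intro nn_integral_cong) (simp add: indicator_def)
  show "integrable lborel (\<lambda>h::real^'n. indicator (ball 0 r) h * norm h powr (b - CARD('n)))"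
    using nn by (intro integrableI_nonneg) (auto simp: less_top[symmetric])
  show "(LINT h|lborel. indicator (ball 0 r) (h::real^'n) * norm h powr (b - CARD('n))) =
      CARD('n) / b * r powr b * measure lborel (cball (0::real^'n) 1)"
    using nn b by (subst integral_eq_nn_integral) auto
qed

text \<open>Reflecting the coordinate \<open>i\<close> preserves the weight and changes the sign of
  h_i h_j for distinct indices, so only the diagonal survives, with a second moment as value.
  Integration against h_i |h|^(b - n - 2) thus extracts the i-th coefficient of a linear function of
  h.\<close>

lemma coordinate_kernel_integral:
  fixes b r :: real and i j :: "'n::finite"
  assumes b: "0 < b" "b < 1" and r: "0 < r"
  shows "integrable lborel (\<lambda>h::real^'n. indicator (ball 0 r) h * norm h powr (b - CARD('n) - 2) * h $ i * h $ j)"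
    and "(LINT h|lborel. indicator (ball 0 r) (h::real^'n) * norm h powr (b - CARD('n) - 2) * h $ i * h $ j) =
      (if i = j then CARD('n) / b * r powr b * enn2real (direction_moment i 2) else 0)"
proof -
  let ?k = "\<lambda>h::real^'n. indicator (ball 0 r) h * norm h powr (b - CARD('n) - 2) * h $ i * h $ j :: real"
  show "integrable lborel ?k"
  proof (rule Bochner_Integration.integrable_bound[OF norm_kernel_integral(1)[OF b r]])
    show "AE h::real^'n in lborel. norm (?k h) \<le> norm (indicator (ball 0 r) h * norm h powr (b - CARD('n)))"
    proof (rule AE_I2)
      fix h :: "real^'n"
      show "norm (?k h) \<le> norm (indicator (ball 0 r) h * norm h powr (b - CARD('n)))"
      proof (cases "h = 0")
        case False
        have "\<bar>h $ i\<bar> * \<bar>h $ j\<bar> \<le> norm h * norm h"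
          by (intro mult_mono component_le_norm_cart) auto
        then have "norm h powr (b - CARD('n) - 2) * (\<bar>h $ i\<bar> * \<bar>h $ j\<bar>) \<le> norm h powr (b - CARD('n) - 2) * (norm h powr 2)"
          by (intro mult_left_mono) (auto simp: power2_eq_square)
        also have "\<dots> = norm h powr (b - CARD('n))" using powr_add[of "norm h" "b - CARD('n) - 2" 2] by simp
        finally show ?thesis by (simp add: abs_mult indicator_def mult.assoc)
      qed simp
    qed
  qed measurable
  show "(LINT h|lborel. ?k h) = (if i = j then CARD('n) / b * r powr b * enn2real (direction_moment i 2) else 0)"
  proof (cases "i = j")
    case True
    have "(LINT h|lborel. ?k h) = enn2real (\<integral>\<^sup>+h. ennreal (?k h) \<partial>lborel)"
      using True by (intro integral_eq_nn_integral) (auto simp: mult.assoc)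
    also have "(\<integral>\<^sup>+h. ennreal (?k h) \<partial>lborel) = (\<integral>\<^sup>+h. ennreal (\<bar>(h::real^'n) $ i\<bar> powr 2 * norm h powr (b - CARD('n) - 2)) * indicator (ball 0 r) h \<partial>lborel)"
      using True by (intro nn_integral_cong) (auto simp: indicator_def power2_eq_square mult_ac)
    also have "\<dots> = ennreal (CARD('n) / b * r powr b) * direction_moment i 2"
      using b r by (intro nn_integral_component_kernel) auto
    finally show ?thesis using True b by (simp add: enn2real_mult)
  next
    case False
    define T where "T h = (\<chi> j. if j = i then - h $ j else h $ j)" for h :: "real^'n"
    have T: "orthogonal_transformation T" unfolding T_def[abs_def] by (rule orthogonal_coordinate_reflection)
    have "(LINT h|lborel. ?k (T h)) = (LINT h|lborel. ?k h)"
      by (rule integral_lborel_orthogonal[OF T]) measurable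
    moreover have "?k (T h) = - ?k h" for h
      using False orthogonal_transformation_norm[OF T, of h] by (simp add: T_def indicator_def)
    ultimately have "- (LINT h|lborel. ?k h) = (LINT h|lborel. ?k h)" by simp
    then show ?thesis using False by simp
  qed
qed

section \<open>Averaged difference quotients\<close>

locale bounded_energy_setting =
  fixes \<Omega> :: "(real^'n::finite) set" and \<rho> :: "real^'n \<Rightarrow> real"
    and f :: "real^'n \<Rightarrow> real" and p :: real
  assumes open_domain: "open \<Omega>" and bounded_domain: "bounded \<Omega>"
    and cont_radius: "continuous_on UNIV \<rho>"
    and radius_pos: "x \<in> \<Omega> \<Longrightarrow> 0 < \<rho> x"
    and f_int: "integrable lborel f"
    and p: "1 < p"
begin

lemma measurable_domain [measurable]: "\<Omega> \<in> sets borel" using open_domain by simp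

lemma measurable_radius [measurable]: "\<rho> \<in> borel_measurable borel"
  using cont_radius by (rule borel_measurable_continuous_onI)

lemma measurable_f [measurable]: "f \<in> borel_measurable borel" using f_int by auto

text \<open>Up to the truncations this is |h|^(b - n) times h_i / |h| times the difference quotient
  (f(x + h) - f(x)) / |h|: an average of difference quotients in which the factor h_i / |h| selects
  the i-th partial derivative, by \<open>coordinate_kernel_integral\<close>.\<close>

definition diff_kernel :: "'n \<Rightarrow> real \<Rightarrow> real \<Rightarrow> real^'n \<Rightarrow> real^'n \<Rightarrow> real" where
  "diff_kernel i b r x h = indicator \<Omega> x * indicator (ball 0 (\<rho> x)) h * indicator (ball 0 r) h *
     norm h powr (b - CARD('n) - 2) * h $ i * (f (x + h) - f x)"

lemma measurable_diff_kernel [measurable]: "case_prod (diff_kernel i b r) \<in> borel_measurable (borel \<Otimes>\<^sub>M borel)"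
  unfolding diff_kernel_def by measurable

lemma abs_diff_kernel_le:
  assumes "norm h \<noteq> 0"
  shows "\<bar>diff_kernel i b r x h\<bar> \<le> indicator \<Omega> x * indicator (ball 0 (\<rho> x)) h * indicator (ball 0 r) h *
    norm h powr (b - CARD('n)) * (\<bar>f (x + h) - f x\<bar> / norm h)"
proof -
  have "norm h powr (b - CARD('n) - 2) * \<bar>h $ i\<bar> \<le> norm h powr (b - CARD('n) - 2) * norm h"
    by (intro mult_left_mono component_le_norm_cart) auto
  moreover have "norm h powr (b - CARD('n) - 2) = norm h powr (b - CARD('n)) / (norm h * norm h)"
    using assms by (simp add: powr_diff power2_eq_square)
  then have "norm h powr (b - CARD('n) - 2) * norm h = norm h powr (b - CARD('n)) / norm h"
    using assms by simp
  ultimately have "norm h powr (b - CARD('n) - 2) * \<bar>h $ i\<bar> \<le> norm h powr (b - CARD('n)) / norm h"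
    by simp
  then have "norm h powr (b - CARD('n) - 2) * \<bar>h $ i\<bar> * \<bar>f (x + h) - f x\<bar> \<le> norm h powr (b - CARD('n)) / norm h * \<bar>f (x + h) - f x\<bar>"
    by (intro mult_right_mono) auto
  then show ?thesis by (auto simp: diff_kernel_def abs_mult indicator_def mult.assoc)
qed

text \<open>The difference quotient is at most 1 plus its p-th power. The constant contributes the
  integrable weight |h|^(b - n) over a bounded set, the p-th power contributes the energy.\<close>

lemma integrable_diff_kernel:
  assumes b: "0 < b" "b < 1" and r: "0 < r" and fin: "ball_energy \<Omega> \<rho> f p b < \<infinity>"
  shows "integrable (lborel \<Otimes>\<^sub>M lborel) (\<lambda>(x, h). diff_kernel i b r x h)"
proof (rule integrable_lborel_pairI)
  show "(\<lambda>(x, h). diff_kernel i b r x h) \<in> borel_measurable (lborel \<Otimes>\<^sub>M lborel)" by measurable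
  have "(\<integral>\<^sup>+x. \<integral>\<^sup>+h. ennreal \<bar>diff_kernel i b r x h\<bar> \<partial>lborel \<partial>lborel) \<le>
    (\<integral>\<^sup>+x. \<integral>\<^sup>+h. indicator \<Omega> x * (ennreal (norm h powr (b - CARD('n))) * indicator (ball 0 r) h)
      + indicator \<Omega> x * indicator (ball 0 (\<rho> x)) h * ennreal (\<bar>f (x + h) - f x\<bar> powr p * norm h powr (b - CARD('n) - p)) \<partial>lborel \<partial>lborel)"
  proof (rule nn_integral_mono, rule nn_integral_mono_AE)
    fix x
    show "AE h in lborel. ennreal \<bar>diff_kernel i b r x h\<bar> \<le> indicator \<Omega> x * (ennreal (norm h powr (b - CARD('n))) * indicator (ball 0 r) h)
      + indicator \<Omega> x * indicator (ball 0 (\<rho> x)) h * ennreal (\<bar>f (x + h) - f x\<bar> powr p * norm h powr (b - CARD('n) - p))"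
      using AE_lborel_singleton[of "0::real^'n"]
    proof eventually_elim
      case (elim h)
      then have h: "norm h \<noteq> 0" by simp
      define q where "q = \<bar>f (x + h) - f x\<bar> / norm h"
      have q0: "0 \<le> q" by (simp add: q_def)
      have "norm h powr (b - CARD('n)) * q \<le> norm h powr (b - CARD('n)) * (1 + q powr p)"
        using abs_le_1_plus_powr[OF p, of q] q0 by (intro mult_left_mono) auto
      also have "\<dots> = norm h powr (b - CARD('n)) + \<bar>f (x + h) - f x\<bar> powr p * norm h powr (b - CARD('n) - p)"
        using h by (simp add: q_def powr_divide powr_diff[of _ "b - CARD('n)" p] distrib_left)
      finally have le: "norm h powr (b - CARD('n)) * q \<le> \<dots>" .
      show ?case
      proof (cases "x \<in> \<Omega> \<and> norm h < \<rho> x \<and> norm h < r")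
        case True
        have "ennreal \<bar>diff_kernel i b r x h\<bar> \<le> ennreal (norm h powr (b - CARD('n)) + \<bar>f (x + h) - f x\<bar> powr p * norm h powr (b - CARD('n) - p))"
          using abs_diff_kernel_le[OF h, of i b r x] le True by (intro ennreal_leI) (auto simp: q_def)
        then show ?thesis using True by (simp add: ennreal_plus)
      next
        case False
        then have "diff_kernel i b r x h = 0" by (auto simp: diff_kernel_def indicator_def)
        then show ?thesis by simp
      qed
    qed
  qed
  also have "\<dots> = (\<integral>\<^sup>+x. indicator \<Omega> x * (\<integral>\<^sup>+h. ennreal (norm h powr (b - CARD('n))) * indicator (ball (0::real^'n) r) h \<partial>lborel) \<partial>lborel)
     + ball_energy \<Omega> \<rho> f p b"
    unfolding ball_energy_def
    by (subst nn_integral_add[symmetric]) (auto simp: nn_integral_add nn_integral_cmult indicator_def)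
  also have "\<dots> < \<infinity>"
  proof -
    have "emeasure lborel \<Omega> < \<infinity>" using emeasure_bounded_finite[OF bounded_domain] .
    then show ?thesis using fin
      by (simp add: nn_integral_norm_kernel[OF b r] nn_integral_multc ennreal_mult_less_top)
  qed
  finally show "(\<integral>\<^sup>+x. \<integral>\<^sup>+h. ennreal \<bar>case (x, h) of (x, h) \<Rightarrow> diff_kernel i b r x h\<bar> \<partial>lborel \<partial>lborel) < \<infinity>"
    by simp
qed

text \<open>Jensen's inequality for the measure with density A |h|^(b - n) on the ball of radius
  \<open>r\<close>, whose total mass is the base of the power p - 1. The factor h_i / |h| is at most
  1 in absolute value, and the p-th power of the quotient reproduces the kernel of the
  energy.\<close>

lemma powr_integral_diff_kernel_le:
  assumes b: "0 < b" "b < 1" and r: "0 < r" and fin: "ball_energy \<Omega> \<rho> f p b < \<infinity>" and A: "0 \<le> A"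
  shows "(\<integral>\<^sup>+x. ennreal (\<bar>A * (LINT h|lborel. diff_kernel i b r x h)\<bar> powr p) \<partial>lborel) \<le>
    ennreal ((A * (CARD('n) / b * r powr b * measure lborel (cball (0::real^'n) 1))) powr (p - 1) * A) * ball_energy \<Omega> \<rho> f p b"
proof -
  define \<kappa> where "\<kappa> h = A * (indicator (ball 0 r) h * norm h powr (b - CARD('n)))" for h :: "real^'n"
  have [measurable]: "\<kappa> \<in> borel_measurable borel" unfolding \<kappa>_def by measurable
  have \<kappa>0: "0 \<le> \<kappa> h" for h using A by (simp add: \<kappa>_def)
  have \<kappa>_int: "integrable lborel \<kappa>"
    unfolding \<kappa>_def[abs_def] by (intro integrable_mult_right norm_kernel_integral[OF b r])
  define \<Theta> where "\<Theta> = A * (CARD('n) / b * r powr b * measure lborel (cball (0::real^'n) 1))"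
  have \<kappa>_tot: "(LINT h|lborel. \<kappa> h) = \<Theta>"
    unfolding \<kappa>_def \<Theta>_def using norm_kernel_integral[OF b r, where 'n='n] by simp
  define N where "N = density lborel (\<lambda>h. ennreal (\<kappa> h))"
  have eN: "emeasure N (space N) = ennreal \<Theta>"
    unfolding N_def using \<kappa>_int \<kappa>0 by (simp add: emeasure_density nn_integral_eq_integral \<kappa>_tot)
  interpret N: finite_measure N by (rule finite_measureI, unfold eN, simp)
  have \<Theta>0: "0 \<le> \<Theta>" unfolding \<kappa>_tot[symmetric] using \<kappa>0 by (intro Bochner_Integration.integral_nonneg)
  have mN: "measure N (space N) = \<Theta>" using eN \<Theta>0 by (simp add: measure_def)
  define Q where "Q x h = indicator \<Omega> x * indicator (ball 0 (\<rho> x)) h * (h $ i * (f (x + h) - f x) / (norm h * norm h))" for x h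
  have [measurable]: "case_prod Q \<in> borel_measurable (borel \<Otimes>\<^sub>M borel)" unfolding Q_def by measurable
  have \<kappa>Q: "\<kappa> h * Q x h = A * diff_kernel i b r x h" for x h
  proof (cases "h = 0")
    case False
    have "norm h powr (b - CARD('n) - 2) = norm h powr (b - CARD('n)) / (norm h * norm h)"
      using False by (simp add: powr_diff power2_eq_square)
    then show ?thesis by (simp add: \<kappa>_def Q_def diff_kernel_def)
  qed (simp add: Q_def diff_kernel_def)
  have "(\<integral>\<^sup>+x. ennreal (\<bar>A * (LINT h|lborel. diff_kernel i b r x h)\<bar> powr p) \<partial>lborel) \<le>
    (\<integral>\<^sup>+x. ennreal (\<Theta> powr (p - 1) * A) * (\<integral>\<^sup>+h. indicator \<Omega> x * indicator (ball 0 (\<rho> x)) h *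
      ennreal (\<bar>f (x + h) - f x\<bar> powr p * norm h powr (b - CARD('n) - p)) \<partial>lborel) \<partial>lborel)"
  proof (rule nn_integral_mono_AE)
    show "AE x in lborel. ennreal (\<bar>A * (LINT h|lborel. diff_kernel i b r x h)\<bar> powr p) \<le>
      ennreal (\<Theta> powr (p - 1) * A) * (\<integral>\<^sup>+h. indicator \<Omega> x * indicator (ball 0 (\<rho> x)) h *
      ennreal (\<bar>f (x + h) - f x\<bar> powr p * norm h powr (b - CARD('n) - p)) \<partial>lborel)"
      using lborel_pair.AE_integrable_fst'[OF integrable_diff_kernel[OF b r fin, of i]]
    proof eventually_elim
      case (elim x)
      have iQ: "integrable N (Q x)"
        unfolding N_def using elim \<kappa>0 by (subst integrable_density) (auto simp: \<kappa>Q)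
      have LQ: "(LINT h|N. Q x h) = A * (LINT h|lborel. diff_kernel i b r x h)"
        unfolding N_def using \<kappa>0 by (subst integral_density) (auto simp: \<kappa>Q)
      have "ennreal (\<bar>LINT h|N. Q x h\<bar> powr p) \<le> ennreal (\<Theta> powr (p - 1)) * (\<integral>\<^sup>+h. ennreal (\<bar>Q x h\<bar> powr p) \<partial>N)"
        using N.jensen_powr[OF p iQ] by (simp only: mN)
      also have "(\<integral>\<^sup>+h. ennreal (\<bar>Q x h\<bar> powr p) \<partial>N) = (\<integral>\<^sup>+h. ennreal (\<kappa> h) * ennreal (\<bar>Q x h\<bar> powr p) \<partial>lborel)"
        unfolding N_def by (rule nn_integral_density) measurable
      also have "\<dots> \<le> (\<integral>\<^sup>+h. ennreal A * (indicator \<Omega> x * indicator (ball 0 (\<rho> x)) h *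
          ennreal (\<bar>f (x + h) - f x\<bar> powr p * norm h powr (b - CARD('n) - p))) \<partial>lborel)"
      proof (rule nn_integral_mono_AE)
        show "AE h in lborel. ennreal (\<kappa> h) * ennreal (\<bar>Q x h\<bar> powr p) \<le> ennreal A * (indicator \<Omega> x * indicator (ball 0 (\<rho> x)) h *
          ennreal (\<bar>f (x + h) - f x\<bar> powr p * norm h powr (b - CARD('n) - p)))"
          using AE_lborel_singleton[of "0::real^'n"]
        proof eventually_elim
          case (elim h)
          then have h: "norm h \<noteq> 0" by simp
          show ?case
          proof (cases "x \<in> \<Omega> \<and> norm h < \<rho> x \<and> norm h < r")
            case True
            have "\<bar>Q x h\<bar> = \<bar>h $ i\<bar> * \<bar>f (x + h) - f x\<bar> / (norm h * norm h)"
              using True by (simp add: Q_def abs_mult abs_divide)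
            also have "\<dots> \<le> norm h * \<bar>f (x + h) - f x\<bar> / (norm h * norm h)"
              by (intro divide_right_mono mult_right_mono component_le_norm_cart) auto
            also have "\<dots> = \<bar>f (x + h) - f x\<bar> / norm h" using h by simp
            finally have "\<bar>Q x h\<bar> powr p \<le> (\<bar>f (x + h) - f x\<bar> / norm h) powr p" using p by (intro powr_mono2) auto
            then have "\<kappa> h * \<bar>Q x h\<bar> powr p \<le> \<kappa> h * (\<bar>f (x + h) - f x\<bar> / norm h) powr p"
              using \<kappa>0 by (intro mult_left_mono) auto
            also have "\<dots> = A * (\<bar>f (x + h) - f x\<bar> powr p * norm h powr (b - CARD('n) - p))"
              using True h by (simp add: \<kappa>_def powr_divide powr_diff[of _ "b - CARD('n)" p])
            finally show ?thesis using True A \<kappa>0 by (simp add: ennreal_leI flip: ennreal_mult)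
          next
            case False
            then have "\<kappa> h * \<bar>Q x h\<bar> powr p = 0" using p by (auto simp: \<kappa>_def Q_def indicator_def)
            moreover have "ennreal (\<kappa> h) * ennreal (\<bar>Q x h\<bar> powr p) = ennreal (\<kappa> h * \<bar>Q x h\<bar> powr p)"
              using \<kappa>0 by (simp add: ennreal_mult)
            ultimately show ?thesis by (simp only: ennreal_0 zero_le)
          qed
        qed
      qed
      also have "\<dots> = ennreal A * (\<integral>\<^sup>+h. indicator \<Omega> x * indicator (ball 0 (\<rho> x)) h *
          ennreal (\<bar>f (x + h) - f x\<bar> powr p * norm h powr (b - CARD('n) - p)) \<partial>lborel)"
        by (rule nn_integral_cmult) (simp add: indicator_def)
      finally show ?case using A
        by (simp add: LQ ennreal_mult mult.assoc mult_left_mono)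
    qed
  qed
  also have "\<dots> = ennreal (\<Theta> powr (p - 1) * A) * ball_energy \<Omega> \<rho> f p b"
    unfolding ball_energy_def by (rule nn_integral_cmult) (simp add: indicator_def)
  finally show ?thesis by (simp only: \<Theta>_def)
qed

end

context bounded_energy_setting
begin

text \<open>A discrete integration by parts: for each h the difference moves from \<open>f\<close>
  to \<open>\<phi>\<close>, and by the symmetry of the kernel the linear part of
  \<open>\<phi>\<close>(x - h) - \<open>\<phi>\<close>(x) leaves only the i-th derivative. The
  remainder is at most w |h|, and the extra |h| turns the kernel into at most |h|^(b - n).\<close>

lemma integral_diff_kernel_test_fun:
  fixes i :: 'n
  assumes b: "0 < b" "b < 1" and r: "0 < r" and fin: "ball_energy \<Omega> \<rho> f p b < \<infinity>"
    and \<phi>: "test_fun \<Omega> \<phi>" and rK: "\<And>x. \<phi> x \<noteq> 0 \<Longrightarrow> r < \<rho> x"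
    and w: "0 \<le> w" and lin: "\<And>x h. norm h < r \<Longrightarrow> \<bar>\<phi> (x - h) - \<phi> x + (\<Sum>j\<in>UNIV. h $ j * partial_deriv j \<phi> x)\<bar> \<le> w * norm h"
  shows "\<bar>(LINT x|lborel. (LINT h|lborel. diff_kernel i b r x h) * \<phi> x) +
      (CARD('n) / b * r powr b * enn2real (direction_moment i 2)) * (LINT x|lborel. f x * partial_deriv i \<phi> x)\<bar>
    \<le> w * (LINT x|lborel. \<bar>f x\<bar>) * (CARD('n) / b * r powr b * measure lborel (cball (0::real^'n) 1))"
proof -
  obtain B where B: "B > 0" "\<And>x. \<bar>\<phi> x\<bar> \<le> B" "\<And>x j. \<bar>partial_deriv j \<phi> x\<bar> \<le> B"
    using test_fun_bounded[OF \<phi>] by metis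
  have [measurable]: "\<phi> \<in> borel_measurable borel" by (rule test_fun_measurable[OF \<phi>])
  have [measurable]: "partial_deriv j \<phi> \<in> borel_measurable borel" for j by (rule partial_deriv_test_fun_measurable[OF \<phi>])
  have fmult: "integrable lborel (\<lambda>x. u x * \<psi> x)"
    if "integrable lborel u" "\<psi> \<in> borel_measurable borel" "\<And>x. \<bar>\<psi> x\<bar> \<le> B" for u \<psi> :: "real^'n \<Rightarrow> real"
  proof (rule Bochner_Integration.integrable_bound[where f="\<lambda>x. B * u x"])
    show "AE x in lborel. norm (u x * \<psi> x) \<le> norm (B * u x)"
      using that(3) B(1) by (intro AE_I2) (auto simp: abs_mult mult.commute[of "\<bar>u _\<bar>"] intro!: mult_right_mono)
  qed (use that in auto)
  have dom: "x \<in> \<Omega>" if "\<phi> x \<noteq> 0" for x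
  proof -
    obtain K where "K \<subseteq> \<Omega>" "\<And>x. x \<notin> K \<Longrightarrow> \<phi> x = 0"
      using test_fun_support[OF \<phi>] by metis
    then show ?thesis using that by (cases "x \<in> K") auto
  qed
  define kern where "kern h = indicator (ball 0 r) h * norm h powr (b - CARD('n) - 2) * h $ i" for h :: "real^'n"
  have [measurable]: "kern \<in> borel_measurable borel" unfolding kern_def by measurable
  define I where "I h = (LINT x|lborel. f x * (\<phi> (x - h) - \<phi> x))" for h
  have [measurable]: "I \<in> borel_measurable borel"
    unfolding I_def by (rule lborel.borel_measurable_lebesgue_integral) measurable
  define F where "F j = (LINT x|lborel. f x * partial_deriv j \<phi> x)" for j
  define err where "err h = I h + (\<Sum>j\<in>UNIV. h $ j * F j)" for h
  have [measurable]: "err \<in> borel_measurable borel" unfolding err_def by measurable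
  have i1: "integrable lborel (\<lambda>x. f x * \<phi> (x - h))" for h
    using B by (intro fmult f_int) auto
  have i2: "integrable lborel (\<lambda>x. f x * \<phi> x)" using B by (intro fmult f_int) auto
  have i3: "integrable lborel (\<lambda>x. f x * partial_deriv j \<phi> x)" for j using B by (intro fmult f_int) auto
  \<comment> \<open>Where \<open>\<phi>\<close> is nonzero, r < \<open>\<rho> x\<close>; hence for
    |h| < r the truncation at \<open>\<rho> x\<close> has no effect and the kernel splits off as a
    function of h.\<close>
  have slice: "(LINT x|lborel. diff_kernel i b r x h * \<phi> x) = kern h * I h" for h
  proof (cases "norm h < r")
    case False
    then show ?thesis by (simp add: diff_kernel_def kern_def)
  next
    case True
    have "diff_kernel i b r x h * \<phi> x = kern h * (f (x + h) * \<phi> x - f x * \<phi> x)" for x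
      using True dom[of x] rK[of x] by (cases "\<phi> x = 0") (auto simp: diff_kernel_def kern_def left_diff_distrib)
    then have "(LINT x|lborel. diff_kernel i b r x h * \<phi> x) = kern h * (LINT x|lborel. f (x + h) * \<phi> x - f x * \<phi> x)"
      by simp
    also have "(LINT x|lborel. f (x + h) * \<phi> x - f x * \<phi> x) = (LINT x|lborel. f (x + h) * \<phi> x) - (LINT x|lborel. f x * \<phi> x)"
      using B(2) by (intro Bochner_Integration.integral_diff i2 fmult integrable_lborel_translate f_int) auto
    also have "(LINT x|lborel. f (x + h) * \<phi> x) = (LINT x|lborel. f x * \<phi> (x - h))"
      using integral_lborel_translate[of "\<lambda>x. f x * \<phi> (x - h)" h] by simp
    also have "(LINT x|lborel. f x * \<phi> (x - h)) - (LINT x|lborel. f x * \<phi> x) = I h"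
      unfolding I_def using i1[of h] i2 by (simp add: right_diff_distrib)
    finally show ?thesis .
  qed
  have dk_int: "integrable (lborel \<Otimes>\<^sub>M lborel) (\<lambda>(x, h). diff_kernel i b r x h * \<phi> x)"
  proof (rule Bochner_Integration.integrable_bound[where f="\<lambda>z. B * (case z of (x, h) \<Rightarrow> diff_kernel i b r x h)"])
    show "integrable (lborel \<Otimes>\<^sub>M lborel) (\<lambda>z. B * (case z of (x, h) \<Rightarrow> diff_kernel i b r x h))"
      by (rule integrable_mult_right) (rule integrable_diff_kernel[OF b r fin])
    show "AE z in lborel \<Otimes>\<^sub>M lborel. norm (case z of (x, h) \<Rightarrow> diff_kernel i b r x h * \<phi> x) \<le> norm (B * (case z of (x, h) \<Rightarrow> diff_kernel i b r x h))"
      using B by (intro AE_I2) (auto simp: abs_mult mult.commute[of _ "\<bar>\<phi> _\<bar>"] intro!: mult_right_mono)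
  qed measurable
  have "(LINT x|lborel. (LINT h|lborel. diff_kernel i b r x h) * \<phi> x) = (LINT x|lborel. LINT h|lborel. diff_kernel i b r x h * \<phi> x)"
    by simp
  also have "\<dots> = (LINT h|lborel. LINT x|lborel. diff_kernel i b r x h * \<phi> x)"
    by (rule lborel_pair.Fubini_integral[symmetric]) (rule dk_int)
  also have "\<dots> = (LINT h|lborel. kern h * I h)" by (simp only: slice)
  finally have lhs: "(LINT x|lborel. (LINT h|lborel. diff_kernel i b r x h) * \<phi> x) = (LINT h|lborel. kern h * I h)" .
  have err_le: "\<bar>err h\<bar> \<le> w * norm h * (LINT x|lborel. \<bar>f x\<bar>)" if h: "norm h < r" for h
  proof -
    have ii: "integrable lborel (\<lambda>x. f x * (\<phi> (x - h) - \<phi> x))"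
      using i1[of h] i2 by (simp add: right_diff_distrib)
    have ij: "integrable lborel (\<lambda>x. \<Sum>j\<in>UNIV. h $ j * (f x * partial_deriv j \<phi> x))"
      using i3 by (intro Bochner_Integration.integrable_sum integrable_mult_right)
    have sumF: "(\<Sum>j\<in>UNIV. h $ j * F j) = (LINT x|lborel. (\<Sum>j\<in>UNIV. h $ j * (f x * partial_deriv j \<phi> x)))"
      unfolding F_def using i3 by (subst Bochner_Integration.integral_sum) auto
    have "err h = (LINT x|lborel. f x * (\<phi> (x - h) - \<phi> x) + (\<Sum>j\<in>UNIV. h $ j * (f x * partial_deriv j \<phi> x)))"
      unfolding err_def I_def sumF using ii ij by simp
    also have "\<bar>\<dots>\<bar> \<le> (LINT x|lborel. (w * norm h) * \<bar>f x\<bar>)"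
    proof (rule integral_abs_bound_integral)
      show "integrable lborel (\<lambda>x. f x * (\<phi> (x - h) - \<phi> x) + (\<Sum>j\<in>UNIV. h $ j * (f x * partial_deriv j \<phi> x)))"
        using ii ij by simp
      show "integrable lborel (\<lambda>x. (w * norm h) * \<bar>f x\<bar>)" using f_int by simp
      fix x
      have "f x * (\<phi> (x - h) - \<phi> x) + (\<Sum>j\<in>UNIV. h $ j * (f x * partial_deriv j \<phi> x))
        = f x * (\<phi> (x - h) - \<phi> x + (\<Sum>j\<in>UNIV. h $ j * partial_deriv j \<phi> x))"
        by (simp add: distrib_left sum_distrib_left mult.left_commute)
      then show "\<bar>f x * (\<phi> (x - h) - \<phi> x) + (\<Sum>j\<in>UNIV. h $ j * (f x * partial_deriv j \<phi> x))\<bar> \<le> (w * norm h) * \<bar>f x\<bar>"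
        using mult_left_mono[OF lin[OF h, of x], of "\<bar>f x\<bar>"] by (simp add: abs_mult mult.commute)
    qed
    finally show ?thesis by simp
  qed
  define L where "L = (LINT x|lborel. \<bar>f x\<bar>)"
  have L0: "0 \<le> L" unfolding L_def by (rule Bochner_Integration.integral_nonneg) simp
  define G where "G h = (w * L) * (indicator (ball 0 r) h * norm h powr (b - CARD('n)))" for h :: "real^'n"
  have G_int: "integrable lborel G"
    unfolding G_def[abs_def] by (intro integrable_mult_right norm_kernel_integral[OF b r])
  have kern_le: "\<bar>kern h\<bar> * norm h \<le> indicator (ball 0 r) h * norm h powr (b - CARD('n))" for h
  proof (cases "h = 0")
    case False
    have "\<bar>kern h\<bar> * norm h = indicator (ball 0 r) h * norm h powr (b - CARD('n) - 2) * (\<bar>h $ i\<bar> * norm h)"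
      by (simp add: kern_def abs_mult)
    also have "\<dots> \<le> indicator (ball 0 r) h * norm h powr (b - CARD('n) - 2) * (norm h * norm h)"
      by (intro mult_left_mono mult_right_mono component_le_norm_cart) auto
    also have "\<dots> = indicator (ball 0 r) h * norm h powr (b - CARD('n))"
      using False powr_add[of "norm h" "b - CARD('n) - 2" 2] by (simp add: power2_eq_square)
    finally show ?thesis .
  qed simp
  have ke_le: "\<bar>kern h * err h\<bar> \<le> G h" for h
  proof (cases "norm h < r")
    case True
    have "\<bar>kern h * err h\<bar> \<le> \<bar>kern h\<bar> * (w * norm h * L)"
      unfolding abs_mult using err_le[OF True] by (intro mult_left_mono) (auto simp: L_def)
    also have "\<dots> = (w * L) * (\<bar>kern h\<bar> * norm h)" by (simp add: mult_ac)
    also have "\<dots> \<le> G h" unfolding G_def using kern_le w L0 by (intro mult_left_mono) auto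
    finally show ?thesis .
  qed (simp add: kern_def G_def)
  have ke_int: "integrable lborel (\<lambda>h. kern h * err h)"
    by (rule Bochner_Integration.integrable_bound[OF G_int]) (use ke_le in \<open>auto intro!: AE_I2 order_trans[OF ke_le abs_ge_self]\<close>)
  have kj_int: "integrable lborel (\<lambda>h. F j * (kern h * h $ j))" for j
    unfolding kern_def by (intro integrable_mult_right coordinate_kernel_integral(1)[OF b r])
  have kj: "(LINT h|lborel. kern h * h $ j) = (if i = j then CARD('n) / b * r powr b * enn2real (direction_moment i 2) else 0)" for j
    unfolding kern_def by (rule coordinate_kernel_integral(2)[OF b r])
  have "(LINT h|lborel. kern h * I h) = (LINT h|lborel. kern h * err h - (\<Sum>j\<in>UNIV. F j * (kern h * h $ j)))"
    by (intro Bochner_Integration.integral_cong) (auto simp: err_def distrib_left sum_distrib_left mult_ac)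
  also have "\<dots> = (LINT h|lborel. kern h * err h) - (\<Sum>j\<in>UNIV. LINT h|lborel. F j * (kern h * h $ j))"
    using ke_int kj_int by (subst Bochner_Integration.integral_diff) (auto intro!: Bochner_Integration.integral_sum)
  also have "(\<Sum>j\<in>UNIV. LINT h|lborel. F j * (kern h * h $ j)) = (\<Sum>j\<in>UNIV. if i = j then F j * (CARD('n) / b * r powr b * enn2real (direction_moment i 2)) else 0)"
    by (intro sum.cong) (auto simp: kj)
  also have "\<dots> = F i * (CARD('n) / b * r powr b * enn2real (direction_moment i 2))"
    by simp
  finally have "(LINT h|lborel. kern h * I h) + (CARD('n) / b * r powr b * enn2real (direction_moment i 2)) * F i = (LINT h|lborel. kern h * err h)"
    by (simp add: mult.commute)
  moreover have "\<bar>LINT h|lborel. kern h * err h\<bar> \<le> (LINT h|lborel. G h)"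
    by (rule integral_abs_bound_integral[OF ke_int G_int ke_le])
  moreover have "(LINT h|lborel. G h) = w * L * (CARD('n) / b * r powr b * measure lborel (cball (0::real^'n) 1))"
    unfolding G_def using norm_kernel_integral(2)[OF b r, where 'n='n] by simp
  ultimately show ?thesis by (simp add: lhs F_def L_def)
qed

text \<open>The radii \<open>r k = exp (- 1 / sqrt (b k))\<close> shrink, yet so slowly that \<open>r k powr b k\<close> stays away
  from 0: at these scales the averaged difference quotients have bounded \<open>L\<^sup>p\<close> norms and
  tend weakly to the partial derivative.\<close>

theorem weak_partial_deriv_of_bounded_energy:
  fixes i :: 'n and b :: "nat \<Rightarrow> real"
  assumes b: "\<And>k. 0 < b k" "\<And>k. b k < 1" "b \<longlonglongrightarrow> 0" and M: "0 \<le> M"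
    and bd: "\<And>k. ennreal (b k) * ball_energy \<Omega> \<rho> f p (b k) \<le> ennreal M"
  obtains u where "integrable lborel u"
    "\<And>\<phi>. test_fun \<Omega> \<phi> \<Longrightarrow> (LINT x|lborel. f x * partial_deriv i \<phi> x) = - (LINT x|lborel. u x * \<phi> x)"
proof -
  define n where "n = real CARD('n)"
  have n: "0 < n" by (simp add: n_def)
  define V where "V = measure lborel (cball (0::real^'n) 1)"
  have V: "0 \<le> V" by (simp add: V_def)
  define \<kappa> where "\<kappa> = enn2real (direction_moment i 2)"
  have \<kappa>: "0 < \<kappa>"
    using direction_moment_pos[of i 2] direction_moment_finite[of 2 i] by (simp add: \<kappa>_def enn2real_positive_iff)
  define r where "r k = exp (- (1 / sqrt (b k)))" for k
  have r: "0 < r k" for k by (simp add: r_def)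
  \<comment> \<open>Here r^b = exp(- sqrt b), which is at least 1 / e because b < 1.\<close>
  have rb: "exp (- 1) \<le> r k powr b k" for k
  proof -
    have "r k powr b k = exp (- (b k / sqrt (b k)))" by (simp add: r_def powr_def)
    also have "b k / sqrt (b k) = sqrt (b k)" using b(1)[of k] by (simp add: real_div_sqrt)
    finally show ?thesis using b(1,2)[of k] by simp
  qed
  have r0: "r \<longlonglongrightarrow> 0"
  proof -
    have "(\<lambda>k. sqrt (b k)) \<longlonglongrightarrow> sqrt 0" by (intro tendsto_intros b)
    moreover have "b k \<noteq> 0" for k using b(1)[of k] by simp
    ultimately have "filterlim (\<lambda>k. sqrt (b k)) (at_right 0) sequentially"
      using b(1) by (auto simp: filterlim_at intro!: always_eventually)
    then have "filterlim (\<lambda>k. inverse (sqrt (b k))) at_top sequentially"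
      by (rule filterlim_compose[OF filterlim_inverse_at_top_right])
    then have "filterlim (\<lambda>k. - inverse (sqrt (b k))) at_bot sequentially"
      by (simp add: filterlim_uminus_at_top)
    from filterlim_compose[OF exp_at_bot this] show ?thesis by (simp add: r_def[abs_def] inverse_eq_divide)
  qed
  \<comment> \<open>Normalises the second moment (n / b) r^b \<open>\<kappa>\<close> of the kernel
    to 1, so that the averages approximate the partial derivative itself. Since r^b is bounded
    below, \<open>A k\<close> is at most a multiple of \<open>b k\<close>, and the hypothesis bounds
    \<open>b k\<close> times the energy.\<close>
  define A where "A k = b k / (n * \<kappa> * (r k powr b k))" for k
  have A: "0 < A k" for k using b(1)[of k] n \<kappa> r[of k] by (simp add: A_def)
  have A1: "A k * (n / b k * r k powr b k * c) = c / \<kappa>" for k c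
    using b(1)[of k] n \<kappa> r[of k] by (simp add: A_def)
  define v where "v k x = A k * (LINT h|lborel. diff_kernel i (b k) (r k) x h)" for k x
  have [measurable]: "v k \<in> borel_measurable borel" for k
    unfolding v_def by (intro borel_measurable_times borel_measurable_const lborel.borel_measurable_lebesgue_integral) measurable
  have fin: "ball_energy \<Omega> \<rho> f p (b k) < \<infinity>" for k
  proof (rule ccontr)
    assume "\<not> ball_energy \<Omega> \<rho> f p (b k) < \<infinity>"
    then have "ball_energy \<Omega> \<rho> f p (b k) = \<infinity>" using top.not_eq_extremum[of "ball_energy \<Omega> \<rho> f p (b k)"] by auto
    then show False using bd[of k] b(1)[of k] by (simp add: ennreal_mult_top top_unique)
  qed
  define C where "C = (V / \<kappa>) powr (p - 1) / (n * \<kappa> * exp (- 1)) * M"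
  have C: "0 \<le> C" using n \<kappa> M by (simp add: C_def)
  have v_bd: "(\<integral>\<^sup>+x. ennreal (\<bar>v k x\<bar> powr p) \<partial>lborel) \<le> ennreal C" for k
  proof -
    have "(\<integral>\<^sup>+x. ennreal (\<bar>v k x\<bar> powr p) \<partial>lborel) \<le> ennreal ((V / \<kappa>) powr (p - 1) * A k) * ball_energy \<Omega> \<rho> f p (b k)"
      using powr_integral_diff_kernel_le[OF b(1)[of k] b(2)[of k] r[of k] fin[of k], where A="A k" and i=i] A[of k] A1[of k V]
      by (simp add: v_def n_def V_def)
    also have "(V / \<kappa>) powr (p - 1) * A k = ((V / \<kappa>) powr (p - 1) / (n * \<kappa> * (r k powr b k))) * b k"
      by (simp add: A_def)
    also have "ennreal \<dots> = ennreal ((V / \<kappa>) powr (p - 1) / (n * \<kappa> * (r k powr b k))) * ennreal (b k)"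
      using n \<kappa> b(1)[of k] by (intro ennreal_mult) auto
    also have "\<dots> * ball_energy \<Omega> \<rho> f p (b k) = ennreal ((V / \<kappa>) powr (p - 1) / (n * \<kappa> * (r k powr b k))) * (ennreal (b k) * ball_energy \<Omega> \<rho> f p (b k))"
      by (simp only: mult.assoc)
    also have "\<dots> \<le> ennreal ((V / \<kappa>) powr (p - 1) / (n * \<kappa> * exp (- 1))) * ennreal M"
      using bd[of k] rb[of k] n \<kappa> r[of k]
      by (intro mult_mono ennreal_leI divide_left_mono mult_left_mono mult_pos_pos) auto
    also have "\<dots> = ennreal C"
      unfolding C_def using M n \<kappa> by (intro ennreal_mult[symmetric]) auto
    finally show ?thesis .
  qed
  \<comment> \<open>Boundedness of \<open>\<Omega>\<close> makes this a finite measure, the setting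
    of the weak limit theorem.\<close>
  let ?R = "restrict_space lborel \<Omega>"
  have "emeasure ?R (space ?R) = emeasure lborel \<Omega>"
    by (subst emeasure_restrict_space) (auto simp: space_restrict_space)
  then interpret R: finite_measure ?R
    using emeasure_bounded_finite[OF bounded_domain] by (intro finite_measureI) auto
  have R_bd: "(\<integral>\<^sup>+x. ennreal (\<bar>v k x\<bar> powr p) \<partial>?R) \<le> ennreal C" for k
  proof -
    have "(\<integral>\<^sup>+x. ennreal (\<bar>v k x\<bar> powr p) \<partial>?R) = (\<integral>\<^sup>+x. ennreal (\<bar>v k x\<bar> powr p) * indicator \<Omega> x \<partial>lborel)"
      by (rule nn_integral_restrict_space) simp
    also have "\<dots> \<le> (\<integral>\<^sup>+x. ennreal (\<bar>v k x\<bar> powr p) \<partial>lborel)"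
      by (intro nn_integral_mono) (simp add: indicator_def)
    finally show ?thesis using v_bd order_trans by blast
  qed
  have R_meas: "v k \<in> borel_measurable ?R" for k by (rule measurable_restrict_space1) simp
  obtain u where u: "integrable ?R u"
    and lim: "\<And>\<phi> B T. \<phi> \<in> borel_measurable ?R \<Longrightarrow> (\<And>x. \<bar>\<phi> x\<bar> \<le> B) \<Longrightarrow> (\<lambda>k. LINT x|?R. v k x * \<phi> x) \<longlonglongrightarrow> T \<Longrightarrow>
      (LINT x|?R. u x * \<phi> x) = T"
    by (rule R.weak_limit_of_bounded_powr_integrals[where v=v, OF p R_meas R_bd C]) blast
  show ?thesis
  proof (rule that[of "\<lambda>x. indicator \<Omega> x * u x"])
    show "integrable lborel (\<lambda>x. indicator \<Omega> x * u x)"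
      using u by (simp add: integrable_restrict_space)
    fix \<phi> assume \<phi>: "test_fun \<Omega> \<phi>"
    have [measurable]: "\<phi> \<in> borel_measurable borel" by (rule test_fun_measurable[OF \<phi>])
    obtain B where B: "\<And>x. \<bar>\<phi> x\<bar> \<le> B" using test_fun_bounded[OF \<phi>] by metis
    obtain K where K: "compact K" "K \<subseteq> \<Omega>" "\<And>x. x \<notin> K \<Longrightarrow> \<phi> x = 0"
      using test_fun_support[OF \<phi>] by metis
    obtain s where s: "0 < s" "\<And>x. x \<in> K \<Longrightarrow> s < \<rho> x"
      by (rule compact_radius_gt[OF K(1) cont_radius]) (use K(2) radius_pos in auto)
    define L where "L = (LINT x|lborel. \<bar>f x\<bar>)"
    have L: "0 \<le> L" unfolding L_def by (rule Bochner_Integration.integral_nonneg) simp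
    define F where "F = (LINT x|lborel. f x * partial_deriv i \<phi> x)"
    have R_eq: "(LINT x|?R. w x * \<phi> x) = (LINT x|lborel. indicator \<Omega> x * w x * \<phi> x)" for w
      by (simp add: integral_restrict_space mult.assoc)
    have v_eq: "(LINT x|?R. v k x * \<phi> x) = (LINT x|lborel. v k x * \<phi> x)" for k
      unfolding R_eq by (intro Bochner_Integration.integral_cong) (auto simp: v_def diff_kernel_def indicator_def)
    have "(\<lambda>k. LINT x|?R. v k x * \<phi> x) \<longlonglongrightarrow> - F"
    proof (rule LIMSEQ_I)
      fix e :: real assume e: "0 < e"
      \<comment> \<open>After multiplication by \<open>A k\<close> the linearisation error is w L V
        / \<open>\<kappa>\<close>, so this choice keeps it below \<open>e\<close>; the summand 1
        makes the denominator positive.\<close>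
      define w where "w = e / (L * (V / \<kappa>) + 1)"
      have pos: "0 < L * (V / \<kappa>) + 1"
      proof -
        have "0 \<le> L * (V / \<kappa>)" using L V \<kappa> by simp
        then show ?thesis by linarith
      qed
      have w: "0 < w" using e pos by (simp add: w_def)
      obtain d where d: "0 < d" "\<And>x h. norm h < d \<Longrightarrow> \<bar>\<phi> (x - h) - \<phi> x + (\<Sum>j\<in>UNIV. h $ j * partial_deriv j \<phi> x)\<bar> \<le> w * norm h"
        by (rule test_fun_linearization[OF \<phi> w]) blast
      have "eventually (\<lambda>k. r k < min d s) sequentially"
        using r0 d(1) s(1) by (intro order_tendstoD(2)[of r 0]) auto
      then obtain m where m: "\<And>k. m \<le> k \<Longrightarrow> r k < min d s" by (auto simp: eventually_sequentially)
      show "\<exists>m. \<forall>k\<ge>m. norm ((LINT x|?R. v k x * \<phi> x) - - F) < e"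
      proof (intro exI allI impI)
        fix k assume "m \<le> k"
        then have rk: "r k < d" "r k < s" using m by auto
        define Z where "Z = (LINT x|lborel. (LINT h|lborel. diff_kernel i (b k) (r k) x h) * \<phi> x)"
        have "\<bar>Z + (n / b k * r k powr b k * \<kappa>) * F\<bar> \<le> w * L * (n / b k * r k powr b k * V)"
          unfolding Z_def n_def \<kappa>_def F_def L_def V_def
        proof (rule integral_diff_kernel_test_fun[OF b(1,2) r fin \<phi>])
          show "r k < \<rho> x" if "\<phi> x \<noteq> 0" for x
            using that K(3)[of x] s(2)[of x] rk by fastforce
          show "\<bar>\<phi> (x - h) - \<phi> x + (\<Sum>j\<in>UNIV. h $ j * partial_deriv j \<phi> x)\<bar> \<le> w * norm h" if "norm h < r k" for x h
            using d(2)[of h x] that rk by simp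
        qed (use w in simp)
        then have s1: "A k * \<bar>Z + (n / b k * r k powr b k * \<kappa>) * F\<bar> \<le> A k * (w * L * (n / b k * r k powr b k * V))"
          using A[of k] by (intro mult_left_mono) auto
        have s2: "A k * \<bar>Z + (n / b k * r k powr b k * \<kappa>) * F\<bar> = \<bar>A k * Z + A k * (n / b k * r k powr b k * \<kappa>) * F\<bar>"
          using A[of k] by (simp add: abs_mult_pos' distrib_left mult.assoc)
        have s3: "A k * (n / b k * r k powr b k * \<kappa>) = 1" unfolding A1 using \<kappa> by simp
        have s4: "A k * (w * L * (n / b k * r k powr b k * V)) = w * L * (A k * (n / b k * r k powr b k * V))"
          by (simp only: mult_ac)
        have s5: "w * L * (A k * (n / b k * r k powr b k * V)) = w * (L * (V / \<kappa>))" unfolding A1 by simp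
        have s6: "A k * Z = (LINT x|?R. v k x * \<phi> x)"
          by (subst v_eq) (simp add: Z_def v_def mult.assoc)
        have "\<bar>(LINT x|?R. v k x * \<phi> x) + F\<bar> = A k * \<bar>Z + (n / b k * r k powr b k * \<kappa>) * F\<bar>"
          by (simp only: s2 s3 s6 mult_1)
        also have "\<dots> \<le> w * (L * (V / \<kappa>))" using s1 by (simp only: s4 s5)
        also have "\<dots> < w * (L * (V / \<kappa>) + 1)" using w by (intro mult_strict_left_mono) auto
        also have "\<dots> = e" using pos by (simp add: w_def)
        finally show "norm ((LINT x|?R. v k x * \<phi> x) - - F) < e" by simp
      qed
    qed
    from lim[OF _ B this] have "(LINT x|?R. u x * \<phi> x) = - F"
      by (simp add: measurable_restrict_space1)
    then show "(LINT x|lborel. f x * partial_deriv i \<phi> x) = - (LINT x|lborel. indicator \<Omega> x * u x * \<phi> x)"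
      unfolding R_eq F_def by simp
  qed
qed

end

section \<open>Passage to Borel representatives and the limit\<close>

lemma bounded_open_frontier_nonempty:
  fixes \<Omega> :: "(real^'n::finite) set"
  assumes "bounded \<Omega>" "\<Omega> \<noteq> {}"
  shows "frontier \<Omega> \<noteq> {}"
  using assms frontier_eq_empty[of \<Omega>] not_bounded_UNIV[where 'a="real^'n"] by auto

lemma infdist_frontier_pos:
  fixes \<Omega> :: "'a::euclidean_space set"
  assumes "open \<Omega>" "x \<in> \<Omega>" "frontier \<Omega> \<noteq> {}"
  shows "0 < infdist x (frontier \<Omega>)"
  using assms frontier_disjoint_eq[of \<Omega>] by (intro infdist_pos_not_in_closed) auto

text \<open>A segment from a point of \<open>\<Omega>\<close> to a point outside would meet the
  frontier, at distance at most |h| from \<open>x\<close>.\<close>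

lemma ball_infdist_frontier_subset:
  fixes \<Omega> :: "'a::euclidean_space set"
  assumes x: "x \<in> \<Omega>" and h: "norm h < infdist x (frontier \<Omega>)"
  shows "x + h \<in> \<Omega>"
proof (rule ccontr)
  assume n: "x + h \<notin> \<Omega>"
  have "closed_segment x (x + h) \<inter> frontier \<Omega> \<noteq> {}"
    by (rule connected_Int_frontier) (use x n in auto)
  then obtain z where z: "z \<in> closed_segment x (x + h)" "z \<in> frontier \<Omega>" by auto
  have "dist x z \<le> norm h" using dist_in_closed_segment[OF z(1)] by (simp add: dist_norm norm_minus_commute)
  then show False using infdist_le[OF z(2), of x] h by simp
qed

section \<open>Borel representatives of the function and of its weak gradient\<close>

lemma lebesgue_borel_representative:
  fixes u :: "'a::euclidean_space \<Rightarrow> real"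
  assumes "(\<lambda>x. indicator \<Omega> x *\<^sub>R u x) \<in> borel_measurable lebesgue" and [measurable]: "\<Omega> \<in> sets borel"
  obtains u0 where "u0 \<in> borel_measurable borel" "\<And>x. x \<notin> \<Omega> \<Longrightarrow> u0 x = 0" "AE x in lborel. x \<in> \<Omega> \<longrightarrow> u x = u0 x"
proof -
  obtain w where [measurable]: "w \<in> borel_measurable lborel" and w: "AE x in lborel. indicator \<Omega> x *\<^sub>R u x = w x"
    using completion_ex_borel_measurable_real[OF assms(1)] by blast
  have [measurable]: "w \<in> borel_measurable borel" using \<open>w \<in> borel_measurable lborel\<close> by simp
  show ?thesis
  proof (rule that[of "\<lambda>x. indicator \<Omega> x * w x"])
    show "(\<lambda>x. indicator \<Omega> x * w x) \<in> borel_measurable borel" by measurable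
    show "AE x in lborel. x \<in> \<Omega> \<longrightarrow> u x = indicator \<Omega> x * w x"
      using w by eventually_elim (auto simp: indicator_def split: if_splits)
  qed auto
qed

lemma set_integral_lebesgue_eq_lborel:
  fixes u u0 \<psi> :: "'a::euclidean_space \<Rightarrow> real"
  assumes m: "(\<lambda>x. indicator \<Omega> x *\<^sub>R u x) \<in> borel_measurable lebesgue"
    and [measurable]: "u0 \<in> borel_measurable borel" "\<psi> \<in> borel_measurable borel"
    and z: "\<And>x. x \<notin> \<Omega> \<Longrightarrow> u0 x = 0" and ae: "AE x in lborel. x \<in> \<Omega> \<longrightarrow> u x = u0 x"
  shows "(LINT x:\<Omega>|lebesgue. u x * \<psi> x) = (LINT x|lborel. u0 x * \<psi> x)"
proof -
  have \<psi>m: "\<psi> \<in> borel_measurable lebesgue" by (rule measurable_completion) simp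
  have "(LINT x:\<Omega>|lebesgue. u x * \<psi> x) = (LINT x|lebesgue. (indicator \<Omega> x *\<^sub>R u x) * \<psi> x)"
    by (simp add: set_lebesgue_integral_def mult.assoc)
  also have "\<dots> = (LINT x|lebesgue. u0 x * \<psi> x)"
  proof (rule integral_cong_AE)
    show "(\<lambda>x. (indicator \<Omega> x *\<^sub>R u x) * \<psi> x) \<in> borel_measurable lebesgue"
      by (rule borel_measurable_times[OF m \<psi>m])
    show "(\<lambda>x. u0 x * \<psi> x) \<in> borel_measurable lebesgue" by (rule measurable_completion) simp
    show "AE x in lebesgue. (indicator \<Omega> x *\<^sub>R u x) * \<psi> x = u0 x * \<psi> x"
      using AE_completion[OF ae] by eventually_elim (use z in \<open>auto simp: indicator_def\<close>)
  qed
  also have "\<dots> = (LINT x|lborel. u0 x * \<psi> x)" by (rule integral_completion) simp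
  finally show ?thesis .
qed

lemma set_integrable_lborel_representative:
  fixes u u0 :: "'a::euclidean_space \<Rightarrow> real"
  assumes i: "set_integrable lebesgue C u" and C: "C \<subseteq> \<Omega>" "C \<in> sets borel"
    and [measurable]: "u0 \<in> borel_measurable borel" and ae: "AE x in lborel. x \<in> \<Omega> \<longrightarrow> u x = u0 x"
  shows "set_integrable lborel C u0"
proof -
  have [measurable]: "C \<in> sets borel" by fact
  have m: "(\<lambda>x. indicator C x *\<^sub>R u0 x) \<in> borel_measurable lborel" by measurable
  have "integrable lebesgue (\<lambda>x. indicator C x *\<^sub>R u0 x)"
  proof (rule integrable_cong_AE_imp[OF i[unfolded set_integrable_def]])
    show "(\<lambda>x. indicator C x *\<^sub>R u0 x) \<in> borel_measurable lebesgue" by (rule measurable_completion[OF m])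
    show "AE x in lebesgue. indicator C x *\<^sub>R u x = indicator C x *\<^sub>R u0 x"
      using AE_completion[OF ae] by eventually_elim (use C in \<open>auto simp: indicator_def\<close>)
  qed
  then show ?thesis unfolding set_integrable_def using integrable_completion[OF m] by simp
qed

text \<open>The exponents match since p (1 - s) - n - p = -(n + s p). The representative replaces
  \<open>f\<close> twice: for almost every x and, because the ball lies in \<open>\<Omega>\<close>,
  for almost every y of the inner integral. Its Borel measurability makes f0(x + h) jointly
  measurable, as Tonelli requires.\<close>

lemma nonlocal_energy_eq_ball_energy:
  fixes f f0 :: "real^'n::finite \<Rightarrow> real" and \<rho> :: "real^'n \<Rightarrow> real"
  assumes [measurable]: "f0 \<in> borel_measurable borel"
    and ae: "AE x in lborel. x \<in> \<Omega> \<longrightarrow> f x = f0 x" and sub: "\<And>x. x \<in> \<Omega> \<Longrightarrow> ball x (\<rho> x) \<subseteq> \<Omega>"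
  shows "(\<integral>\<^sup>+ x\<in>\<Omega>. (\<integral>\<^sup>+ y\<in>ball x (\<rho> x). ennreal (\<bar>f y - f x\<bar> powr p / dist x y powr (real CARD('n) + s * p)) \<partial>lebesgue) \<partial>lebesgue)
    = ball_energy \<Omega> \<rho> f0 p (p * (1 - s))"
  unfolding nn_integral_completion ball_energy_def
proof (rule nn_integral_cong_AE)
  show "AE x in lborel. (\<integral>\<^sup>+ y\<in>ball x (\<rho> x). ennreal (\<bar>f y - f x\<bar> powr p / dist x y powr (real CARD('n) + s * p)) \<partial>lborel) * indicator \<Omega> x =
    (\<integral>\<^sup>+h. indicator \<Omega> x * indicator (ball 0 (\<rho> x)) h * ennreal (\<bar>f0 (x + h) - f0 x\<bar> powr p * norm h powr (p * (1 - s) - CARD('n) - p)) \<partial>lborel)"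
    using ae
  proof eventually_elim
    case (elim x)
    show ?case
    proof (cases "x \<in> \<Omega>")
      case True
      define G where "G y = ennreal (\<bar>f0 y - f0 x\<bar> powr p / dist x y powr (real CARD('n) + s * p)) * indicator (ball x (\<rho> x)) y" for y
      have [measurable]: "G \<in> borel_measurable borel" unfolding G_def by measurable
      have "(\<integral>\<^sup>+ y\<in>ball x (\<rho> x). ennreal (\<bar>f y - f x\<bar> powr p / dist x y powr (real CARD('n) + s * p)) \<partial>lborel) = (\<integral>\<^sup>+y. G y \<partial>lborel)"
      proof (rule nn_integral_cong_AE)
        show "AE y in lborel. ennreal (\<bar>f y - f x\<bar> powr p / dist x y powr (real CARD('n) + s * p)) * indicator (ball x (\<rho> x)) y = G y"
          using ae
        proof eventually_elim
          case (elim y)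
          then show ?case using sub[OF True] \<open>x \<in> \<Omega> \<longrightarrow> f x = f0 x\<close> True
            by (cases "y \<in> ball x (\<rho> x)") (auto simp: G_def)
        qed
      qed
      also have "\<dots> = (\<integral>\<^sup>+h. G (h + x) \<partial>lborel)" by (rule nn_integral_lborel_translate[symmetric]) measurable
      also have "\<dots> = (\<integral>\<^sup>+h. indicator \<Omega> x * indicator (ball 0 (\<rho> x)) h * ennreal (\<bar>f0 (x + h) - f0 x\<bar> powr p * norm h powr (p * (1 - s) - CARD('n) - p)) \<partial>lborel)"
      proof (rule nn_integral_cong)
        fix h :: "real^'n"
        have e: "p * (1 - s) - CARD('n) - p = - (real CARD('n) + s * p)" by (simp add: algebra_simps)
        have "indicator (ball x (\<rho> x)) (h + x) = (indicator (ball 0 (\<rho> x)) h :: ennreal)"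
          by (simp add: indicator_def dist_norm)
        then show "G (h + x) = indicator \<Omega> x * indicator (ball 0 (\<rho> x)) h * ennreal (\<bar>f0 (x + h) - f0 x\<bar> powr p * norm h powr (p * (1 - s) - CARD('n) - p))"
          unfolding G_def e powr_minus using True
          by (simp add: dist_norm divide_inverse mult.commute add.commute)
      qed
      finally show ?thesis using True by simp
    qed simp
  qed
qed

lemma weak_gradient_borel_representative:
  fixes f :: "real^'n::finite \<Rightarrow> real" and g :: "real^'n \<Rightarrow> real^'n"
  assumes wg: "weak_gradient \<Omega> f g" and \<Omega>: "open \<Omega>"
    and C: "\<And>m::nat. compact (C m)" "\<And>m. C m \<subseteq> C (Suc m)" "(\<Union>m. C m) = \<Omega>"
    and fm: "(\<lambda>x. indicator \<Omega> x *\<^sub>R f x) \<in> borel_measurable lebesgue"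
    and [measurable]: "f0 \<in> borel_measurable borel" and f0: "\<And>x. x \<notin> \<Omega> \<Longrightarrow> f0 x = 0" "AE x in lborel. x \<in> \<Omega> \<longrightarrow> f x = f0 x"
  obtains g0 where "g0 \<in> borel_measurable borel" "AE x in lborel. x \<in> \<Omega> \<longrightarrow> g x = g0 x"
    "\<And>K. compact K \<Longrightarrow> K \<subseteq> \<Omega> \<Longrightarrow> set_integrable lborel K g0"
    "\<And>\<phi> i. test_fun \<Omega> \<phi> \<Longrightarrow> (LINT x|lborel. f0 x * partial_deriv i \<phi> x) = - (LINT x|lborel. g0 x $ i * \<phi> x)"
proof -
  have [measurable]: "\<Omega> \<in> sets borel" using \<Omega> by simp
  have gi: "set_integrable lebesgue K (\<lambda>x. g x $ i)" if "compact K" "K \<subseteq> \<Omega>" for K i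
    using wg that unfolding weak_gradient_def by blast
  \<comment> \<open>A weak gradient comes with measurability on compact subsets of
    \<open>\<Omega>\<close> only; the exhaustion \<open>C\<close> extends it to
    \<open>\<Omega>\<close> as a pointwise limit.\<close>
  have gm: "(\<lambda>x. indicator \<Omega> x *\<^sub>R (g x $ i)) \<in> borel_measurable lebesgue" for i
  proof (rule borel_measurable_LIMSEQ_real)
    show "(\<lambda>x. indicator (C m) x *\<^sub>R (g x $ i)) \<in> borel_measurable lebesgue" for m
      using gi[of "C m" i] C unfolding set_integrable_def by auto
    fix x
    show "(\<lambda>m. indicator (C m) x *\<^sub>R (g x $ i)) \<longlonglongrightarrow> indicator \<Omega> x *\<^sub>R (g x $ i)"
    proof (intro tendsto_scaleR tendsto_const)
      have "incseq C" using C(2) by (rule incseq_SucI)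
      then show "(\<lambda>m. indicator (C m) x) \<longlonglongrightarrow> (indicator \<Omega> x :: real)"
        unfolding C(3)[symmetric] by (rule LIMSEQ_indicator_incseq)
    qed
  qed
  have "\<forall>i. \<exists>u0. u0 \<in> borel_measurable borel \<and> (\<forall>x. x \<notin> \<Omega> \<longrightarrow> u0 x = 0) \<and> (AE x in lborel. x \<in> \<Omega> \<longrightarrow> g x $ i = u0 x)"
  proof
    fix i
    show "\<exists>u0. u0 \<in> borel_measurable borel \<and> (\<forall>x. x \<notin> \<Omega> \<longrightarrow> u0 x = 0) \<and> (AE x in lborel. x \<in> \<Omega> \<longrightarrow> g x $ i = u0 x)"
      by (rule lebesgue_borel_representative[OF gm[of i]]) (simp, blast)
  qed
  from choice[OF this] obtain u where u: "\<forall>i. u i \<in> borel_measurable borel \<and> (\<forall>x. x \<notin> \<Omega> \<longrightarrow> u i x = 0) \<and> (AE x in lborel. x \<in> \<Omega> \<longrightarrow> g x $ i = u i x)"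
    by blast
  have um [measurable]: "u i \<in> borel_measurable borel" and u0: "x \<notin> \<Omega> \<Longrightarrow> u i x = 0"
    and uae: "AE x in lborel. x \<in> \<Omega> \<longrightarrow> g x $ i = u i x" for i x
    using u by auto
  define g0 where "g0 x = (\<Sum>i\<in>UNIV. u i x *\<^sub>R axis i (1::real))" for x
  have g0i: "g0 x $ i = u i x" for x i
    by (simp add: g0_def axis_def if_distrib cong: if_cong)
  show ?thesis
  proof (rule that[of g0])
    show "g0 \<in> borel_measurable borel" unfolding g0_def by measurable
    have "AE x in lborel. \<forall>i. x \<in> \<Omega> \<longrightarrow> g x $ i = u i x"
      using uae by (intro AE_all_countable[THEN iffD2]) auto
    then show "AE x in lborel. x \<in> \<Omega> \<longrightarrow> g x = g0 x"
      by eventually_elim (auto simp: vec_eq_iff g0i)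
    show "set_integrable lborel K g0" if K: "compact K" "K \<subseteq> \<Omega>" for K
    proof -
      have "set_integrable lborel K (u i)" for i
        using set_integrable_lborel_representative[OF gi[OF K] K(2) borel_compact[OF K(1)] um uae] .
      then have "integrable lborel (\<lambda>x. \<Sum>i\<in>UNIV. (indicator K x *\<^sub>R u i x) *\<^sub>R axis i (1::real))"
        unfolding set_integrable_def by (intro Bochner_Integration.integrable_sum integrable_scaleR_left)
      then show ?thesis by (simp add: set_integrable_def g0_def scaleR_sum_right)
    qed
    fix \<phi> :: "real^'n \<Rightarrow> real" and i assume \<phi>: "test_fun \<Omega> \<phi>"
    have m: "\<phi> \<in> borel_measurable borel" "partial_deriv i \<phi> \<in> borel_measurable borel"
      using test_fun_measurable[OF \<phi>] partial_deriv_test_fun_measurable[OF \<phi>] by auto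
    have "(LINT x:\<Omega>|lebesgue. f x * partial_deriv i \<phi> x) = - (LINT x:\<Omega>|lebesgue. g x $ i * \<phi> x)"
      using wg \<phi> unfolding weak_gradient_def by blast
    moreover have "(LINT x:\<Omega>|lebesgue. f x * partial_deriv i \<phi> x) = (LINT x|lborel. f0 x * partial_deriv i \<phi> x)"
      by (rule set_integral_lebesgue_eq_lborel[OF fm _ m(2) f0]) simp
    moreover have "(LINT x:\<Omega>|lebesgue. g x $ i * \<phi> x) = (LINT x|lborel. u i x * \<phi> x)"
      by (rule set_integral_lebesgue_eq_lborel[OF gm um m(1) u0 uae])
    ultimately show "(LINT x|lborel. f0 x * partial_deriv i \<phi> x) = - (LINT x|lborel. g0 x $ i * \<phi> x)"
      by (simp add: g0i)
  qed
qed

lemma weak_gradientI: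
  fixes f :: "real^'n::finite \<Rightarrow> real"
  assumes \<Omega>: "open \<Omega>" and fm: "(\<lambda>x. indicator \<Omega> x *\<^sub>R f x) \<in> borel_measurable lebesgue"
    and f0m: "f0 \<in> borel_measurable borel" and f0: "\<And>x. x \<notin> \<Omega> \<Longrightarrow> f0 x = 0" "AE x in lborel. x \<in> \<Omega> \<longrightarrow> f x = f0 x"
    and u: "\<And>i. integrable lborel (u i)"
    and eq: "\<And>\<phi> i. test_fun \<Omega> \<phi> \<Longrightarrow> (LINT x|lborel. f0 x * partial_deriv i \<phi> x) = - (LINT x|lborel. u i x * \<phi> x)"
  shows "weak_gradient \<Omega> f (\<lambda>x. \<chi> i. u i x)"
  unfolding weak_gradient_def
proof (intro conjI allI impI)
  have [measurable]: "\<Omega> \<in> sets borel" using \<Omega> by simp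
  have um [measurable]: "u i \<in> borel_measurable borel" for i using u[of i] by auto
  fix i and K :: "(real^'n) set" assume "compact K \<and> K \<subseteq> \<Omega>"
  then have [measurable]: "K \<in> sets borel" using borel_compact by blast
  have "set_integrable lborel K (u i)"
    unfolding set_integrable_def by (rule integrable_mult_indicator[OF _ u]) simp
  then show "set_integrable lebesgue K (\<lambda>x. (\<chi> i. u i x) $ i)"
    unfolding set_integrable_def by (subst integrable_completion) auto
next
  have [measurable]: "\<Omega> \<in> sets borel" using \<Omega> by simp
  have um [measurable]: "u i \<in> borel_measurable borel" for i using u[of i] by auto
  fix \<phi> :: "real^'n \<Rightarrow> real" and i assume \<phi>: "test_fun \<Omega> \<phi>"
  have m [measurable]: "\<phi> \<in> borel_measurable borel" "partial_deriv i \<phi> \<in> borel_measurable borel"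
    using test_fun_measurable[OF \<phi>] partial_deriv_test_fun_measurable[OF \<phi>] by auto
  obtain K where K: "K \<subseteq> \<Omega>" "\<And>x. x \<notin> K \<Longrightarrow> \<phi> x = 0" using test_fun_support[OF \<phi>] by metis
  have "(LINT x:\<Omega>|lebesgue. f x * partial_deriv i \<phi> x) = (LINT x|lborel. f0 x * partial_deriv i \<phi> x)"
    by (rule set_integral_lebesgue_eq_lborel[OF fm f0m m(2) f0])
  also have "\<dots> = - (LINT x|lborel. u i x * \<phi> x)" by (rule eq[OF \<phi>])
  also have "(LINT x|lborel. u i x * \<phi> x) = (LINT x|lborel. (indicator \<Omega> x * u i x) * \<phi> x)"
    using K by (intro Bochner_Integration.integral_cong) (auto simp: indicator_def)
  also have "\<dots> = (LINT x:\<Omega>|lebesgue. u i x * \<phi> x)"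
  proof (rule set_integral_lebesgue_eq_lborel[symmetric])
    show "(\<lambda>x. indicator \<Omega> x *\<^sub>R u i x) \<in> borel_measurable lebesgue"
      by (rule measurable_completion) simp
  qed auto
  finally show "(LINT x:\<Omega>|lebesgue. f x * partial_deriv i \<phi> x) = - (LINT x:\<Omega>|lebesgue. (\<chi> i. u i x) $ i * \<phi> x)"
    by simp
qed

lemma bounded_open_compact_exhaustion:
  fixes \<Omega> :: "'a::euclidean_space set"
  assumes "open \<Omega>" "bounded \<Omega>" "frontier \<Omega> \<noteq> {}"
  obtains C :: "nat \<Rightarrow> 'a set"
  where "\<And>m. compact (C m)" "\<And>m. C m \<subseteq> C (Suc m)" "(\<Union>m. C m) = \<Omega>"
proof -
  \<comment> \<open>Intersecting with the closure gives compactness; a positive distance from the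
    frontier then forces the points back into \<open>\<Omega>\<close>.\<close>
  define C where "C m = closure \<Omega> \<inter> {x. 1 / real (Suc m) \<le> infdist x (frontier \<Omega>)}" for m
  have "closed {x. 1 / real (Suc m) \<le> infdist x (frontier \<Omega>)}" for m
    by (intro closed_Collect_le continuous_intros)
  then have c: "compact (C m)" for m
    unfolding C_def using assms(2) by (intro compact_Int_closed) (auto simp: compact_closure)
  have mono: "C m \<subseteq> C (Suc m)" for m
  proof -
    have "1 / real (Suc (Suc m)) \<le> 1 / real (Suc m)" by (intro divide_left_mono) auto
    then show ?thesis unfolding C_def by (auto intro: order_trans)
  qed
  have "(\<Union>m. C m) = \<Omega>"
  proof (intro set_eqI iffI)
    fix x assume "x \<in> (\<Union>m. C m)"
    then obtain m where x: "x \<in> closure \<Omega>" "1 / real (Suc m) \<le> infdist x (frontier \<Omega>)" by (auto simp: C_def)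
    have "0 < 1 / real (Suc m)" by simp
    then have "infdist x (frontier \<Omega>) \<noteq> 0" using x(2) by linarith
    then have "x \<notin> frontier \<Omega>" by auto
    then show "x \<in> \<Omega>" using x(1) interior_subset[of \<Omega>] by (auto simp: frontier_def)
  next
    fix x assume x: "x \<in> \<Omega>"
    obtain m where "inverse (real (Suc m)) < infdist x (frontier \<Omega>)"
      using reals_Archimedean[OF infdist_frontier_pos[OF assms(1) x assms(3)]] by blast
    then have "x \<in> C m" using x closure_subset by (auto simp: C_def inverse_eq_divide)
    then show "x \<in> (\<Union>m. C m)" by blast
  qed
  with c mono that show ?thesis by blast
qed

text \<open>This is why the radii \<open>R\<close> of the upper and \<open>r\<close> of the lower
  bound disappear in the limit.\<close>

lemma tendsto_powr_exponent_vanishes: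
  fixes R p :: real
  assumes "0 < R"
  shows "((\<lambda>s. R powr (p * (1 - s))) \<longlongrightarrow> 1) (at_left 1)"
proof -
  have "((\<lambda>s. R powr (p * (1 - s))) \<longlongrightarrow> R powr (p * (1 - 1))) (at_left 1)"
    using assms by (intro tendsto_intros) auto
  then show ?thesis using assms by simp
qed

lemma eventually_exponent_small:
  fixes p :: real
  assumes "1 < p"
  shows "eventually (\<lambda>s. 0 < p * (1 - s) \<and> p * (1 - s) < 1 \<and> s < 1) (at_left 1)"
proof -
  have "((\<lambda>s. p * (1 - s)) \<longlongrightarrow> p * (1 - 1)) (at_left 1)" by (intro tendsto_intros)
  then have "eventually (\<lambda>s. p * (1 - s) < 1) (at_left 1)" by (intro order_tendstoD(2)) auto
  moreover have "eventually (\<lambda>s. s < (1::real)) (at_left 1)" by (simp add: eventually_at_filter)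
  ultimately show ?thesis by eventually_elim (use assms in auto)
qed

section \<open>The limit with and without a weak gradient\<close>

context weak_gradient_setting
begin

theorem ball_energy_tendsto:
  fixes i :: 'n and p R :: real
  assumes p: "1 < p" and R: "0 < R" "\<And>x. x \<in> \<Omega> \<Longrightarrow> \<rho> x \<le> R"
    and C: "\<And>m::nat. compact (C m)" "\<And>m. C m \<subseteq> C (Suc m)" "(\<Union>m. C m) = \<Omega>"
  shows "((\<lambda>s. ennreal (1 - s) * ball_energy \<Omega> \<rho> f p (p * (1 - s))) \<longlongrightarrow>
    K_const i p * (\<integral>\<^sup>+x. ennreal (norm (g x) powr p) * indicator \<Omega> x \<partial>lborel)) (at_left 1)"
proof -
  define K where "K = K_const i p"
  have K: "0 < K" "K < \<infinity>" unfolding K_def using K_const_pos_finite[OF p] by auto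
  define W where "W = (\<integral>\<^sup>+x. ennreal (norm (g x) powr p) * indicator \<Omega> x \<partial>lborel)"
  define E where "E s = ennreal (1 - s) * ball_energy \<Omega> \<rho> f p (p * (1 - s))" for s
  \<comment> \<open>With b = p (1 - s) the factors 1 - s and p / b of the two bounds cancel
    exactly.\<close>
  have scale: "ennreal (1 - s) * ennreal (p / (p * (1 - s)) * c) = ennreal c" if "0 < p * (1 - s)" "0 \<le> c" for s c
  proof -
    have "0 < 1 - s" using that p by (simp add: zero_less_mult_iff)
    then have "ennreal (1 - s) * ennreal (p / (p * (1 - s)) * c) = ennreal ((1 - s) * (p / (p * (1 - s)) * c))"
      using that p by (intro ennreal_mult[symmetric]) auto
    also have "(1 - s) * (p / (p * (1 - s)) * c) = c" using \<open>0 < 1 - s\<close> p by simp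
    finally show ?thesis .
  qed
  have "(E \<longlongrightarrow> K * W) (at_left 1)"
  proof (rule order_tendstoI)
    fix a assume a: "K * W < a"
    have "((\<lambda>s. ennreal (R powr (p * (1 - s))) * (K * W)) \<longlongrightarrow> ennreal 1 * (K * W)) (at_left 1)"
      by (intro tendsto_mult_ennreal tendsto_const tendsto_ennrealI tendsto_powr_exponent_vanishes R) auto
    then have "eventually (\<lambda>s. ennreal (R powr (p * (1 - s))) * (K * W) < a) (at_left 1)"
      using a by (intro order_tendstoD(2)) auto
    then show "eventually (\<lambda>s. E s < a) (at_left 1)"
      using eventually_exponent_small[OF p]
    proof eventually_elim
      case (elim s)
      have "E s \<le> ennreal (1 - s) * (ennreal (p / (p * (1 - s)) * R powr (p * (1 - s))) * K * W)"
        unfolding E_def K_def W_def using elim by (intro mult_left_mono ball_energy_le p R) auto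
      also have "\<dots> = (ennreal (1 - s) * ennreal (p / (p * (1 - s)) * R powr (p * (1 - s)))) * (K * W)"
        by (simp only: mult.assoc)
      also have "\<dots> = ennreal (R powr (p * (1 - s))) * (K * W)" using elim by (subst scale) auto
      finally show ?case using elim by simp
    qed
  next
    fix a assume a: "a < K * W"
    \<comment> \<open>Sets to which \<open>ball_energy_ge\<close> applies with N = m. They exhaust
      \<open>\<Omega>\<close>, so the truncated integrals increase to the full one even if that is
      infinite; each of them is finite, which allows the comparison to be made with real
      numbers.\<close>
    define S where "S m = {x\<in>C m. norm (g x) \<le> real m}" for m
    have [measurable]: "C m \<in> sets borel" for m using C(1) borel_compact by blast
    have S_meas [measurable]: "S m \<in> sets borel" for m unfolding S_def by measurable
    have Cm: "C l \<subseteq> C m" if "l \<le> m" for l m using lift_Suc_mono_le[of C, OF C(2) that] .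
    have incS: "incseq S" unfolding S_def using C(2) by (intro incseq_SucI) (auto intro: order_trans)
    have US: "(\<Union>m. S m) = \<Omega>"
    proof (intro set_eqI iffI)
      fix x assume "x \<in> \<Omega>"
      then obtain l where l: "x \<in> C l" using C(3) by blast
      obtain q :: nat where q: "norm (g x) \<le> real q" using real_arch_simple by blast
      have "x \<in> S (max l q)" using l q Cm[of l "max l q"] by (auto simp: S_def)
      then show "x \<in> (\<Union>m. S m)" by blast
    qed (use C(3) in \<open>auto simp: S_def\<close>)
    define Wm where "Wm m = (\<integral>\<^sup>+x. ennreal (norm (g x) powr p) * indicator (S m) x \<partial>lborel)" for m
    have "Wm \<longlonglongrightarrow> W"
    proof -
      let ?D = "density lborel (\<lambda>x. ennreal (norm (g x) powr p))"
      have "(\<lambda>m. emeasure ?D (S m)) \<longlonglongrightarrow> emeasure ?D (\<Union>m. S m)"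
        using incS by (intro Lim_emeasure_incseq) auto
      moreover have "emeasure ?D (S m) = Wm m" for m unfolding Wm_def by (subst emeasure_density) auto
      moreover have "emeasure ?D (\<Union>m. S m) = W" unfolding US W_def by (subst emeasure_density) auto
      ultimately show ?thesis by simp
    qed
    then have "(\<lambda>m. K * Wm m) \<longlonglongrightarrow> K * W" using K by (intro ennreal_tendsto_cmult) auto
    then have "eventually (\<lambda>m. a < K * Wm m) sequentially" using a by (rule order_tendstoD(1))
    then obtain m where m: "a < K * Wm m" by (auto simp: eventually_sequentially)
    have Cs: "C m \<subseteq> \<Omega>" using C(3) by blast
    have "Wm m \<le> (\<integral>\<^sup>+x. ennreal (real m powr p) * indicator (C m) x \<partial>lborel)"
      unfolding Wm_def using p
      by (intro nn_integral_mono) (auto simp: S_def indicator_def intro!: ennreal_leI powr_mono2)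
    also have "\<dots> < \<infinity>"
      using emeasure_bounded_finite[OF compact_imp_bounded[OF C(1)[of m]]]
      by (simp add: nn_integral_cmult_indicator ennreal_mult_less_top)
    finally have KW: "K * Wm m < \<infinity>" using K by (simp add: ennreal_mult_less_top)
    define x where "x = enn2real (K * Wm m)"
    define a' where "a' = enn2real a"
    have x: "ennreal x = K * Wm m" using KW by (simp add: x_def)
    have x0: "0 \<le> x" by (simp add: x_def)
    have a': "ennreal a' = a" using m KW by (simp add: a'_def)
    have a'0: "0 \<le> a'" by (simp add: a'_def)
    have ax: "a' < x" using m unfolding x[symmetric] a'[symmetric] using a'0 by (simp add: ennreal_less_iff)
    \<comment> \<open>Multiplied by 1 - s, the error term of \<open>ball_energy_ge\<close> becomes
      r^b c e. The choice of \<open>e\<close> below keeps c e smaller than the margin x - a'; the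
      summand 1 in its denominator covers c = 0.\<close>
    define c where "c = real m powr (p - 1) * CARD('n) * measure lborel (cball (0::real^'n) 1)"
    have c: "0 \<le> c" by (simp add: c_def)
    define e where "e = (x - a') / (2 * (c + 1))"
    have e: "0 < e" using ax c by (simp add: e_def)
    have "c * e = (x - a') / 2 * (c / (c + 1))" using c by (simp add: e_def)
    also have "\<dots> \<le> (x - a') / 2 * 1" using c ax by (intro mult_left_mono) auto
    finally have ce: "c * e < x - a'" using ax by simp
    obtain r where r: "0 < r" and low: "\<And>b. 0 < b \<Longrightarrow> b < 1 \<Longrightarrow>
      ennreal (p / b * r powr b) * K_const i p * (\<integral>\<^sup>+x. ennreal (norm (g x) powr p) * indicator {x\<in>C m. norm (g x) \<le> real m} x \<partial>lborel)
      \<le> ball_energy \<Omega> \<rho> f p b + ennreal (p * real m powr (p - 1) * e * (CARD('n) / b * r powr b * measure lborel (cball (0::real^'n) 1)))"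
      by (rule ball_energy_ge[OF p C(1) Cs e, of "real m" i]) auto
    have "((\<lambda>s. r powr (p * (1 - s)) * (x - c * e)) \<longlongrightarrow> 1 * (x - c * e)) (at_left 1)"
      by (intro tendsto_mult tendsto_const tendsto_powr_exponent_vanishes r)
    then have "eventually (\<lambda>s. a' < r powr (p * (1 - s)) * (x - c * e)) (at_left 1)"
      using ce by (intro order_tendstoD(1)) auto
    then show "eventually (\<lambda>s. a < E s) (at_left 1)"
      using eventually_exponent_small[OF p]
    proof eventually_elim
      case (elim s)
      define b where "b = p * (1 - s)"
      have b: "0 < b" "b < 1" using elim by (auto simp: b_def)
      define d where "d = r powr b"
      have d: "0 < d" using r by (simp add: d_def)
      have "ennreal (p / b * d) * K * Wm m \<le> ball_energy \<Omega> \<rho> f p b + ennreal (p / b * (d * (c * e)))"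
        using low[OF b] by (simp add: K_def Wm_def S_def d_def c_def mult_ac)
      then have "ennreal (1 - s) * (ennreal (p / b * d) * K * Wm m) \<le> ennreal (1 - s) * (ball_energy \<Omega> \<rho> f p b + ennreal (p / b * (d * (c * e))))"
        by (rule mult_left_mono) simp
      also have "\<dots> = E s + ennreal (1 - s) * ennreal (p / b * (d * (c * e)))"
        by (simp add: E_def b_def distrib_left)
      also have "ennreal (1 - s) * ennreal (p / b * (d * (c * e))) = ennreal (d * (c * e))"
        unfolding b_def using elim d c e by (intro scale) auto
      also have "ennreal (1 - s) * (ennreal (p / b * d) * K * Wm m) = (ennreal (1 - s) * ennreal (p / b * d)) * (K * Wm m)"
        by (simp only: mult.assoc)
      also have "ennreal (1 - s) * ennreal (p / b * d) = ennreal d"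
        unfolding b_def using elim d by (intro scale) auto
      also have "ennreal d * (K * Wm m) = ennreal (d * x)"
        using d x0 by (simp add: x[symmetric] ennreal_mult)
      finally have le: "ennreal (d * x) \<le> E s + ennreal (d * (c * e))" .
      have gt: "a' + d * (c * e) < d * x" using elim(1) by (simp add: d_def b_def right_diff_distrib)
      show ?case
      proof (rule ccontr)
        assume "\<not> a < E s"
        then have "E s \<le> ennreal a'" by (simp add: a')
        then have "ennreal (d * x) \<le> ennreal a' + ennreal (d * (c * e))"
          using le by (meson add_right_mono order_trans)
        also have "\<dots> = ennreal (a' + d * (c * e))"
          using a'0 d c e by (intro ennreal_plus[symmetric]) auto
        finally have "d * x \<le> a' + d * (c * e)" using a'0 d c e by (subst (asm) ennreal_le_iff) auto
        then show False using gt by simp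
      qed
    qed
  qed
  then show ?thesis by (simp add: E_def[abs_def] K_def W_def)
qed

end

text \<open>If the energies do not eventually exceed a level, they stay below it along some sequence
  tending to 1, and a single such sequence already yields all weak partial derivatives. Hence the
  absence of a weak gradient gives a genuine limit and not merely an infinite upper limit.\<close>

lemma (in bounded_energy_setting) ball_energy_tendsto_infinity:
  assumes no: "\<nexists>u. (\<forall>i. integrable lborel (u i)) \<and>
    (\<forall>\<phi> i. test_fun \<Omega> \<phi> \<longrightarrow> (LINT x|lborel. f x * partial_deriv i \<phi> x) = - (LINT x|lborel. u i x * \<phi> x))"
  shows "((\<lambda>s. ennreal (1 - s) * ball_energy \<Omega> \<rho> f p (p * (1 - s))) \<longlongrightarrow> \<infinity>) (at_left 1)"
proof (rule order_tendstoI)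
  fix a :: ennreal assume a: "a < \<infinity>"
  define E where "E s = ennreal (1 - s) * ball_energy \<Omega> \<rho> f p (p * (1 - s))" for s
  define M where "M = enn2real a"
  have M: "ennreal M = a" "0 \<le> M" using a by (auto simp: M_def)
  show "eventually (\<lambda>s. a < ennreal (1 - s) * ball_energy \<Omega> \<rho> f p (p * (1 - s))) (at_left 1)"
  proof (rule ccontr)
    assume "\<not> ?thesis"
    then have ne: "\<not> eventually (\<lambda>s. a < E s) (at_left 1)" by (simp add: E_def)
    \<comment> \<open>This distance to 1 yields b k < 1 / (k + 2), so every exponent is below 1 and
      the sequence tends to 0.\<close>
    have "\<exists>s. 1 - 1 / (p * real (k + 2)) < s \<and> s < 1 \<and> E s \<le> a" for k :: nat
    proof -
      define c where "c = 1 - 1 / (p * real (k + 2))"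
      have "c < 1" using p by (simp add: c_def)
      have "\<exists>s. c < s \<and> s < 1 \<and> E s \<le> a"
      proof (rule ccontr)
        assume "\<not> ?thesis"
        then have "\<forall>y>c. y < 1 \<longrightarrow> a < E y" by (auto simp: not_le)
        then have "eventually (\<lambda>s. a < E s) (at_left 1)"
          unfolding eventually_at_left[OF \<open>c < 1\<close>] using \<open>c < 1\<close> by blast
        then show False using ne by simp
      qed
      then show ?thesis by (simp only: c_def)
    qed
    then obtain s where s: "\<And>k. 1 - 1 / (p * real (k + 2)) < s k" "\<And>k. s k < 1" "\<And>k. E (s k) \<le> a" by metis
    define b where "b k = p * (1 - s k)" for k
    have b0: "0 < b k" for k using s(2)[of k] p by (simp add: b_def)
    have b1: "b k < 1 / real (k + 2)" for k
    proof -
      have "1 - s k < 1 / (p * real (k + 2))" using s(1)[of k] by linarith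
      then have "p * (1 - s k) < p * (1 / (p * real (k + 2)))" using p by (intro mult_strict_left_mono) auto
      also have "\<dots> = 1 / real (k + 2)" using p by simp
      finally show ?thesis by (simp add: b_def)
    qed
    have b2: "b k < 1" for k
    proof -
      have "1 / real (k + 2) \<le> 1" by simp
      then show ?thesis using b1[of k] by linarith
    qed
    have "b \<longlonglongrightarrow> 0"
    proof (rule tendsto_sandwich[of "\<lambda>_. 0" b sequentially "\<lambda>k. inverse (real (Suc k))"])
      show "eventually (\<lambda>k. b k \<le> inverse (real (Suc k))) sequentially"
      proof (intro always_eventually allI)
        fix k
        have "1 / real (k + 2) \<le> inverse (real (Suc k))" by (simp add: inverse_eq_divide frac_le)
        then show "b k \<le> inverse (real (Suc k))" using b1[of k] by linarith
      qed
      show "(\<lambda>k. inverse (real (Suc k))) \<longlonglongrightarrow> 0" by (rule LIMSEQ_inverse_real_of_nat)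
    qed (auto intro!: always_eventually less_imp_le[OF b0])
    have bd: "ennreal (b k) * ball_energy \<Omega> \<rho> f p (b k) \<le> ennreal (p * M)" for k
    proof -
      have "ennreal (b k) * ball_energy \<Omega> \<rho> f p (b k) = ennreal p * E (s k)"
        using p s(2)[of k] by (simp add: b_def E_def ennreal_mult mult.assoc)
      also have "\<dots> \<le> ennreal p * ennreal M" using s(3)[of k] by (intro mult_left_mono) (auto simp: M)
      finally show ?thesis using p M by (simp add: ennreal_mult)
    qed
    have pM: "0 \<le> p * M" using p M by simp
    have "\<forall>i. \<exists>u. integrable lborel u \<and> (\<forall>\<phi>. test_fun \<Omega> \<phi> \<longrightarrow> (LINT x|lborel. f x * partial_deriv i \<phi> x) = - (LINT x|lborel. u x * \<phi> x))"
    proof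
      fix i
      show "\<exists>u. integrable lborel u \<and> (\<forall>\<phi>. test_fun \<Omega> \<phi> \<longrightarrow> (LINT x|lborel. f x * partial_deriv i \<phi> x) = - (LINT x|lborel. u x * \<phi> x))"
        by (rule weak_partial_deriv_of_bounded_energy[OF b0 b2 \<open>b \<longlonglongrightarrow> 0\<close> pM bd, of i]) blast
    qed
    from choice[OF this] show False using no by blast
  qed
qed simp

theorem theorem1p1:
  fixes \<Omega> :: "(real^'n::finite) set" and f :: "real^'n \<Rightarrow> real"
    and \<tau> p :: real and i :: 'n
  assumes "open \<Omega>" and "connected \<Omega>" and "bounded \<Omega>" and "\<Omega> \<noteq> {}"
    and "0 < \<tau>" and "\<tau> < 1" and "1 < p"
    and "f \<in> borel_measurable (lebesgue_on \<Omega>)"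
    and "(\<integral>\<^sup>+ x\<in>\<Omega>. ennreal (\<bar>f x\<bar> powr p) \<partial>lebesgue) < \<infinity>"
  shows "((\<lambda>s::real. ennreal (1 - s) *
            (\<integral>\<^sup>+ x\<in>\<Omega>. (\<integral>\<^sup>+ y\<in>ball x (\<tau> * infdist x (frontier \<Omega>)).
                ennreal (\<bar>f y - f x\<bar> powr p / dist x y powr (real CARD('n) + s * p)) \<partial>lebesgue) \<partial>lebesgue))
          \<longlongrightarrow> K_const i p * grad_energy \<Omega> f p) (at_left 1)"
proof -
  define \<rho> where "\<rho> x = \<tau> * infdist x (frontier \<Omega>)" for x
  have fr: "frontier \<Omega> \<noteq> {}" using assms by (intro bounded_open_frontier_nonempty)
  have \<Omega>m [measurable]: "\<Omega> \<in> sets borel" using assms(1) by simp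
  have cont: "continuous_on UNIV \<rho>" unfolding \<rho>_def by (intro continuous_intros)
  have pos: "0 < \<rho> x" if "x \<in> \<Omega>" for x
    using infdist_frontier_pos[OF assms(1) that fr] assms by (simp add: \<rho>_def)
  have \<rho>_le: "\<rho> x \<le> infdist x (frontier \<Omega>)" for x
    unfolding \<rho>_def using assms infdist_nonneg[of x "frontier \<Omega>"] by (intro mult_left_le_one_le) auto
  have ballh: "x + h \<in> \<Omega>" if "x \<in> \<Omega>" "norm h < \<rho> x" for x h
    using ball_infdist_frontier_subset[of x \<Omega> h] that \<rho>_le[of x] by simp
  have balls: "ball x (\<rho> x) \<subseteq> \<Omega>" if "x \<in> \<Omega>" for x
  proof
    fix y assume "y \<in> ball x (\<rho> x)"
    then show "y \<in> \<Omega>" using ballh[OF that, of "y - x"] by (simp add: dist_norm norm_minus_commute)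
  qed
  obtain a where a: "a \<in> frontier \<Omega>" using fr by blast
  obtain B where B: "0 < B" "\<And>x. x \<in> \<Omega> \<Longrightarrow> norm x \<le> B" using assms(3) unfolding bounded_pos by blast
  \<comment> \<open>The distance to the frontier is at most the distance to its point
    \<open>a\<close>, hence at most |x| + |a|.\<close>
  define R where "R = B + norm a"
  have R: "0 < R" "\<And>x. x \<in> \<Omega> \<Longrightarrow> \<rho> x \<le> R"
  proof -
    show "0 < R" using B(1) norm_ge_zero[of a] unfolding R_def by linarith
    show "\<rho> x \<le> R" if "x \<in> \<Omega>" for x
      using \<rho>_le[of x] infdist_le[OF a, of x] norm_triangle_ineq4[of x a] B(2)[OF that]
      unfolding R_def dist_norm by linarith
  qed
  obtain C :: "nat \<Rightarrow> (real^'n) set" where C: "\<And>m. compact (C m)" "\<And>m. C m \<subseteq> C (Suc m)" "(\<Union>m. C m) = \<Omega>"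
    by (rule bounded_open_compact_exhaustion[OF assms(1,3) fr]) blast
  have fm: "(\<lambda>x. indicator \<Omega> x *\<^sub>R f x) \<in> borel_measurable lebesgue"
    using assms(8) by (subst (asm) borel_measurable_restrict_space_iff) auto
  obtain f0 where f0m [measurable]: "f0 \<in> borel_measurable borel" and f0: "\<And>x. x \<notin> \<Omega> \<Longrightarrow> f0 x = 0" "AE x in lborel. x \<in> \<Omega> \<longrightarrow> f x = f0 x"
    by (rule lebesgue_borel_representative[OF fm \<Omega>m]) blast
  \<comment> \<open>On a bounded set, integrability of the p-th power gives integrability through
    |t| <= 1 + |t|^p.\<close>
  have f0_int: "integrable lborel f0"
  proof (rule integrableI_bounded)
    have "(\<integral>\<^sup>+x. ennreal (norm (f0 x)) \<partial>lborel) \<le> (\<integral>\<^sup>+x. indicator \<Omega> x + ennreal (\<bar>f x\<bar> powr p) * indicator \<Omega> x \<partial>lborel)"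
    proof (rule nn_integral_mono_AE)
      show "AE x in lborel. ennreal (norm (f0 x)) \<le> indicator \<Omega> x + ennreal (\<bar>f x\<bar> powr p) * indicator \<Omega> x"
        using f0(2)
      proof eventually_elim
        case (elim x)
        show ?case
        proof (cases "x \<in> \<Omega>")
          case True
          have "ennreal (norm (f0 x)) \<le> ennreal (1 + \<bar>f x\<bar> powr p)"
            using abs_le_1_plus_powr[OF assms(7), of "f x"] elim True by (intro ennreal_leI) auto
          then show ?thesis using True by (simp add: ennreal_plus)
        qed (simp add: f0(1))
      qed
    qed
    also have "\<dots> = (\<integral>\<^sup>+x. indicator \<Omega> x + ennreal (\<bar>f0 x\<bar> powr p) * indicator \<Omega> x \<partial>lborel)"
      by (intro nn_integral_cong_AE, use f0(2) in eventually_elim) (auto simp: indicator_def)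
    also have "\<dots> = emeasure lborel \<Omega> + (\<integral>\<^sup>+x. ennreal (\<bar>f0 x\<bar> powr p) * indicator \<Omega> x \<partial>lborel)"
      by (subst nn_integral_add) auto
    also have "(\<integral>\<^sup>+x. ennreal (\<bar>f0 x\<bar> powr p) * indicator \<Omega> x \<partial>lborel) = (\<integral>\<^sup>+x. ennreal (\<bar>f x\<bar> powr p) * indicator \<Omega> x \<partial>lborel)"
      by (intro nn_integral_cong_AE, use f0(2) in eventually_elim) (auto simp: indicator_def)
    also have "emeasure lborel \<Omega> + \<dots> < \<infinity>"
      using emeasure_bounded_finite[OF assms(3)] assms(9) by (simp add: nn_integral_completion)
    finally show "(\<integral>\<^sup>+x. ennreal (norm (f0 x)) \<partial>lborel) < \<infinity>" .
  qed simp
  have energy: "(\<integral>\<^sup>+ x\<in>\<Omega>. (\<integral>\<^sup>+ y\<in>ball x (\<tau> * infdist x (frontier \<Omega>)).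
      ennreal (\<bar>f y - f x\<bar> powr p / dist x y powr (real CARD('n) + s * p)) \<partial>lebesgue) \<partial>lebesgue) = ball_energy \<Omega> \<rho> f0 p (p * (1 - s))" for s
    unfolding \<rho>_def[symmetric] by (rule nonlocal_energy_eq_ball_energy[OF f0m f0(2) balls])
  \<comment> \<open>The cases are separated by the existence of a locally integrable weak gradient;
    one whose p-th power has infinite integral belongs to the first case. There the limit formula
    holds for every weak gradient, in particular for the one selected by \<open>SOME\<close> in
    \<open>grad_energy\<close>.\<close>
  show ?thesis
  proof (cases "\<exists>g. weak_gradient \<Omega> f g")
    case True
    define g where "g = (SOME g. weak_gradient \<Omega> f g)"
    have wg: "weak_gradient \<Omega> f g" unfolding g_def using True by (rule someI_ex)
    obtain g0 where g0m [measurable]: "g0 \<in> borel_measurable borel" and g0: "AE x in lborel. x \<in> \<Omega> \<longrightarrow> g x = g0 x"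
      "\<And>K. compact K \<Longrightarrow> K \<subseteq> \<Omega> \<Longrightarrow> set_integrable lborel K g0"
      "\<And>\<phi> i. test_fun \<Omega> \<phi> \<Longrightarrow> (LINT x|lborel. f0 x * partial_deriv i \<phi> x) = - (LINT x|lborel. g0 x $ i * \<phi> x)"
      by (rule weak_gradient_borel_representative[OF wg assms(1) C fm f0m f0]) (assumption, (rule that; simp))
    interpret weak_gradient_setting \<Omega> \<rho> f0 g0
    proof
      show "set_integrable lborel K f0" if "compact K" "K \<subseteq> \<Omega>" for K
        unfolding set_integrable_def by (rule integrable_mult_indicator[OF _ f0_int]) (use borel_compact[OF that(1)] in simp)
    qed (use assms(1) cont pos ballh f0m g0m g0 in auto)
    have "grad_energy \<Omega> f p = (\<integral>\<^sup>+x. ennreal (norm (g x) powr p) * indicator \<Omega> x \<partial>lborel)"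
      using True by (simp add: grad_energy_def g_def nn_integral_completion)
    also have "\<dots> = (\<integral>\<^sup>+x. ennreal (norm (g0 x) powr p) * indicator \<Omega> x \<partial>lborel)"
      by (intro nn_integral_cong_AE, use g0(1) in eventually_elim) (auto simp: indicator_def)
    finally show ?thesis
      unfolding energy using ball_energy_tendsto[OF assms(7) R C, of i] by simp
  next
    case False
    interpret bounded_energy_setting \<Omega> \<rho> f0 p
      by standard (use assms cont pos f0_int in auto)
    have "\<nexists>u. (\<forall>i. integrable lborel (u i)) \<and>
      (\<forall>\<phi> i. test_fun \<Omega> \<phi> \<longrightarrow> (LINT x|lborel. f0 x * partial_deriv i \<phi> x) = - (LINT x|lborel. u i x * \<phi> x))"
    proof
      assume "\<exists>u. (\<forall>i. integrable lborel (u i)) \<and>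
        (\<forall>\<phi> i. test_fun \<Omega> \<phi> \<longrightarrow> (LINT x|lborel. f0 x * partial_deriv i \<phi> x) = - (LINT x|lborel. u i x * \<phi> x))"
      then obtain u where "\<And>i. integrable lborel (u i)"
        "\<And>\<phi> i. test_fun \<Omega> \<phi> \<Longrightarrow> (LINT x|lborel. f0 x * partial_deriv i \<phi> x) = - (LINT x|lborel. u i x * \<phi> x)" by blast
      from weak_gradientI[OF assms(1) fm f0m f0 this] show False using False by blast
    qed
    from ball_energy_tendsto_infinity[OF this]
    have "((\<lambda>s. ennreal (1 - s) * ball_energy \<Omega> \<rho> f0 p (p * (1 - s))) \<longlongrightarrow> \<infinity>) (at_left 1)" .
    moreover have "K_const i p * grad_energy \<Omega> f p = \<infinity>"
      using False K_const_pos_finite(1)[OF assms(7), of i] by (simp add: grad_energy_def ennreal_mult_top)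
    ultimately show ?thesis unfolding energy by simp
  qed
qed

end
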